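(* (i) Assume that there exist four constants $C,c>0$ and $\gamma,\kappa>0$ such that $$\mathbb{E}_x(Z_t)\ge c\,e^{-\kappa t}\quad\forall t\in I,\ \forall x\in E,$$ $$\mathbb{E}_{(x,y)}[d(X_t,Y_t)]\le C\,e^{-\gamma t}\,d(x,y)\quad\forall t\in I,\ \forall x,y\in E,$$ for some Markovian coupling $\mathbb{P}_{(x,y)}$ of $\mathbb{P}_x$ and $\mathbb{P}_y$, and $\gamma>\kappa-\inf_E\rho$. Then condition (A) holds with $C_A=C/c$ and $\gamma_A=\gamma-\kappa+\inf_E\rho$. (ii) Let $I=[0,+\infty)$. Assume that there exists a Markovian coupling $(\mathbb{P}_{(x,y)})_{x,y\in E}$ of the non-penalized process $X$ with extended generator $L^c$ such that $d$ belongs to its domain and $$\sigma:=\sup_{x\ne y}\left(\frac{L^cd(x,y)}{d(x,y)}-\rho(x)+\|\rho\|_\infty\right)<0.$$ Then condition (A) holds with $C_A=1$ and $\gamma_A=-\sigma$. Here condition (A) with constants $C_A,\gamma_A>0$ means: for all $x,y\in E$ there exists a Markovian coupling $\mathbb{P}_{(x,y)}$ between $\mathbb{P}_x$ and $\mathbb{P}_y$ such that for all $t\in I$, $\mathbb{E}_{(x,y)}[G^X_t\, d(X_t,Y_t)]\le C_A e^{-\gamma_A t}d(x,y)$.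
   Context: Setting. $(E,d)$ is a Polish space whose distance satisfies $d\le\bar d$ on $E\times E$ for a finite constant $\bar d$. The time set $I$ is either $[0,+\infty)$ or $\mathbb{Z}_+$. $(\Omega,(\mathcal F_t)_{t\in I},(\mathbb{P}_x)_{x\in E},(X_t)_{t\in I})$ is a time-homogeneous Markov process in $E$ with $\mathbb{P}_x(X_0=x)=1$; $\mathbb{E}_x$ is the expectation under $\mathbb{P}_x$. The function $\rho:E\to\mathbb{R}_+$ is $d$-Lipschitz (hence bounded), and $\|\rho\|_\infty=\sup_E\rho$. The penalization is $Z_t=Z_t(X)=e^{-\int_0^t\rho(X_s)ds}$ if $I=[0,+\infty)$ (the integral being assumed well defined), and $Z_t=Z_t(X)=p(X_0)p(X_1)\cdots p(X_{t-1})$ with $p=e^{-\rho}$ (and $Z_0=1$) if $I=\mathbb{Z}_+$. Couplings. A coupling measure between $\mathbb{P}_x$ and $\mathbb{P}_y$ is a probability measure $\mathbb{P}_{(x,y)}$ on a space carrying $(X_t,Y_t)_{t\in I}$ such that $(X_t)$ has the law of $X$ under $\mathbb{P}_x$ and $(Y_t)$ the law of $X$ under $\mathbb{P}_y$. It is Markovian if $(X_t,Y_t)_{t\in I}$ is Markov with respect to its natural filtration; the couplings are understood as a family $(\mathbb{P}_{(x,y)})_{x,y\in E}$ of laws of a time-homogeneous Markov process on $E\times E$ started from $(x,y)$ (conditionally on the past up to time $t$, the process shifted by $t$ has law $\mathbb{P}_{(X_t,Y_t)}$). Write $Z^X_t=Z_t(X)$ and $G^X_t=Z^X_t/\mathbb{E}_xZ_t$.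 That $d$ belongs to the domain of the extended generator $L^c$ of the coupled process means that there is a measurable function $L^cd$ on $E\times E$ such that $d(X_t,Y_t)-d(x,y)-\int_0^tL^cd(X_s,Y_s)\,ds$ is a local martingale under $\mathbb{P}_{(x,y)}$ for all $x,y\in E$. *)

theory Defs
  imports "HOL-Probability.Probability"
begin

text \<open>
  Both time sets are subsets of the reals: \<open>{0..}\<close> and \<open>\<nat>\<close>. A process is a function
  \<open>real \<Rightarrow> 'w \<Rightarrow> 's\<close> of which only the values at times in \<open>I\<close> matter. A measurable space
  \<open>(\<Omega>, \<F>)\<close> carrying several probability measures is given by a \<open>'w measure\<close> \<open>N\<close> of which
  only \<open>space N\<close> and \<open>sets N\<close> are used.
\<close>

definition natural_filtration ::
    "'w measure \<Rightarrow> real set \<Rightarrow> (real \<Rightarrow> 'w \<Rightarrow> 's::topological_space) \<Rightarrow> real \<Rightarrow> 'w measure" where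
  "natural_filtration N I X t =
     sigma (space N) {X s -` A \<inter> space N | s A. s \<in> I \<and> s \<le> t \<and> A \<in> sets borel}"

definition path_law ::
    "real set \<Rightarrow> 'w measure \<Rightarrow> (real \<Rightarrow> 'w \<Rightarrow> 's::topological_space) \<Rightarrow> (real \<Rightarrow> 's) measure" where
  "path_law I M X = distr M (\<Pi>\<^sub>M t\<in>I. borel) (\<lambda>\<omega>. \<lambda>t\<in>I. X t \<omega>)"

text \<open>
  Joint measurability of \<open>(t, \<omega>) \<mapsto> X\<^sub>t(\<omega>)\<close> is what makes \<open>\<integral>\<^sub>0\<^sup>t g(X\<^sub>s) ds\<close> a well defined random
  variable for bounded measurable \<open>g\<close>; for \<open>I = \<nat>\<close> it only says that every \<open>X\<^sub>t\<close> is
  measurable.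
\<close>

locale markov_process =
  fixes N :: "'w measure"
    and I :: "real set"
    and F :: "real \<Rightarrow> 'w measure"
    and P :: "'s::topological_space \<Rightarrow> 'w measure"
    and X :: "real \<Rightarrow> 'w \<Rightarrow> 's"
  assumes prob_space_P: "\<And>x. prob_space (P x)"
    and sets_P: "\<And>x. sets (P x) = sets N"
    and subalgebra_F: "\<And>t. t \<in> I \<Longrightarrow> subalgebra N (F t)"
    and mono_F: "\<And>s t. s \<in> I \<Longrightarrow> t \<in> I \<Longrightarrow> s \<le> t \<Longrightarrow> sets (F s) \<subseteq> sets (F t)"
    and measurable_X: "(\<lambda>(t, \<omega>). X t \<omega>) \<in> restrict_space borel I \<Otimes>\<^sub>M N \<rightarrow>\<^sub>M borel"
    and adapted_X: "\<And>t. t \<in> I \<Longrightarrow> X t \<in> F t \<rightarrow>\<^sub>M borel"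
    and start: "\<And>x. AE \<omega> in P x. X 0 \<omega> = x"
    and measurable_law:
      "\<And>A. A \<in> sets (\<Pi>\<^sub>M t\<in>I. borel) \<Longrightarrow>
        (\<lambda>x. measure (path_law I (P x) X) A) \<in> borel_measurable borel"
    and markov:
      "\<And>x t A. t \<in> I \<Longrightarrow> A \<in> sets (\<Pi>\<^sub>M t\<in>I. borel) \<Longrightarrow>
        AE \<omega> in P x.
          real_cond_exp (P x) (F t) (indicator {\<omega>' \<in> space N. (\<lambda>s\<in>I. X (t + s) \<omega>') \<in> A}) \<omega>
            = measure (path_law I (P (X t \<omega>)) X) A"

text \<open>\<open>Q (x, y)\<close> is the coupling measure of \<open>P x\<close> and \<open>P y\<close>, and \<open>(U, V)\<close> the coupled process.\<close>

definition markovian_coupling ::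
    "real set \<Rightarrow> ('e::topological_space \<Rightarrow> 'w measure) \<Rightarrow> (real \<Rightarrow> 'w \<Rightarrow> 'e) \<Rightarrow>
     'v measure \<Rightarrow> ('e \<times> 'e \<Rightarrow> 'v measure) \<Rightarrow> (real \<Rightarrow> 'v \<Rightarrow> 'e) \<Rightarrow> (real \<Rightarrow> 'v \<Rightarrow> 'e) \<Rightarrow> bool" where
  "markovian_coupling I P X N Q U V \<longleftrightarrow>
     markov_process N I (natural_filtration N I (\<lambda>t \<omega>. (U t \<omega>, V t \<omega>))) Q (\<lambda>t \<omega>. (U t \<omega>, V t \<omega>)) \<and>
     (\<forall>x y. path_law I (Q (x, y)) U = path_law I (P x) X \<and>
            path_law I (Q (x, y)) V = path_law I (P y) X)"

definition penalization ::
    "real set \<Rightarrow> ('e \<Rightarrow> real) \<Rightarrow> (real \<Rightarrow> 'w \<Rightarrow> 'e) \<Rightarrow> real \<Rightarrow> 'w \<Rightarrow> real" where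
  "penalization I \<rho> X t \<omega> =
     (if I = \<nat> then \<Prod>n<nat \<lfloor>t\<rfloor>. exp (- \<rho> (X (real n) \<omega>))
      else exp (- (LBINT s:{0..t}. \<rho> (X s \<omega>))))"

text \<open>
  The type argument \<open>'v\<close> is the type of the sample points on which the coupling is realised,
  since HOL cannot quantify over it. The couplings form one Markov family indexed by the starting
  points.
\<close>

definition condition_A ::
    "'v itself \<Rightarrow> real set \<Rightarrow> ('e::metric_space \<Rightarrow> real) \<Rightarrow> ('e \<Rightarrow> 'w measure) \<Rightarrow> (real \<Rightarrow> 'w \<Rightarrow> 'e) \<Rightarrow>
     real \<Rightarrow> real \<Rightarrow> bool" where
  "condition_A _ I \<rho> P X C\<^sub>A \<gamma>\<^sub>A \<longleftrightarrow>
     0 < C\<^sub>A \<and> 0 < \<gamma>\<^sub>A \<and>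
     (\<exists>(N :: 'v measure) Q U V. markovian_coupling I P X N Q U V \<and>
        (\<forall>x y. \<forall>t\<in>I.
          (\<integral>\<omega>. penalization I \<rho> U t \<omega> / (\<integral>\<omega>'. penalization I \<rho> X t \<omega>' \<partial>P x)
                 * dist (U t \<omega>) (V t \<omega>) \<partial>Q (x, y))
            \<le> C\<^sub>A * exp (- \<gamma>\<^sub>A * t) * dist x y))"

definition martingale ::
    "'w measure \<Rightarrow> (real \<Rightarrow> 'w measure) \<Rightarrow> (real \<Rightarrow> 'w \<Rightarrow> real) \<Rightarrow> bool" where
  "martingale M F S \<longleftrightarrow>
     (\<forall>t\<ge>0. subalgebra M (F t) \<and> S t \<in> borel_measurable (F t) \<and> integrable M (S t)) \<and>
     (\<forall>s\<ge>0. \<forall>t\<ge>s. AE \<omega> in M. real_cond_exp M (F s) (S t) \<omega> = S s \<omega>)"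

text \<open>
  Real-valued localizing times lose nothing: an extended-valued localizing sequence \<open>\<tau>\<^sub>n\<close> can be
  replaced by \<open>min \<tau>\<^sub>n n\<close>.
\<close>

definition local_martingale ::
    "'w measure \<Rightarrow> (real \<Rightarrow> 'w measure) \<Rightarrow> (real \<Rightarrow> 'w \<Rightarrow> real) \<Rightarrow> bool" where
  "local_martingale M F S \<longleftrightarrow>
     (\<forall>t\<ge>0. S t \<in> borel_measurable (F t)) \<and>
     (\<exists>\<tau> :: nat \<Rightarrow> 'w \<Rightarrow> real.
        (\<forall>n. stopping_time F (\<tau> n) \<and> (\<forall>\<omega>\<in>space M. 0 \<le> \<tau> n \<omega>)) \<and>
        (AE \<omega> in M. incseq (\<lambda>n. \<tau> n \<omega>) \<and> filterlim (\<lambda>n. \<tau> n \<omega>) at_top sequentially) \<and>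
        (\<forall>n. martingale M F (\<lambda>t \<omega>. S (min t (\<tau> n \<omega>)) \<omega>)))"

text \<open>
  \<open>extended_generator N Q W f g\<close>: \<open>f\<close> belongs to the domain of the extended generator of the
  continuous-time Markov process \<open>(Q, W)\<close>, with \<open>g\<close> as (a version of) its image.
\<close>

definition extended_generator ::
    "'w measure \<Rightarrow> ('s::topological_space \<Rightarrow> 'w measure) \<Rightarrow> (real \<Rightarrow> 'w \<Rightarrow> 's) \<Rightarrow>
     ('s \<Rightarrow> real) \<Rightarrow> ('s \<Rightarrow> real) \<Rightarrow> bool" where
  "extended_generator N Q W f g \<longleftrightarrow>
     g \<in> borel_measurable borel \<and>
     (\<forall>z. (AE \<omega> in Q z. \<forall>t\<ge>0. set_integrable lborel {0..t} (\<lambda>s. g (W s \<omega>))) \<and>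
          local_martingale (Q z) (natural_filtration N {0..} W)
            (\<lambda>t \<omega>. f (W t \<omega>) - f z - (LBINT s:{0..t}. g (W s \<omega>))))"

end

theory Submission
  imports Defs
begin

text \<open>
  Part (i) is the bound \<open>Z\<^sub>t \<le> exp (- t * inf \<rho>)\<close>. In part (ii) the hypothesis does not control
  \<open>L\<^sup>c d\<close> on the diagonal, and the given coupling may well separate after a meeting. It is
  replaced by the coalesced coupling, in which the second component copies the first one as soon as
  the pair has spent a positive amount of time on the diagonal.

  The paths are merely measurable and there is no strong Markov property, so three points need care.
  First, \<open>exp (t * (sup \<rho> - \<sigma>)) * Z\<^sub>t * d (X\<^sub>t, Y\<^sub>t)\<close>, restricted to the event that no time has been
  spent on the diagonal, is a supermartingale: integrate by parts against exponential weights that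
  punish time on the diagonal. Second, this supermartingale cannot come back from zero, and the
  distance tends to zero along the rationals to the right of almost every time spent on the diagonal; hence the
  coalescence is visible on the rational times, which makes the coalesced law measurable in the
  starting point. Third, coalescence preserves the law of the second component: switching at rate
  \<open>m\<close> while on the diagonal does so by the Markov property at fixed times, and \<open>m\<close> tends to infinity.
\<close>

section \<open>Integration on a time interval\<close>

text \<open>Put \<open>R = sup \<rho>\<close> and \<open>lam = R - \<sigma>\<close>. Off the
  diagonal the hypothesis of part (ii) bounds the generator of the distance by
  \<open>- (lam - \<rho> x) * dist x y\<close>. The summand \<open>R\<close> in it pays for the
  normalisation: the penalization has expectation at least \<open>exp (- R * t)\<close>, which
  cancels \<open>R\<close> exactly; hence the constant 1 and the rate \<open>- \<sigma>\<close>.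
  What replaces a first meeting time is Lebesgue measure on the time axis. A random time with an
  adapted density can be treated by Fubini's theorem and the Markov or martingale property at each
  deterministic time, and a null set of times is invisible to a drift that enters through a time
  integral. So meeting is measured by occupation time, stopping becomes an exponential weight of
  large rate, and integration by parts against such weights takes the place of stochastic calculus.
  The weights also tame the drift, which is integrable along almost every path but perhaps not in
  expectation: a rate that dominates its absolute value keeps the weighted terms bounded uniformly
  in the localisation.\<close>

lemma LBINT_singleton [simp]: "(LBINT s:{a}. z s) = 0" for z :: "real \<Rightarrow> real"
proof -
  have "AE s in lborel. indicator {a} s *\<^sub>R z s = 0"
    using AE_lborel_singleton[of a] by (rule AE_mp) (simp add: indicator_def)
  then show ?thesis unfolding set_lebesgue_integral_def by (rule integral_eq_zero_AE)
qed

lemma LBINT_split: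
  fixes x :: "real \<Rightarrow> real"
  assumes "set_integrable lborel {a..t} x" "a \<le> c" "c \<le> t"
  shows "(LBINT s:{a..t}. x s) = (LBINT s:{a..c}. x s) + (LBINT s:{c..t}. x s)"
proof -
  have 1: "set_integrable lborel {a..c} x" "set_integrable lborel {c..t} x"
    using assms by (auto intro: set_integrable_subset)
  show ?thesis
    unfolding set_borel_integral_eq_integral(2)[OF assms(1)] set_borel_integral_eq_integral(2)[OF 1(1)]
      set_borel_integral_eq_integral(2)[OF 1(2)]
    using Henstock_Kurzweil_Integration.integral_combine[OF assms(2,3) set_borel_integral_eq_integral(1)[OF assms(1)]]
    by simp
qed

lemma LBINT_continuous_on:
  fixes x :: "real \<Rightarrow> real"
  assumes "set_integrable lborel {a..t} x"
  shows "continuous_on {a..t} (\<lambda>s. LBINT u:{a..s}. x u)"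
proof -
  have "continuous_on {a..t} (\<lambda>s. integral {a..s} x)"
    by (intro indefinite_integral_continuous_1 set_borel_integral_eq_integral(1) assms)
  moreover have "(LBINT u:{a..s}. x u) = integral {a..s} x" if "s \<in> {a..t}" for s
    using assms that by (intro set_borel_integral_eq_integral(2)) (auto intro: set_integrable_subset)
  ultimately show ?thesis using continuous_on_cong by (metis (no_types, lifting))
qed

lemma set_integrable_continuous_mult:
  fixes x y :: "real \<Rightarrow> real"
  assumes "continuous_on {a..t} y" "set_integrable lborel {a..t} x"
  shows "set_integrable lborel {a..t} (\<lambda>s. y s * x s)"
proof -
  obtain C where C: "\<And>s. s \<in> {a..t} \<Longrightarrow> \<bar>y s\<bar> \<le> C"
    using compact_imp_bounded[OF compact_continuous_image[OF assms(1) compact_Icc]]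
    by (force simp: bounded_iff)
  have m: "(\<lambda>s. indicator {a..t} s *\<^sub>R y s) \<in> borel_measurable borel"
    by (rule borel_measurable_continuous_on_indicator) (use assms(1) in auto)
  have i: "integrable lborel (\<lambda>s. indicator {a..t} s *\<^sub>R x s)"
    using assms(2) by (simp add: set_integrable_def)
  have "integrable lborel (\<lambda>s. C * (indicator {a..t} s *\<^sub>R x s))"
    using i by simp
  then have "integrable lborel (\<lambda>s. (indicator {a..t} s *\<^sub>R y s) * (indicator {a..t} s *\<^sub>R x s))"
  proof (rule Bochner_Integration.integrable_bound)
    show "(\<lambda>s. (indicator {a..t} s *\<^sub>R y s) * (indicator {a..t} s *\<^sub>R x s)) \<in> borel_measurable lborel"
      using m borel_measurable_integrable[OF i] by simp
    show "AE s in lborel. norm ((indicator {a..t} s *\<^sub>R y s) * (indicator {a..t} s *\<^sub>R x s))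
        \<le> norm (C * (indicator {a..t} s *\<^sub>R x s))"
      using C by (intro AE_I2) (force simp: indicator_def abs_mult intro!: mult_right_mono)
  qed
  also have "(\<lambda>s. (indicator {a..t} s *\<^sub>R y s) * (indicator {a..t} s *\<^sub>R x s))
      = (\<lambda>s. indicator {a..t} s *\<^sub>R (y s * x s))"
    by (simp add: fun_eq_iff indicator_def)
  finally show ?thesis by (simp add: set_integrable_def)
qed

section \<open>Integration by parts and the chain rule for absolutely continuous functions\<close>

text \<open>Stands in for differentiation: the functions treated below are time integrals of merely
  integrable densities and need not be differentiable everywhere. A fine partition and a telescoping
  sum bound the total increment of \<open>h\<close> by
  \<open>\<epsilon> * (\<Gamma> t - \<Gamma> a)\<close> for every \<open>\<epsilon>\<close>.\<close>

lemma eq_if_locally_small_increments: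
  fixes h \<Gamma> :: "real \<Rightarrow> real"
  assumes at: "a \<le> t"
    and small: "\<And>\<epsilon>. \<epsilon> > 0 \<Longrightarrow> \<exists>\<delta>>0. \<forall>u v. a \<le> u \<longrightarrow> u \<le> v \<longrightarrow> v \<le> t \<longrightarrow> v - u < \<delta> \<longrightarrow>
      \<bar>h v - h u\<bar> \<le> \<epsilon> * (\<Gamma> v - \<Gamma> u)"
  shows "h t = h a"
proof -
  have le: "\<bar>h t - h a\<bar> \<le> \<epsilon> * (\<Gamma> t - \<Gamma> a)" if e: "\<epsilon> > 0" for \<epsilon>
  proof -
    obtain \<delta> where \<delta>: "\<delta> > 0" "\<And>u v. a \<le> u \<Longrightarrow> u \<le> v \<Longrightarrow> v \<le> t \<Longrightarrow> v - u < \<delta> \<Longrightarrow>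
      \<bar>h v - h u\<bar> \<le> \<epsilon> * (\<Gamma> v - \<Gamma> u)"
      using small[OF e] by blast
    obtain n :: nat where n: "(t - a) / \<delta> < real n" using reals_Archimedean2 by blast
    define N where "N = Suc n"
    have N: "(t - a) / N < \<delta>" "0 < real N"
      using n \<delta>(1) by (auto simp: N_def field_simps intro: less_le_trans)
    define p where "p i = a + real i * ((t - a) / N)" for i :: nat
    have p0: "p 0 = a" and pN: "p N = t" using N by (auto simp: p_def)
    have step: "\<bar>h (p (Suc i)) - h (p i)\<bar> \<le> \<epsilon> * (\<Gamma> (p (Suc i)) - \<Gamma> (p i))" if "i < N" for i
    proof (rule \<delta>(2))
      show "a \<le> p i" using assms(1) N by (simp add: p_def)
      show "p i \<le> p (Suc i)" 
        unfolding p_def using at by (intro add_left_mono mult_right_mono) auto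
      have "real (Suc i) * ((t - a) / N) \<le> real N * ((t - a) / N)"
        using that assms(1) by (intro mult_right_mono) auto
      then show "p (Suc i) \<le> t" using N by (simp add: p_def)
      have "p (Suc i) - p i = (t - a) / N" unfolding p_def by (simp only: of_nat_Suc distrib_right)
      then show "p (Suc i) - p i < \<delta>" using N by simp
    qed
    have "\<bar>h t - h a\<bar> = \<bar>\<Sum>i<N. h (p (Suc i)) - h (p i)\<bar>"
      by (simp add: sum_lessThan_telescope[of "\<lambda>i. h (p i)"] p0 pN)
    also have "\<dots> \<le> (\<Sum>i<N. \<epsilon> * (\<Gamma> (p (Suc i)) - \<Gamma> (p i)))"
      by (rule order_trans[OF sum_abs sum_mono]) (use step in auto)
    also have "\<dots> = \<epsilon> * (\<Gamma> t - \<Gamma> a)"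
      by (simp add: sum_distrib_left[symmetric] sum_lessThan_telescope[of "\<lambda>i. \<Gamma> (p i)"] p0 pN)
    finally show ?thesis .
  qed
  have "\<bar>h t - h a\<bar> \<le> 0"
  proof (rule field_le_epsilon)
    fix e :: real assume e: "e > 0"
    \<comment> \<open>The added 1 keeps the divisor positive when the total increment of
      \<open>\<Gamma>\<close> is 0.\<close>
    have "\<bar>h t - h a\<bar> \<le> e / (1 + \<bar>\<Gamma> t - \<Gamma> a\<bar>) * (\<Gamma> t - \<Gamma> a)"
      by (rule le) (use e in \<open>simp add: add_pos_nonneg\<close>)
    also have "\<dots> \<le> e / (1 + \<bar>\<Gamma> t - \<Gamma> a\<bar>) * (1 + \<bar>\<Gamma> t - \<Gamma> a\<bar>)"
      using e by (intro mult_left_mono) auto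
    also have "\<dots> = e" by simp
    finally show "\<bar>h t - h a\<bar> \<le> 0 + e" by simp
  qed
  then show ?thesis by simp
qed

lemma LBINT_abs_le:
  fixes x :: "real \<Rightarrow> real"
  assumes "set_integrable lborel A x" "set_integrable lborel A y" "\<And>s. s \<in> A \<Longrightarrow> \<bar>x s\<bar> \<le> y s"
  shows "\<bar>LBINT s:A. x s\<bar> \<le> (LBINT s:A. y s)"
proof -
  have "\<bar>LBINT s:A. x s\<bar> \<le> (LBINT s:A. \<bar>x s\<bar>)"
    using integral_norm_bound[of lborel "\<lambda>s. indicator A s *\<^sub>R x s"]
    by (simp add: set_lebesgue_integral_def abs_mult)
  also have "\<dots> \<le> (LBINT s:A. y s)"
    using assms by (intro set_integral_mono set_integrable_abs)
  finally show ?thesis .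
qed

text \<open>Over a short interval from \<open>u\<close> to \<open>v\<close> the defect
  \<open>h\<close> of the formula changes by the integral of
  \<open>(X v - X s) * y s + (Y u - Y s) * x s\<close>. Uniform continuity of \<open>X\<close> and
  \<open>Y\<close> makes this small compared with the integral of
  \<open>\<bar>x\<bar> + \<bar>y\<bar>\<close>.\<close>

lemma LBINT_product_rule:
  fixes x y :: "real \<Rightarrow> real"
  assumes "a \<le> t" "set_integrable lborel {a..t} x" "set_integrable lborel {a..t} y"
  defines "X \<equiv> \<lambda>s. LBINT u:{a..s}. x u" and "Y \<equiv> \<lambda>s. LBINT u:{a..s}. y u"
  shows "(LBINT s:{a..t}. X s * y s) + (LBINT s:{a..t}. Y s * x s) = X t * Y t"
proof -
  have cX: "continuous_on {a..t} X" and cY: "continuous_on {a..t} Y"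
    unfolding X_def Y_def by (auto intro!: LBINT_continuous_on assms)
  have iXy: "set_integrable lborel {a..t} (\<lambda>s. X s * y s)" and iYx: "set_integrable lborel {a..t} (\<lambda>s. Y s * x s)"
    by (auto intro!: set_integrable_continuous_mult cX cY assms)
  define h where "h s = X s * Y s - (LBINT s:{a..s}. X s * y s) - (LBINT s:{a..s}. Y s * x s)" for s
  have int_xy: "set_integrable lborel {a..t} (\<lambda>s. \<bar>x s\<bar> + \<bar>y s\<bar>)"
    using assms by (intro set_integral_add set_integrable_abs)
  have "h t = h a"
  proof (rule eq_if_locally_small_increments[OF assms(1), where \<Gamma> = "\<lambda>s. LBINT u:{a..s}. \<bar>x u\<bar> + \<bar>y u\<bar>"])
    fix \<epsilon> :: real assume e: "\<epsilon> > 0"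
    have "uniformly_continuous_on {a..t} X" "uniformly_continuous_on {a..t} Y"
      using cX cY by (auto intro: compact_uniformly_continuous)
    from this(1) obtain d1 where d1: "d1 > 0"
      "\<And>u v. u \<in> {a..t} \<Longrightarrow> v \<in> {a..t} \<Longrightarrow> dist u v < d1 \<Longrightarrow> dist (X u) (X v) < \<epsilon>"
      using e unfolding uniformly_continuous_on_def by meson
    from \<open>uniformly_continuous_on {a..t} Y\<close> obtain d2 where d2: "d2 > 0"
      "\<And>u v. u \<in> {a..t} \<Longrightarrow> v \<in> {a..t} \<Longrightarrow> dist u v < d2 \<Longrightarrow> dist (Y u) (Y v) < \<epsilon>"
      using e unfolding uniformly_continuous_on_def by meson
    note d = d1(1) d2(1) d1(2) d2(2)
    show "\<exists>\<delta>>0. \<forall>u v. a \<le> u \<longrightarrow> u \<le> v \<longrightarrow> v \<le> t \<longrightarrow> v - u < \<delta> \<longrightarrow>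
      \<bar>h v - h u\<bar> \<le> \<epsilon> * ((LBINT u:{a..v}. \<bar>x u\<bar> + \<bar>y u\<bar>) - (LBINT u:{a..u}. \<bar>x u\<bar> + \<bar>y u\<bar>))"
    proof (intro exI[of _ "min d1 d2"] conjI allI impI)
      show "min d1 d2 > 0" using d by simp
      fix u v assume uv: "a \<le> u" "u \<le> v" "v \<le> t" "v - u < min d1 d2"
      have sub: "set_integrable lborel {u..v} z" "set_integrable lborel {a..v} z"
        if "set_integrable lborel {a..t} z" for z :: "real \<Rightarrow> real"
        using that uv by (auto intro: set_integrable_subset)
      have spl: "(LBINT s:{a..v}. z s) = (LBINT s:{a..u}. z s) + (LBINT s:{u..v}. z s)"
        if "set_integrable lborel {a..t} z" for z :: "real \<Rightarrow> real"
        using that uv by (intro LBINT_split sub)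
      have Xv: "X v = X u + (LBINT s:{u..v}. x s)" and Yv: "Y v = Y u + (LBINT s:{u..v}. y s)"
        unfolding X_def Y_def using assms by (auto intro!: spl)
      have "h v - h u = X v * Y v - X u * Y u - (LBINT s:{u..v}. X s * y s) - (LBINT s:{u..v}. Y s * x s)"
        unfolding h_def using spl[OF iXy] spl[OF iYx] by simp
      \<comment> \<open>Taking \<open>X\<close> at the right and \<open>Y\<close> at the left end
        point makes this expansion exact, without a second-order term.\<close>
      also have "X v * Y v - X u * Y u = (LBINT s:{u..v}. X v * y s) + (LBINT s:{u..v}. Y u * x s)"
      proof -
        have "X v * Y v - X u * Y u = X v * (LBINT s:{u..v}. y s) + Y u * (LBINT s:{u..v}. x s)"
          by (simp add: Xv Yv algebra_simps)
        then show ?thesis by simp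
      qed
      also have "(LBINT s:{u..v}. X v * y s) + (LBINT s:{u..v}. Y u * x s)
          - (LBINT s:{u..v}. X s * y s) - (LBINT s:{u..v}. Y s * x s)
        = (LBINT s:{u..v}. (X v * y s + Y u * x s) - (X s * y s + Y s * x s))"
        using sub[OF iXy] sub[OF iYx] sub[OF assms(2)] sub[OF assms(3)]
        by (simp add: set_integral_add set_integral_diff)
      finally have "\<bar>h v - h u\<bar> = \<bar>LBINT s:{u..v}. (X v * y s + Y u * x s) - (X s * y s + Y s * x s)\<bar>"
        by simp
      also have "\<dots> \<le> (LBINT s:{u..v}. \<epsilon> * (\<bar>x s\<bar> + \<bar>y s\<bar>))"
      proof (rule LBINT_abs_le)
        show "set_integrable lborel {u..v} (\<lambda>s. (X v * y s + Y u * x s) - (X s * y s + Y s * x s))"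
          using sub[OF iXy] sub[OF iYx] sub[OF assms(2)] sub[OF assms(3)]
          by (simp add: set_integral_add set_integral_diff)
        show "set_integrable lborel {u..v} (\<lambda>s. \<epsilon> * (\<bar>x s\<bar> + \<bar>y s\<bar>))"
          using sub[OF int_xy] by simp
        fix s assume s: "s \<in> {u..v}"
        have 1: "\<bar>X v - X s\<bar> \<le> \<epsilon>" "\<bar>Y u - Y s\<bar> \<le> \<epsilon>"
          using d(3)[of v s] d(4)[of u s] s uv by (auto simp: dist_real_def)
        have "(X v * y s + Y u * x s) - (X s * y s + Y s * x s) = (X v - X s) * y s + (Y u - Y s) * x s"
          by (simp add: algebra_simps)
        also have "\<bar>\<dots>\<bar> \<le> \<bar>X v - X s\<bar> * \<bar>y s\<bar> + \<bar>Y u - Y s\<bar> * \<bar>x s\<bar>"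
          by (rule order_trans[OF abs_triangle_ineq]) (simp add: abs_mult)
        also have "\<dots> \<le> \<epsilon> * \<bar>y s\<bar> + \<epsilon> * \<bar>x s\<bar>"
          using 1 by (intro add_mono mult_right_mono) auto
        finally show "\<bar>(X v * y s + Y u * x s) - (X s * y s + Y s * x s)\<bar> \<le> \<epsilon> * (\<bar>x s\<bar> + \<bar>y s\<bar>)"
          by (simp add: algebra_simps)
      qed
      also have "\<dots> = \<epsilon> * ((LBINT u:{a..v}. \<bar>x u\<bar> + \<bar>y u\<bar>) - (LBINT u:{a..u}. \<bar>x u\<bar> + \<bar>y u\<bar>))"
        using spl[OF int_xy] by simp
      finally show "\<bar>h v - h u\<bar> \<le> \<dots>" .
    qed
  qed
  then show ?thesis by (simp add: h_def X_def)
qed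

text \<open>The left-hand side is the mass that the rate \<open>b\<close> removes from the weight
  \<open>exp (- \<integral>b)\<close>; for nonnegative \<open>b\<close> it is at most 1, however
  large \<open>b\<close> is. The increments of the exponential come from the mean value theorem and
  are compared with the integral of \<open>\<phi> * b\<close> as in the product rule.\<close>

lemma LBINT_exp_chain_rule:
  fixes b :: "real \<Rightarrow> real"
  assumes "a \<le> t" "set_integrable lborel {a..t} b"
  shows "(LBINT s:{a..t}. exp (- (LBINT u:{a..s}. b u)) * b s) = 1 - exp (- (LBINT u:{a..t}. b u))"
proof -
  define B where "B s = (LBINT u:{a..s}. b u)" for s
  define \<phi> where "\<phi> s = exp (- B s)" for s
  have cB: "continuous_on {a..t} B"
    unfolding B_def by (auto intro!: LBINT_continuous_on assms)
  then have c: "continuous_on {a..t} \<phi>" unfolding \<phi>_def by (intro continuous_intros)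
  have i: "set_integrable lborel {a..t} (\<lambda>s. \<phi> s * b s)"
    by (auto intro!: set_integrable_continuous_mult c assms)
  have ib: "set_integrable lborel {a..t} (\<lambda>s. \<bar>b s\<bar>)"
    using assms by (intro set_integrable_abs)
  define h where "h s = \<phi> s + (LBINT s:{a..s}. \<phi> s * b s)" for s
  have "h t = h a"
  proof (rule eq_if_locally_small_increments[OF assms(1), where \<Gamma> = "\<lambda>s. LBINT u:{a..s}. \<bar>b u\<bar>"])
    fix \<epsilon> :: real assume e: "\<epsilon> > 0"
    have "uniformly_continuous_on {a..t} \<phi>"
      using c by (auto intro: compact_uniformly_continuous)
    then obtain d where d: "d > 0"
      "\<And>u v. u \<in> {a..t} \<Longrightarrow> v \<in> {a..t} \<Longrightarrow> dist u v < d \<Longrightarrow> dist (\<phi> u) (\<phi> v) < \<epsilon>"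
      using e unfolding uniformly_continuous_on_def by meson
    show "\<exists>\<delta>>0. \<forall>u v. a \<le> u \<longrightarrow> u \<le> v \<longrightarrow> v \<le> t \<longrightarrow> v - u < \<delta> \<longrightarrow>
      \<bar>h v - h u\<bar> \<le> \<epsilon> * ((LBINT u:{a..v}. \<bar>b u\<bar>) - (LBINT u:{a..u}. \<bar>b u\<bar>))"
    proof (intro exI[of _ d] conjI allI impI)
      show "d > 0" using d by simp
      fix u v assume uv: "a \<le> u" "u \<le> v" "v \<le> t" "v - u < d"
      have sub: "set_integrable lborel {u..v} z" "set_integrable lborel {a..v} z"
        if "set_integrable lborel {a..t} z" for z :: "real \<Rightarrow> real"
        using that uv by (auto intro: set_integrable_subset)
      have spl: "(LBINT s:{a..v}. z s) = (LBINT s:{a..u}. z s) + (LBINT s:{u..v}. z s)"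
        if "set_integrable lborel {a..t} z" for z :: "real \<Rightarrow> real"
        using that uv by (intro LBINT_split sub)
      have Bv: "B v = B u + (LBINT s:{u..v}. b s)"
        unfolding B_def using assms by (auto intro!: spl)
      \<comment> \<open>\<open>B\<close> need not be monotone because \<open>b\<close> may change
        sign, so the mean value theorem is applied in either order of \<open>B u\<close> and
        \<open>B v\<close>. In each case \<open>exp (- \<theta>)\<close> lies between
        \<open>\<phi> u\<close> and \<open>\<phi> v\<close>.\<close>
      obtain \<theta> where \<theta>: "\<phi> v - \<phi> u = - exp (- \<theta>) * (B v - B u)"
        "min (\<phi> u) (\<phi> v) \<le> exp (- \<theta>)" "exp (- \<theta>) \<le> max (\<phi> u) (\<phi> v)"
      proof -
        have D: "((\<lambda>x. exp (- x)) has_real_derivative - exp (- x)) (at x)" for x :: real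
          by (auto intro!: derivative_eq_intros)
        consider "B u < B v" | "B u > B v" | "B u = B v" by linarith
        then show ?thesis
        proof cases
          case 1
          with MVT2[of "B u" "B v" "\<lambda>x. exp (- x)" "\<lambda>x. - exp (- x)"] D
          obtain z where "z > B u" "z < B v" "exp (- B v) - exp (- B u) = (B v - B u) * - exp (- z)" by blast
          then show ?thesis by (intro that[of z]) (auto simp: \<phi>_def)
        next
          case 2
          with MVT2[of "B v" "B u" "\<lambda>x. exp (- x)" "\<lambda>x. - exp (- x)"] D
          obtain z where "z > B v" "z < B u" "exp (- B u) - exp (- B v) = (B u - B v) * - exp (- z)" by blast
          then show ?thesis by (intro that[of z]) (auto simp: \<phi>_def algebra_simps)
        next
          case 3
          then show ?thesis by (intro that[of "B u"]) (auto simp: \<phi>_def)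
        qed
      qed
      have "h v - h u = \<phi> v - \<phi> u + (LBINT s:{u..v}. \<phi> s * b s)"
        unfolding h_def using spl[OF i] by simp
      also have "\<phi> v - \<phi> u = - (LBINT s:{u..v}. exp (- \<theta>) * b s)"
        using \<theta>(1) by (simp add: Bv)
      finally have "\<bar>h v - h u\<bar> = \<bar>LBINT s:{u..v}. \<phi> s * b s - exp (- \<theta>) * b s\<bar>"
        using sub[OF i] sub[OF assms(2)] by (simp add: set_integral_diff)
      also have "\<dots> \<le> (LBINT s:{u..v}. \<epsilon> * \<bar>b s\<bar>)"
      proof (rule LBINT_abs_le)
        show "set_integrable lborel {u..v} (\<lambda>s. \<phi> s * b s - exp (- \<theta>) * b s)"
          using sub[OF i] sub[OF assms(2)] by (simp add: set_integral_diff)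
        show "set_integrable lborel {u..v} (\<lambda>s. \<epsilon> * \<bar>b s\<bar>)"
          using sub[OF ib] by simp
        fix s assume s: "s \<in> {u..v}"
        have "\<bar>\<phi> s - \<phi> u\<bar> \<le> \<epsilon>" "\<bar>\<phi> s - \<phi> v\<bar> \<le> \<epsilon>"
          using d(2)[of s u] d(2)[of s v] s uv by (auto simp: dist_real_def)
        then have 1: "\<bar>\<phi> s - exp (- \<theta>)\<bar> \<le> \<epsilon>" using \<theta>(2,3) by linarith
        have "\<phi> s * b s - exp (- \<theta>) * b s = (\<phi> s - exp (- \<theta>)) * b s" by (simp add: algebra_simps)
        then show "\<bar>\<phi> s * b s - exp (- \<theta>) * b s\<bar> \<le> \<epsilon> * \<bar>b s\<bar>"
          using 1 by (simp add: abs_mult mult_right_mono)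
      qed
      also have "\<dots> = \<epsilon> * ((LBINT u:{a..v}. \<bar>b u\<bar>) - (LBINT u:{a..u}. \<bar>b u\<bar>))"
        using spl[OF ib] by simp
      finally show "\<bar>h v - h u\<bar> \<le> \<dots>" .
    qed
  qed
  then show ?thesis by (simp add: h_def \<phi>_def B_def)
qed

section \<open>Joint measurability and Fubini's theorem over a time interval\<close>

text \<open>Moving the variable limit \<open>s\<close> into the integrand turns it into an ordinary
  parameter. Where a section is not integrable the integral is 0 by convention, which does not
  disturb measurability.\<close>

lemma borel_measurable_LBINT_Icc:
  fixes x :: "real \<Rightarrow> 'w \<Rightarrow> real"
  assumes "(\<lambda>(u, \<omega>). x u \<omega>) \<in> borel_measurable (borel \<Otimes>\<^sub>M M)"
  shows "(\<lambda>(s, \<omega>). LBINT u:{a..s}. x u \<omega>) \<in> borel_measurable (borel \<Otimes>\<^sub>M M)"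
proof -
  have "(\<lambda>q. (snd q, snd (fst q))) \<in> (borel \<Otimes>\<^sub>M M) \<Otimes>\<^sub>M lborel \<rightarrow>\<^sub>M (borel :: real measure) \<Otimes>\<^sub>M M" by measurable
  from measurable_compose[OF this assms]
  have [measurable]: "(\<lambda>q. x (snd q) (snd (fst q))) \<in> borel_measurable (((borel :: real measure) \<Otimes>\<^sub>M M) \<Otimes>\<^sub>M lborel)"
    by simp
  have "(\<lambda>p. LINT u|lborel. (if a \<le> u \<and> u \<le> fst p then x u (snd p) else 0)) \<in> borel_measurable (borel \<Otimes>\<^sub>M M)"
    by (rule lborel.borel_measurable_lebesgue_integral) (simp add: split_def)
  also have "(\<lambda>p. LINT u|lborel. (if a \<le> u \<and> u \<le> fst p then x u (snd p) else 0))
    = (\<lambda>(s, \<omega>). LBINT u:{a..s}. x u \<omega>)"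
    by (auto simp: fun_eq_iff set_lebesgue_integral_def intro!: Bochner_Integration.integral_cong)
  finally show ?thesis .
qed

lemma measurable_section_fst:
  "(\<lambda>(u, \<omega>). x u \<omega>) \<in> borel_measurable (borel \<Otimes>\<^sub>M M) \<Longrightarrow> x (s::real) \<in> borel_measurable M"
  using measurable_compose[of "\<lambda>\<omega>. (s, \<omega>)" M "borel \<Otimes>\<^sub>M M" "\<lambda>(u, \<omega>). x u \<omega>"] by simp

lemma measurable_section_snd:
  "(\<lambda>(u, \<omega>). x u \<omega>) \<in> borel_measurable (borel \<Otimes>\<^sub>M M) \<Longrightarrow> \<omega> \<in> space M \<Longrightarrow>
    (\<lambda>u::real. x u \<omega>) \<in> borel_measurable borel"
  using measurable_compose[of "\<lambda>u. (u, \<omega>)" borel "borel \<Otimes>\<^sub>M M" "\<lambda>(u, \<omega>). x u \<omega>"] by simp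

lemma set_integrable_const_Icc [simp]: "set_integrable lborel {a..t::real} (\<lambda>_. C::real)"
  by (rule borel_integrable_atLeastAtMost') simp

lemma LBINT_const_Icc: "a \<le> t \<Longrightarrow> (LBINT s:{a..t}. C) = C * (t - a)" for a t C :: real
  by (simp add: set_lebesgue_integral_def mult.commute)

lemma set_integrable_bounded_Icc:
  fixes x :: "real \<Rightarrow> real"
  assumes "x \<in> borel_measurable borel" "\<And>u. u \<in> {a..t} \<Longrightarrow> \<bar>x u\<bar> \<le> C"
  shows "set_integrable lborel {a..t} x"
  unfolding set_integrable_def
proof (rule Bochner_Integration.integrable_bound)
  show "integrable lborel (\<lambda>s. indicator {a..t} s * C)"
    using set_integrable_const_Icc[of a t C] by (simp add: set_integrable_def)
  show "(\<lambda>s. indicator {a..t} s *\<^sub>R x s) \<in> borel_measurable lborel" using assms(1) by simp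
  show "AE s in lborel. norm (indicator {a..t} s *\<^sub>R x s) \<le> norm (indicator {a..t} s * C)"
    using assms(2) by (intro AE_I2) (force simp: indicator_def)
qed

lemma LBINT_Icc_mono_set:
  fixes x :: "real \<Rightarrow> real"
  assumes "set_integrable lborel {a..t} x" "a \<le> s" "s \<le> t" "\<And>u. u \<in> {a..t} \<Longrightarrow> 0 \<le> x u"
  shows "(LBINT u:{a..s}. x u) \<le> (LBINT u:{a..t}. x u)" "0 \<le> (LBINT u:{a..s}. x u)"
proof -
  have n: "0 \<le> (LBINT u:{c..d}. x u)" if "a \<le> c" "d \<le> t" for c d
    unfolding set_lebesgue_integral_def using assms(4) that
    by (intro Bochner_Integration.integral_nonneg) (auto simp: indicator_def)
  then show "0 \<le> (LBINT u:{a..s}. x u)" using assms by simp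
  show "(LBINT u:{a..s}. x u) \<le> (LBINT u:{a..t}. x u)"
    using LBINT_split[OF assms(1-3)] n[of s t] assms by simp
qed

text \<open>Tonelli's theorem with the time integral inside. The pathwise bound \<open>c\<close> may
  be random, which admits terms proportional to an increment of a stopped process that is integrable
  but unbounded.\<close>

lemma integrable_pairI:
  fixes x :: "real \<Rightarrow> 'w \<Rightarrow> real"
  assumes "(\<lambda>(u, \<omega>). x u \<omega>) \<in> borel_measurable (borel \<Otimes>\<^sub>M M)"
    and "sigma_finite_measure M"
    and "AE \<omega> in M. set_integrable lborel {a..t} (\<lambda>u. x u \<omega>) \<and> (LBINT u:{a..t}. \<bar>x u \<omega>\<bar>) \<le> c \<omega>"
    and "integrable M c"
  shows "integrable (lborel \<Otimes>\<^sub>M M) (\<lambda>(u, \<omega>). indicator {a..t} u * x u \<omega>)"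
proof (rule integrableI_bounded)
  interpret M: sigma_finite_measure M by fact
  interpret pair_sigma_finite lborel M ..
  have m: "(\<lambda>(u, \<omega>). indicator {a..t} u * x u \<omega>) \<in> borel_measurable (borel \<Otimes>\<^sub>M M)"
    using assms(1) by (simp add: split_def)
  then show m': "(\<lambda>(u, \<omega>). indicator {a..t} u * x u \<omega>) \<in> borel_measurable (lborel \<Otimes>\<^sub>M M)"
    by (simp cong: measurable_cong_sets sets_pair_measure_cong)
  have "(\<integral>\<^sup>+ p. ennreal (norm (case p of (u, \<omega>) \<Rightarrow> indicator {a..t} u * x u \<omega>)) \<partial>(lborel \<Otimes>\<^sub>M M))
    = (\<integral>\<^sup>+ \<omega>. \<integral>\<^sup>+ u. ennreal (norm (indicator {a..t} u * x u \<omega>)) \<partial>lborel \<partial>M)"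
    by (subst nn_integral_snd[symmetric]) (use m' in auto)
  also have "\<dots> \<le> (\<integral>\<^sup>+ \<omega>. ennreal (norm (c \<omega>)) \<partial>M)"
  proof (rule nn_integral_mono_AE, use assms(3) in eventually_elim)
    case (elim \<omega>)
    then have i: "integrable lborel (\<lambda>u. indicator {a..t} u * x u \<omega>)"
      by (simp add: set_integrable_def)
    have "(\<integral>\<^sup>+ u. ennreal (norm (indicator {a..t} u * x u \<omega>)) \<partial>lborel)
        = ennreal (LINT u|lborel. norm (indicator {a..t} u * x u \<omega>))"
      by (rule nn_integral_eq_integral) (use i in auto)
    also have "(LINT u|lborel. norm (indicator {a..t} u * x u \<omega>)) = (LBINT u:{a..t}. \<bar>x u \<omega>\<bar>)"
      by (simp add: set_lebesgue_integral_def abs_mult)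
    also have "ennreal \<dots> \<le> ennreal (norm (c \<omega>))"
      using elim by (intro ennreal_leI) auto
    finally show ?case .
  qed
  also have "\<dots> < \<infinity>" using assms(4) by (simp add: integrable_iff_bounded)
  finally show "(\<integral>\<^sup>+ p. ennreal (norm (case p of (u, \<omega>) \<Rightarrow> indicator {a..t} u * x u \<omega>)) \<partial>(lborel \<Otimes>\<^sub>M M)) < \<infinity>" .
qed

text \<open>Integrability over the product makes \<open>x u\<close> integrable for almost every
  \<open>u\<close> only, so arguments at single times are later made for almost every time.\<close>

lemma Fubini_Icc:
  fixes x :: "real \<Rightarrow> 'w \<Rightarrow> real"
  assumes "sigma_finite_measure M"
    and i: "integrable (lborel \<Otimes>\<^sub>M M) (\<lambda>(u, \<omega>). indicator {a..t} u * x u \<omega>)"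
  shows "(\<integral>\<omega>. (LBINT u:{a..t}. x u \<omega>) \<partial>M) = (LBINT u:{a..t}. (\<integral>\<omega>. x u \<omega> \<partial>M))"
    and "integrable M (\<lambda>\<omega>. LBINT u:{a..t}. x u \<omega>)"
    and "AE u in lborel. u \<in> {a..t} \<longrightarrow> integrable M (x u)"
proof -
  interpret M: sigma_finite_measure M by fact
  interpret pair_sigma_finite lborel M ..
  show "(\<integral>\<omega>. (LBINT u:{a..t}. x u \<omega>) \<partial>M) = (LBINT u:{a..t}. (\<integral>\<omega>. x u \<omega> \<partial>M))"
    using Fubini_integral[OF i] by (simp add: set_lebesgue_integral_def)
  show "integrable M (\<lambda>\<omega>. LBINT u:{a..t}. x u \<omega>)"
    using integrable_snd[OF i] by (simp add: set_lebesgue_integral_def)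
  show "AE u in lborel. u \<in> {a..t} \<longrightarrow> integrable M (x u)"
    using AE_integrable_fst[OF i] by (rule AE_mp) (auto simp: indicator_def)
qed

text \<open>
  A measurable adapted process need not be progressively measurable, so the integral is only
  almost surely adapted: its difference from its conditional expectation is orthogonal to every
  \<open>x u\<close>, hence to the integral itself, and therefore vanishes.
\<close>

lemma (in prob_space) AE_adapted_LBINT_bounded:
  fixes x :: "real \<Rightarrow> 'a \<Rightarrow> real"
  assumes sub: "subalgebra M F"
    and x[measurable]: "(\<lambda>(u, \<omega>). x u \<omega>) \<in> borel_measurable (borel \<Otimes>\<^sub>M M)"
    and ad: "\<And>u. u \<in> {a..t} \<Longrightarrow> x u \<in> borel_measurable F"
    and bd: "\<And>u \<omega>. \<bar>x u \<omega>\<bar> \<le> C" and at: "a \<le> t"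
  shows "\<exists>Z\<in>borel_measurable F. AE \<omega> in M. (LBINT u:{a..t}. x u \<omega>) = Z \<omega>"
proof -
  interpret sigma_finite_subalgebra M F
    using sub by (simp add: finite_measure_subalgebra_is_sigma_finite finite_measure_subalgebra_def
        finite_measure_subalgebra_axioms_def finite_measure_axioms)
  define J where "J \<omega> = (LBINT u:{a..t}. x u \<omega>)" for \<omega>
  have mJ[measurable]: "J \<in> borel_measurable M"
    unfolding J_def by (rule measurable_section_fst[OF borel_measurable_LBINT_Icc[OF x]])
  have xi: "set_integrable lborel {a..t} (\<lambda>u. x u \<omega>)" if "\<omega> \<in> space M" for \<omega>
    by (rule set_integrable_bounded_Icc[of _ _ _ C]) (use measurable_section_snd[OF x that] bd in auto)
  have abs_int: "(LBINT u:{a..t}. \<bar>x u \<omega>\<bar>) \<le> C * (t - a)" if "\<omega> \<in> space M" for \<omega>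
  proof -
    have "(LBINT u:{a..t}. \<bar>x u \<omega>\<bar>) \<le> (LBINT u:{a..t}. C)"
      using xi[OF that] bd by (intro set_integral_mono set_integrable_abs) auto
    then show ?thesis using at by (simp add: LBINT_const_Icc)
  qed
  have bJ: "\<bar>J \<omega>\<bar> \<le> C * (t - a)" if "\<omega> \<in> space M" for \<omega>
    using LBINT_abs_le[OF xi[OF that] set_integrable_abs[OF xi[OF that]]] abs_int[OF that] by (simp add: J_def)
  define Z where "Z = real_cond_exp M F J"
  have iJ: "integrable M J"
    by (rule integrable_const_bound[where B = "C * (t - a)"]) (use bJ in \<open>auto intro!: AE_I2\<close>)
  have mZF[measurable]: "Z \<in> borel_measurable F" and mZ[measurable]: "Z \<in> borel_measurable M"
    unfolding Z_def by (auto intro: measurable_from_subalg[OF sub])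
  have iZ: "integrable M Z" unfolding Z_def using iJ by (rule real_cond_exp_int(1))
  have iYJ: "integrable M (\<lambda>\<omega>. Y \<omega> * J \<omega>)" if "integrable M Y" for Y
  proof (rule Bochner_Integration.integrable_bound)
    show "integrable M (\<lambda>\<omega>. C * (t - a) * Y \<omega>)" using that by simp
    show "(\<lambda>\<omega>. Y \<omega> * J \<omega>) \<in> borel_measurable M" using that by simp
    have "norm (Y \<omega> * J \<omega>) \<le> norm (C * (t - a) * Y \<omega>)" if "\<omega> \<in> space M" for \<omega>
    proof -
      have "norm (Y \<omega> * J \<omega>) = \<bar>J \<omega>\<bar> * \<bar>Y \<omega>\<bar>" by (simp add: abs_mult)
      also have "\<dots> \<le> \<bar>C * (t - a)\<bar> * \<bar>Y \<omega>\<bar>"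
        using bJ[OF that] by (intro mult_right_mono) auto
      finally show ?thesis by (simp add: abs_mult)
    qed
    then show "AE \<omega> in M. norm (Y \<omega> * J \<omega>) \<le> norm (C * (t - a) * Y \<omega>)" by (rule AE_I2)
  qed
  note ZJ = real_cond_exp_intg[OF iYJ[OF iZ] mZF mJ, folded Z_def]
  define H where "H \<omega> = J \<omega> - Z \<omega>" for \<omega>
  have iH: "integrable M H" unfolding H_def using iJ iZ by simp
  have mH[measurable]: "H \<in> borel_measurable M" unfolding H_def by simp
  have Hx: "(\<integral>\<omega>. H \<omega> * x u \<omega> \<partial>M) = 0" if "u \<in> {a..t}" for u
  proof -
    have [measurable]: "x u \<in> borel_measurable F" "x u \<in> borel_measurable M"
      using ad[OF that] measurable_section_fst[OF x] by auto
    have ix: "integrable M (x u)"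
      by (rule integrable_const_bound[where B = C]) (use bd in auto)
    have "integrable M (\<lambda>\<omega>. x u \<omega> * J \<omega>)" by (rule iYJ[OF ix])
    note c = real_cond_exp_intg[OF this \<open>x u \<in> borel_measurable F\<close> mJ, folded Z_def]
    show ?thesis using c iYJ[OF ix] by (simp add: H_def algebra_simps)
  qed
  have HJ: "(\<integral>\<omega>. H \<omega> * J \<omega> \<partial>M) = 0"
  proof -
    have "integrable (lborel \<Otimes>\<^sub>M M) (\<lambda>(u, \<omega>). indicator {a..t} u * (H \<omega> * x u \<omega>))"
    proof (rule integrable_pairI[where c = "\<lambda>\<omega>. \<bar>H \<omega>\<bar> * (C * (t - a))"])
      show "(\<lambda>(u, \<omega>). H \<omega> * x u \<omega>) \<in> borel_measurable (borel \<Otimes>\<^sub>M M)" by measurable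
      show "integrable M (\<lambda>\<omega>. \<bar>H \<omega>\<bar> * (C * (t - a)))" using iH by simp
      show "AE \<omega> in M. set_integrable lborel {a..t} (\<lambda>u. H \<omega> * x u \<omega>) \<and>
        (LBINT u:{a..t}. \<bar>H \<omega> * x u \<omega>\<bar>) \<le> \<bar>H \<omega>\<bar> * (C * (t - a))"
        using xi abs_int by (intro AE_I2) (auto simp: abs_mult intro!: mult_left_mono)
    qed unfold_locales
    note F = Fubini_Icc(1)[OF _ this]
    have "(\<integral>\<omega>. H \<omega> * J \<omega> \<partial>M) = (LBINT u:{a..t}. (\<integral>\<omega>. H \<omega> * x u \<omega> \<partial>M))"
      using F by (simp add: J_def sigma_finite_measure_axioms)
    also have "\<dots> = (LBINT u:{a..t}. 0)"
      by (intro set_lebesgue_integral_cong) (auto simp: Hx)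
    finally show ?thesis by (simp add: set_lebesgue_integral_def)
  qed
  have HZ: "(\<integral>\<omega>. H \<omega> * Z \<omega> \<partial>M) = 0"
    using ZJ iYJ[OF iZ] by (simp add: H_def algebra_simps)
  have iHJ: "integrable M (\<lambda>\<omega>. H \<omega> * J \<omega>)" by (rule iYJ[OF iH])
  have iHZ: "integrable M (\<lambda>\<omega>. H \<omega> * Z \<omega>)"
    using Bochner_Integration.integrable_diff[OF iYJ[OF iZ] ZJ(1)] by (simp add: H_def algebra_simps)
  have HH: "H \<omega> * H \<omega> = H \<omega> * J \<omega> - H \<omega> * Z \<omega>" for \<omega> by (simp add: H_def algebra_simps)
  have iHH: "integrable M (\<lambda>\<omega>. H \<omega> * H \<omega>)" unfolding HH using iHJ iHZ by simp
  have "(\<integral>\<omega>. H \<omega> * H \<omega> \<partial>M) = 0"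
    unfolding HH using HJ HZ iHJ iHZ by simp
  then have "AE \<omega> in M. H \<omega> * H \<omega> = 0"
    by (subst (asm) integral_nonneg_eq_0_iff_AE[OF iHH]) auto
  then have "AE \<omega> in M. J \<omega> = Z \<omega>" by eventually_elim (simp add: H_def)
  then show ?thesis using mZF by (auto simp: J_def)
qed

text \<open>The bounded case applies to the truncations \<open>y n\<close> of \<open>x\<close> at
  height \<open>n\<close>, whose integrals converge along almost every path by dominated
  convergence. The limit is taken with the total operator \<open>lim\<close>, so that it is
  \<open>F\<close>-measurable everywhere, also where the sequence diverges.\<close>

lemma (in prob_space) AE_adapted_LBINT:
  fixes x :: "real \<Rightarrow> 'a \<Rightarrow> real"
  assumes sub: "subalgebra M F"
    and x[measurable]: "(\<lambda>(u, \<omega>). x u \<omega>) \<in> borel_measurable (borel \<Otimes>\<^sub>M M)"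
    and ad: "\<And>u. u \<in> {a..t} \<Longrightarrow> x u \<in> borel_measurable F"
    and int: "AE \<omega> in M. set_integrable lborel {a..t} (\<lambda>u. x u \<omega>)" and at: "a \<le> t"
  shows "\<exists>Z\<in>borel_measurable F. AE \<omega> in M. (LBINT u:{a..t}. x u \<omega>) = Z \<omega>"
proof -
  define y where "y n u \<omega> = max (- real n) (min (real n) (x u \<omega>))" for n u \<omega>
  have "\<exists>Z\<in>borel_measurable F. AE \<omega> in M. (LBINT u:{a..t}. y n u \<omega>) = Z \<omega>" for n
  proof (rule AE_adapted_LBINT_bounded[OF sub, where C = n])
    show "(\<lambda>(u, \<omega>). y n u \<omega>) \<in> borel_measurable (borel \<Otimes>\<^sub>M M)" unfolding y_def by measurable
    show "y n u \<in> borel_measurable F" if "u \<in> {a..t}" for u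
      using ad[OF that] unfolding y_def by measurable
  qed (use at in \<open>auto simp: y_def\<close>)
  then obtain Z where Z: "\<And>n. Z n \<in> borel_measurable F"
    "\<And>n. AE \<omega> in M. (LBINT u:{a..t}. y n u \<omega>) = Z n \<omega>" by metis
  have "AE \<omega> in M. \<forall>n. (LBINT u:{a..t}. y n u \<omega>) = Z n \<omega>"
    using Z(2) by (simp add: AE_all_countable)
  then have "AE \<omega> in M. (\<lambda>n. Z n \<omega>) \<longlonglongrightarrow> (LBINT u:{a..t}. x u \<omega>)"
    using int AE_space
  proof eventually_elim
    case (elim \<omega>)
    have "(\<lambda>n. LBINT u:{a..t}. y n u \<omega>) \<longlonglongrightarrow> (LBINT u:{a..t}. x u \<omega>)"
      unfolding set_lebesgue_integral_def
    proof (rule integral_dominated_convergence[where w = "\<lambda>u. \<bar>indicator {a..t} u *\<^sub>R x u \<omega>\<bar>"])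
      have m[measurable]: "(\<lambda>u. x u \<omega>) \<in> borel_measurable borel" by (rule measurable_section_snd[OF x elim(3)])
      show "(\<lambda>u. indicator {a..t} u *\<^sub>R x u \<omega>) \<in> borel_measurable lborel" by simp
      show "(\<lambda>u. indicator {a..t} u *\<^sub>R y n u \<omega>) \<in> borel_measurable lborel" for n unfolding y_def by simp
      show "integrable lborel (\<lambda>u. \<bar>indicator {a..t} u *\<^sub>R x u \<omega>\<bar>)"
        using elim(2) unfolding set_integrable_def by (rule integrable_abs)
      show "AE u in lborel. (\<lambda>n. indicator {a..t} u *\<^sub>R y n u \<omega>) \<longlonglongrightarrow> indicator {a..t} u *\<^sub>R x u \<omega>"
      proof (intro AE_I2 tendsto_intros)
        fix u
        obtain N :: nat where N: "\<bar>x u \<omega>\<bar> \<le> real N" using real_arch_simple by blast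
        show "(\<lambda>n. y n u \<omega>) \<longlonglongrightarrow> x u \<omega>"
        proof (rule tendsto_eventually, rule eventually_sequentiallyI[of N])
          fix n assume "N \<le> n"
          then have "real N \<le> real n" by simp
          with N show "y n u \<omega> = x u \<omega>" unfolding y_def by linarith
        qed
      qed
      show "AE u in lborel. norm (indicator {a..t} u *\<^sub>R y n u \<omega>) \<le> \<bar>indicator {a..t} u *\<^sub>R x u \<omega>\<bar>" for n
        by (intro AE_I2) (auto simp: y_def indicator_def)
    qed
    with elim(1) show ?case by simp
  qed
  then have "AE \<omega> in M. (LBINT u:{a..t}. x u \<omega>) = lim (\<lambda>n. Z n \<omega>)"
    by eventually_elim (auto dest: limI)
  moreover have "(\<lambda>\<omega>. lim (\<lambda>n. Z n \<omega>)) \<in> borel_measurable F"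
    using Z(1) by (rule borel_measurable_lim_metric)
  ultimately show ?thesis by (auto intro!: bexI[of _ "\<lambda>\<omega>. lim (\<lambda>n. Z n \<omega>)"])
qed

section \<open>Exponential weights along a path\<close>

text \<open>One half of the decay absorbs the linear factor; the other half is kept to make the
  weight integrable against an unbounded rate.\<close>

lemma mult_exp_neg_half_le: "x * exp (- x) \<le> exp (- x / 2) * 2" if "0 \<le> x" for x :: real
proof -
  have "x / 2 \<le> exp (x / 2)" using exp_ge_add_one_self[of "x / 2"] by linarith
  then have "x / 2 * exp (- x) \<le> exp (x / 2) * exp (- x)" by (intro mult_right_mono) auto
  also have "\<dots> = exp (- x / 2)" by (simp add: exp_add[symmetric])
  finally show ?thesis by simp
qed

text \<open>One fixed path. \<open>k\<close> is the unbounded nonnegative part of the rate and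
  dominates the drift \<open>g\<close> up to the factor \<open>c\<close>; the bounded part
  \<open>b0\<close> costs at most the factor \<open>E0\<close>. The aim is bounds in terms of
  \<open>C0\<close>, \<open>c\<close> and \<open>t - a\<close> alone, hence uniform over
  paths.\<close>

locale path_weight =
  fixes a t C0 c :: real and b0 k g :: "real \<Rightarrow> real"
  assumes at: "a \<le> t"
    and int_b0: "set_integrable lborel {a..t} b0"
    and int_k: "set_integrable lborel {a..t} k"
    and int_g: "set_integrable lborel {a..t} g"
    and b0_le: "\<And>s. s \<in> {a..t} \<Longrightarrow> \<bar>b0 s\<bar> \<le> C0"
    and k_nonneg: "\<And>s. s \<in> {a..t} \<Longrightarrow> 0 \<le> k s"
    and g_le: "\<And>s. s \<in> {a..t} \<Longrightarrow> \<bar>g s\<bar> \<le> c * k s"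
    and c_nonneg: "0 \<le> c"
begin

definition "\<kappa> s = (LBINT u:{a..s}. k u)"
definition "\<eta> s = exp (- (LBINT u:{a..s}. b0 u + k u))"
definition "\<Gamma> s = (LBINT u:{a..s}. g u)"
definition "E0 = exp (C0 * (t - a))"

lemma C0_nonneg: "0 \<le> C0" using b0_le[of a] at by auto

lemma int_b: "set_integrable lborel {a..t} (\<lambda>u. b0 u + k u)"
  using int_b0 int_k by (rule set_integral_add)

lemma \<kappa>_nonneg: "s \<in> {a..t} \<Longrightarrow> 0 \<le> \<kappa> s"
  unfolding \<kappa>_def by (rule LBINT_Icc_mono_set[OF int_k]) (auto intro: k_nonneg)

lemma \<eta>_le: assumes "s \<in> {a..t}" shows "\<eta> s \<le> E0 * exp (- \<kappa> s)"
proof -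
  have sub: "set_integrable lborel {a..s} z" if "set_integrable lborel {a..t} z" for z :: "real \<Rightarrow> real"
    using that assms by (auto intro: set_integrable_subset)
  have "(LBINT u:{a..s}. - C0) \<le> (LBINT u:{a..s}. b0 u)"
    using assms by (intro set_integral_mono sub int_b0) (auto intro: b0_le[THEN abs_le_D2, THEN minus_le_iff[THEN iffD1]])
  then have "- C0 * (s - a) \<le> (LBINT u:{a..s}. b0 u)"
    using assms by (simp add: LBINT_const_Icc)
  moreover have "C0 * (s - a) \<le> C0 * (t - a)"
    using assms C0_nonneg by (intro mult_left_mono) auto
  ultimately have "- (LBINT u:{a..s}. b0 u + k u) \<le> C0 * (t - a) - \<kappa> s"
    by (simp add: \<kappa>_def set_integral_add(2)[OF sub[OF int_b0] sub[OF int_k]])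
  then have "\<eta> s \<le> exp (C0 * (t - a) - \<kappa> s)" by (simp add: \<eta>_def)
  then show ?thesis by (simp add: E0_def exp_diff exp_minus divide_inverse)
qed

lemma \<eta>_pos: "0 < \<eta> s" by (simp add: \<eta>_def)

lemma E0_pos: "0 < E0" by (simp add: E0_def)

lemma \<Gamma>_le: assumes "s \<in> {a..t}" shows "\<bar>\<Gamma> s\<bar> \<le> c * \<kappa> s"
proof -
  have sub: "set_integrable lborel {a..s} z" if "set_integrable lborel {a..t} z" for z :: "real \<Rightarrow> real"
    using that assms by (auto intro: set_integrable_subset)
  have "\<bar>\<Gamma> s\<bar> \<le> (LBINT u:{a..s}. c * k u)"
    unfolding \<Gamma>_def
  proof (rule LBINT_abs_le)
    show "set_integrable lborel {a..s} g" "set_integrable lborel {a..s} (\<lambda>u. c * k u)"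
      using sub[OF int_k] sub[OF int_g] by auto
  qed (use assms in \<open>auto intro: g_le\<close>)
  then show ?thesis by (simp add: \<kappa>_def)
qed

lemma cont_\<kappa>: "continuous_on {a..t} \<kappa>"
  unfolding \<kappa>_def by (rule LBINT_continuous_on[OF int_k])

lemma cont_\<eta>: "continuous_on {a..t} \<eta>"
  unfolding \<eta>_def by (intro continuous_intros LBINT_continuous_on[OF int_b])

lemma cont_\<Gamma>: "continuous_on {a..t} \<Gamma>"
  unfolding \<Gamma>_def by (rule LBINT_continuous_on[OF int_g])

text \<open>A majorant that keeps half of the exponent, in the spirit of
  \<open>mult_exp_neg_half_le\<close>. The integral of \<open>k\<close> has no bound uniform over
  paths, that of \<open>bnd\<close> does.\<close>

definition "bnd s = (C0 + k s) * exp (- \<kappa> s / 2)"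

lemma int_bnd: "set_integrable lborel {a..t} bnd"
proof -
  have "set_integrable lborel {a..t} (\<lambda>s. exp (- \<kappa> s / 2) * (C0 + k s))"
    using int_k by (intro set_integrable_continuous_mult continuous_intros cont_\<kappa> set_integral_add) auto
  then show ?thesis by (simp add: bnd_def[abs_def] mult.commute)
qed

text \<open>By the chain rule for \<open>k / 2\<close>, the part with \<open>k\<close> integrates to
  \<open>2 * (1 - exp (- \<kappa> t / 2))\<close>; this is the origin of the summand 2.\<close>

lemma LBINT_bnd_le: "(LBINT s:{a..t}. bnd s) \<le> C0 * (t - a) + 2"
proof -
  have 1: "set_integrable lborel {a..t} (\<lambda>s. C0 * exp (- \<kappa> s / 2))"
    "set_integrable lborel {a..t} (\<lambda>s. exp (- \<kappa> s / 2) * (k s / 2))"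
  proof -
    show "set_integrable lborel {a..t} (\<lambda>s. C0 * exp (- \<kappa> s / 2))"
      by (intro borel_integrable_atLeastAtMost' continuous_intros cont_\<kappa>) auto
    have "set_integrable lborel {a..t} (\<lambda>s. k s / 2)" using int_k by simp
    then show "set_integrable lborel {a..t} (\<lambda>s. exp (- \<kappa> s / 2) * (k s / 2))"
      by (rule set_integrable_continuous_mult[rotated]) (intro continuous_intros cont_\<kappa>, auto)
  qed
  have 2: "set_integrable lborel {a..t} (\<lambda>s. 2 * (exp (- \<kappa> s / 2) * (k s / 2)))"
    using 1(2) by (rule set_integrable_mult_right[rotated])
  have "(LBINT s:{a..t}. bnd s) = (LBINT s:{a..t}. C0 * exp (- \<kappa> s / 2) + 2 * (exp (- \<kappa> s / 2) * (k s / 2)))"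
    by (simp add: bnd_def algebra_simps)
  also have "\<dots> = (LBINT s:{a..t}. C0 * exp (- \<kappa> s / 2)) + 2 * (LBINT s:{a..t}. exp (- \<kappa> s / 2) * (k s / 2))"
    using set_integral_add(2)[OF 1(1) 2] by (simp only: set_integral_mult_right)
  finally have "(LBINT s:{a..t}. bnd s) = (LBINT s:{a..t}. C0 * exp (- \<kappa> s / 2)) + 2 * (LBINT s:{a..t}. exp (- \<kappa> s / 2) * (k s / 2))" .
  moreover have "(LBINT s:{a..t}. exp (- \<kappa> s / 2) * (k s / 2)) = 1 - exp (- \<kappa> t / 2)"
    using LBINT_exp_chain_rule[OF at, of "\<lambda>s. k s / 2"] int_k by (simp add: \<kappa>_def)
  moreover have "(LBINT s:{a..t}. C0 * exp (- \<kappa> s / 2)) \<le> (LBINT s:{a..t}. C0)"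
  proof (intro set_integral_mono 1)
    fix s assume s: "s \<in> {a..t}"
    show "C0 * exp (- \<kappa> s / 2) \<le> C0" by (rule mult_right_le_one_le) (use C0_nonneg \<kappa>_nonneg[OF s] in auto)
  qed simp
  moreover have "(LBINT s:{a..t}. C0) = C0 * (t - a)" using at by (rule LBINT_const_Icc)
  moreover have "1 - exp (- \<kappa> t / 2) \<le> 1" by simp
  ultimately show ?thesis by linarith
qed

lemma exp_half_le: "s \<in> {a..t} \<Longrightarrow> exp (- \<kappa> s) \<le> exp (- \<kappa> s / 2)"
  using \<kappa>_nonneg by simp

text \<open>The growth allowed for \<open>d\<close> is that of an increment of the stopped
  compensated process: \<open>C\<close> bounds the increment of \<open>f\<close>, and
  \<open>c * \<kappa> s\<close> the accumulated drift.\<close>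

lemma weight_le:
  assumes s: "s \<in> {a..t}" and d: "\<bar>d\<bar> \<le> C + c * \<kappa> s" and C: "0 \<le> C"
  shows "\<eta> s * \<bar>d\<bar> \<le> E0 * (C + 2 * c) * exp (- \<kappa> s / 2)"
proof -
  have "\<eta> s * \<bar>d\<bar> \<le> (E0 * exp (- \<kappa> s)) * (C + c * \<kappa> s)"
    using \<eta>_le[OF s] d \<eta>_pos[of s] E0_pos by (intro mult_mono) auto
  also have "\<dots> = E0 * (C * exp (- \<kappa> s) + c * (\<kappa> s * exp (- \<kappa> s)))" by (simp add: algebra_simps)
  also have "\<dots> \<le> E0 * (C * exp (- \<kappa> s / 2) + c * (exp (- \<kappa> s / 2) * 2))"
    using E0_pos C c_nonneg exp_half_le[OF s] mult_exp_neg_half_le[OF \<kappa>_nonneg[OF s]]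
    by (intro mult_left_mono add_mono) auto
  finally show ?thesis by (simp add: algebra_simps)
qed

lemma b_le: "s \<in> {a..t} \<Longrightarrow> \<bar>b0 s + k s\<bar> \<le> C0 + k s"
  using b0_le[of s] k_nonneg[of s] by linarith

lemma weight_b_le:
  assumes s: "s \<in> {a..t}" and d: "\<bar>d\<bar> \<le> C + c * \<kappa> s" and C: "0 \<le> C"
  shows "\<bar>\<eta> s * (b0 s + k s) * d\<bar> \<le> E0 * (C + 2 * c) * bnd s"
proof -
  have "\<bar>\<eta> s * (b0 s + k s) * d\<bar> = (\<eta> s * \<bar>d\<bar>) * \<bar>b0 s + k s\<bar>"
    using \<eta>_pos[of s] by (simp add: abs_mult)
  also have "\<dots> \<le> (E0 * (C + 2 * c) * exp (- \<kappa> s / 2)) * (C0 + k s)"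
  proof (rule mult_mono)
    show "\<eta> s * \<bar>d\<bar> \<le> E0 * (C + 2 * c) * exp (- \<kappa> s / 2)" by (rule weight_le[OF assms])
  qed (use b_le[OF s] E0_pos C c_nonneg in auto)
  finally show ?thesis by (simp add: bnd_def algebra_simps)
qed

lemma weight_b_le':
  assumes s: "s \<in> {a..t}" shows "\<bar>\<eta> s * (b0 s + k s)\<bar> \<le> E0 * bnd s"
proof -
  have "\<bar>\<eta> s * (b0 s + k s)\<bar> = \<eta> s * \<bar>b0 s + k s\<bar>"
    using \<eta>_pos[of s] by (simp add: abs_mult)
  also have "\<dots> \<le> (E0 * exp (- \<kappa> s / 2)) * (C0 + k s)"
    using order_trans[OF \<eta>_le[OF s] mult_left_mono[OF exp_half_le[OF s]]] E0_pos b_le[OF s]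
    by (intro mult_mono) auto
  finally show ?thesis by (simp add: bnd_def algebra_simps)
qed

lemma int_\<eta>b: "set_integrable lborel {a..t} (\<lambda>s. \<eta> s * (b0 s + k s))"
  by (intro set_integrable_continuous_mult cont_\<eta> int_b)

lemma int_\<eta>g: "set_integrable lborel {a..t} (\<lambda>s. \<eta> s * g s)"
  by (intro set_integrable_continuous_mult cont_\<eta> int_g)

lemma int_\<eta>b\<Gamma>: "set_integrable lborel {a..t} (\<lambda>s. \<eta> s * (b0 s + k s) * \<Gamma> s)"
  using set_integrable_continuous_mult[OF cont_\<Gamma> int_\<eta>b] by (simp add: mult.commute)

lemma LBINT_\<eta>b: "s \<in> {a..t} \<Longrightarrow> (LBINT u:{a..s}. \<eta> u * (b0 u + k u)) = 1 - \<eta> s"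
  unfolding \<eta>_def by (rule LBINT_exp_chain_rule) (use int_b in \<open>auto intro: set_integrable_subset\<close>)

lemma LBINT_\<eta>b_abs: "(LBINT s:{a..t}. \<bar>\<eta> s * (b0 s + k s)\<bar>) \<le> E0 * (C0 * (t - a) + 2)"
proof -
  have "(LBINT s:{a..t}. \<bar>\<eta> s * (b0 s + k s)\<bar>) \<le> (LBINT s:{a..t}. E0 * bnd s)"
    using int_bnd by (intro set_integral_mono set_integrable_abs int_\<eta>b weight_b_le') auto
  also have "\<dots> \<le> E0 * (C0 * (t - a) + 2)" using LBINT_bnd_le E0_pos by simp
  finally show ?thesis .
qed

text \<open>The product rule for \<open>\<Gamma>\<close> and \<open>1 - \<eta>\<close>, the latter
  being the integral of \<open>\<eta> * (b0 + k)\<close>.\<close>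

lemma LBINT_\<eta>g: "(LBINT s:{a..t}. \<eta> s * g s) = \<eta> t * \<Gamma> t + (LBINT s:{a..t}. \<eta> s * (b0 s + k s) * \<Gamma> s)"
proof -
  have "(LBINT s:{a..t}. \<Gamma> s * (\<eta> s * (b0 s + k s))) + (LBINT s:{a..t}. (LBINT u:{a..s}. \<eta> u * (b0 u + k u)) * g s)
    = \<Gamma> t * (LBINT u:{a..t}. \<eta> u * (b0 u + k u))"
    unfolding \<Gamma>_def by (rule LBINT_product_rule[OF at int_g int_\<eta>b])
  also have "(LBINT s:{a..t}. (LBINT u:{a..s}. \<eta> u * (b0 u + k u)) * g s) = (LBINT s:{a..t}. g s - \<eta> s * g s)"
    by (intro set_lebesgue_integral_cong) (auto simp: LBINT_\<eta>b left_diff_distrib)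
  also have "\<dots> = \<Gamma> t - (LBINT s:{a..t}. \<eta> s * g s)"
    using int_g int_\<eta>g by (simp add: \<Gamma>_def)
  also have "(LBINT u:{a..t}. \<eta> u * (b0 u + k u)) = 1 - \<eta> t" using at by (intro LBINT_\<eta>b) auto
  finally show ?thesis by (simp add: algebra_simps)
qed

text \<open>The mass of this density is at most 1 whatever the size of \<open>k\<close>. Later this
  caps the total contribution of a positive drift that \<open>k\<close> dominates.\<close>

lemma LBINT_exp_k:
  assumes "s \<in> {a..t}"
  shows "set_integrable lborel {a..s} (\<lambda>u. exp (- \<kappa> u) * k u)"
    and "(LBINT u:{a..s}. exp (- \<kappa> u) * k u) = 1 - exp (- \<kappa> s)"
proof -
  have "set_integrable lborel {a..t} (\<lambda>u. exp (- \<kappa> u) * k u)"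
    by (intro set_integrable_continuous_mult int_k continuous_intros cont_\<kappa>)
  then show "set_integrable lborel {a..s} (\<lambda>u. exp (- \<kappa> u) * k u)"
    using assms by (auto intro: set_integrable_subset)
  show "(LBINT u:{a..s}. exp (- \<kappa> u) * k u) = 1 - exp (- \<kappa> s)"
    unfolding \<kappa>_def using assms by (intro LBINT_exp_chain_rule set_integrable_subset[OF int_k]) auto
qed

end

section \<open>The product formula for a process with drift\<close>

text \<open>
  Here \<open>f - x0 - \<integral>g\<close> is a local martingale with localising times \<open>\<tau>\<close>. Nothing is assumed about the
  regularity of the paths, and \<open>g\<close> need not be integrable in expectation.
\<close>

locale drift_process = prob_space M for M :: "'a measure" +
  fixes F :: "real \<Rightarrow> 'a measure" and f g :: "real \<Rightarrow> 'a \<Rightarrow> real" and \<tau> :: "nat \<Rightarrow> 'a \<Rightarrow> real"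
    and C x0 :: real
  assumes subalg: "\<And>t. 0 \<le> t \<Longrightarrow> subalgebra M (F t)"
    and filtration: "\<And>s t. 0 \<le> s \<Longrightarrow> s \<le> t \<Longrightarrow> sets (F s) \<subseteq> sets (F t)"
    and f_meas[measurable]: "(\<lambda>(s, \<omega>). f s \<omega>) \<in> borel_measurable (borel \<Otimes>\<^sub>M M)"
    and g_meas[measurable]: "(\<lambda>(s, \<omega>). g s \<omega>) \<in> borel_measurable (borel \<Otimes>\<^sub>M M)"
    and f_adapted: "\<And>s. 0 \<le> s \<Longrightarrow> f s \<in> borel_measurable (F s)"
    and g_adapted: "\<And>s. 0 \<le> s \<Longrightarrow> g s \<in> borel_measurable (F s)"
    and f_nonneg: "\<And>s \<omega>. 0 \<le> f s \<omega>"
    and f_le: "\<And>s \<omega>. f s \<omega> \<le> C"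
    and g_integrable: "AE \<omega> in M. \<forall>t\<ge>0. set_integrable lborel {0..t} (\<lambda>s. g s \<omega>)"
    and \<tau>_meas[measurable]: "\<And>n. \<tau> n \<in> borel_measurable M"
    and \<tau>_nonneg: "\<And>n \<omega>. \<omega> \<in> space M \<Longrightarrow> 0 \<le> \<tau> n \<omega>"
    and \<tau>_lim: "AE \<omega> in M. filterlim (\<lambda>n. \<tau> n \<omega>) at_top sequentially"
    and mart: "\<And>n. martingale M F (\<lambda>t \<omega>. f (min t (\<tau> n \<omega>)) \<omega> - x0 - (LBINT s:{0..min t (\<tau> n \<omega>)}. g s \<omega>))"
begin

definition "S t \<omega> = f t \<omega> - x0 - (LBINT s:{0..t}. g s \<omega>)"
definition "St n t \<omega> = S (min t (\<tau> n \<omega>)) \<omega>"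

lemma C_nonneg: "0 \<le> C"
  using f_nonneg[of 0 undefined] f_le[of 0 undefined] by linarith

lemma S_meas[measurable]: "(\<lambda>(s, \<omega>). S s \<omega>) \<in> borel_measurable (borel \<Otimes>\<^sub>M M)"
proof -
  note borel_measurable_LBINT_Icc[OF g_meas, of 0, measurable]
  show ?thesis unfolding S_def by measurable
qed

lemma St_meas[measurable]: "(\<lambda>(s, \<omega>). St n s \<omega>) \<in> borel_measurable (borel \<Otimes>\<^sub>M M)"
proof -
  have "(\<lambda>p. (min (fst p) (\<tau> n (snd p)), snd p)) \<in> borel \<Otimes>\<^sub>M M \<rightarrow>\<^sub>M (borel :: real measure) \<Otimes>\<^sub>M M"
    by measurable
  from measurable_compose[OF this S_meas] show ?thesis by (simp add: St_def split_def)
qed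

lemma sigma_finite_sub: "0 \<le> s \<Longrightarrow> sigma_finite_subalgebra M (F s)"
  using subalg by (simp add: finite_measure_subalgebra_is_sigma_finite finite_measure_subalgebra_def
        finite_measure_subalgebra_axioms_def finite_measure_axioms)

lemma St_integrable: "0 \<le> t \<Longrightarrow> integrable M (St n t)"
  using mart[of n] by (simp add: martingale_def St_def[abs_def] S_def)

text \<open>Integrability is asked of the product: \<open>Y\<close> will contain the unbounded rate
  \<open>k\<close>, and Fubini's theorem provides integrability of the product as a whole.\<close>

lemma St_increment:
  assumes st: "0 \<le> s" "s \<le> t" and Y[measurable]: "Y \<in> borel_measurable (F s)"
    and i: "integrable M (\<lambda>\<omega>. Y \<omega> * (St n t \<omega> - St n s \<omega>))"
  shows "(\<integral>\<omega>. Y \<omega> * (St n t \<omega> - St n s \<omega>) \<partial>M) = 0"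
proof -
  interpret sub: sigma_finite_subalgebra M "F s" by (rule sigma_finite_sub) fact
  have St: "integrable M (St n t)" "integrable M (St n s)" using st by (auto intro: St_integrable)
  have ms: "St n s \<in> borel_measurable (F s)"
    using mart[of n] st by (simp add: martingale_def St_def[abs_def] S_def)
  have "AE \<omega> in M. real_cond_exp M (F s) (St n t) \<omega> = St n s \<omega>"
    using mart[of n] st by (simp add: martingale_def St_def[abs_def] S_def)
  then have "AE \<omega> in M. real_cond_exp M (F s) (\<lambda>\<omega>. St n t \<omega> - St n s \<omega>) \<omega> = 0"
    using sub.real_cond_exp_diff[OF St] sub.real_cond_exp_F_meas[OF St(2) ms]
    by eventually_elim simp
  then have 0: "AE \<omega> in M. Y \<omega> * real_cond_exp M (F s) (\<lambda>\<omega>. St n t \<omega> - St n s \<omega>) \<omega> = 0"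
    by eventually_elim simp
  have "(\<integral>\<omega>. Y \<omega> * (St n t \<omega> - St n s \<omega>) \<partial>M)
    = (\<integral>\<omega>. Y \<omega> * real_cond_exp M (F s) (\<lambda>\<omega>. St n t \<omega> - St n s \<omega>) \<omega> \<partial>M)"
    using St by (intro sub.real_cond_exp_intg(2)[OF i, symmetric]) auto
  also have "\<dots> = 0" by (rule integral_eq_zero_AE[OF 0])
  finally show ?thesis .
qed

text \<open>
  Integration by parts against the absolutely continuous weight \<open>\<eta>\<close> only needs Fubini's theorem and the
  martingale property at fixed times. As \<open>k\<close> dominates \<open>\<bar>g\<bar>\<close>, the weight \<open>exp (- \<integral>k)\<close> makes the stopped
  terms bounded, so the localisation can be removed by dominated convergence.
\<close>

lemma expectation_weighted:
  fixes b0 k :: "real \<Rightarrow> 'a \<Rightarrow> real" and H :: "'a \<Rightarrow> real"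
  assumes at: "0 \<le> a" "a \<le> t"
    and b0_meas[measurable]: "(\<lambda>(s, \<omega>). b0 s \<omega>) \<in> borel_measurable (borel \<Otimes>\<^sub>M M)"
    and k_meas[measurable]: "(\<lambda>(s, \<omega>). k s \<omega>) \<in> borel_measurable (borel \<Otimes>\<^sub>M M)"
    and b0_adapted: "\<And>s. 0 \<le> s \<Longrightarrow> b0 s \<in> borel_measurable (F s)"
    and k_adapted: "\<And>s. 0 \<le> s \<Longrightarrow> k s \<in> borel_measurable (F s)"
    and b0_le: "\<And>s \<omega>. \<bar>b0 s \<omega>\<bar> \<le> C0" and k_nonneg: "\<And>s \<omega>. 0 \<le> k s \<omega>"
    and g_le: "\<And>s \<omega>. \<bar>g s \<omega>\<bar> \<le> c * k s \<omega>" and c: "0 \<le> c"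
    and k_int: "AE \<omega> in M. set_integrable lborel {a..t} (\<lambda>s. k s \<omega>)"
    and H[measurable]: "H \<in> borel_measurable (F a)" and H_le: "\<And>\<omega>. \<bar>H \<omega>\<bar> \<le> 1"
  defines "\<eta> \<equiv> \<lambda>s \<omega>. exp (- (LBINT u:{a..s}. b0 u \<omega> + k u \<omega>))"
  shows "integrable M (\<lambda>\<omega>. H \<omega> * (LBINT s:{a..t}. \<eta> s \<omega> * (g s \<omega> - (b0 s \<omega> + k s \<omega>) * f s \<omega>)))" (is ?int)
    and "(\<integral>\<omega>. H \<omega> * (\<eta> t \<omega> * f t \<omega>) \<partial>M) = (\<integral>\<omega>. H \<omega> * f a \<omega> \<partial>M)
      + (\<integral>\<omega>. H \<omega> * (LBINT s:{a..t}. \<eta> s \<omega> * (g s \<omega> - (b0 s \<omega> + k s \<omega>) * f s \<omega>)) \<partial>M)" (is ?eq)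
proof -
  have \<eta>_meas[measurable]: "(\<lambda>(s, \<omega>). \<eta> s \<omega>) \<in> borel_measurable (borel \<Otimes>\<^sub>M M)"
  proof -
    have "(\<lambda>(u, \<omega>). b0 u \<omega> + k u \<omega>) \<in> borel_measurable (borel \<Otimes>\<^sub>M M)" by measurable
    note borel_measurable_LBINT_Icc[OF this, of a, measurable]
    show ?thesis unfolding \<eta>_def by measurable
  qed
  have Hm[measurable]: "H \<in> borel_measurable M"
    by (rule measurable_from_subalg[OF subalg[OF at(1)] H])
  have good: "AE \<omega> in M. path_weight a t C0 c (\<lambda>s. b0 s \<omega>) (\<lambda>s. k s \<omega>) (\<lambda>s. g s \<omega>)"
    using k_int g_integrable AE_space
  proof eventually_elim
    case (elim \<omega>)
    have "set_integrable lborel {a..t} (\<lambda>s. b0 s \<omega>)"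
      by (rule set_integrable_bounded_Icc[where C = C0])
        (use measurable_section_snd[OF b0_meas elim(3)] b0_le in auto)
    moreover have "set_integrable lborel {a..t} (\<lambda>s. g s \<omega>)"
      by (rule set_integrable_subset[of _ "{0..t}"]) (use elim at in auto)
    ultimately show ?case
      by unfold_locales (use elim at b0_le k_nonneg g_le c in auto)
  qed
  have f_sec: "(\<lambda>s. f s \<omega>) \<in> borel_measurable borel" if "\<omega> \<in> space M" for \<omega>
    by (rule measurable_section_snd[OF f_meas that])
  define E where "E = exp (C0 * (t - a))"
  define B where "B s \<omega> = b0 s \<omega> + k s \<omega>" for s \<omega>
  have B_meas[measurable]: "(\<lambda>(s, \<omega>). B s \<omega>) \<in> borel_measurable (borel \<Otimes>\<^sub>M M)"
    unfolding B_def by measurable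
  \<comment> \<open>\<open>\<eta> s\<close> contains a time integral, so an
    \<open>F s\<close>-measurable version of it is all that can be had. That suffices under
    expectations.\<close>
  have \<eta>_adapted: "\<exists>Z\<in>borel_measurable (F s). AE \<omega> in M. \<eta> s \<omega> = Z \<omega>" if "s \<in> {a..t}" for s
  proof -
    have "\<exists>Z\<in>borel_measurable (F s). AE \<omega> in M. (LBINT u:{a..s}. b0 u \<omega> + k u \<omega>) = Z \<omega>"
    proof (rule AE_adapted_LBINT)
      show "subalgebra M (F s)" using subalg that at by auto
      show "(\<lambda>(u, \<omega>). b0 u \<omega> + k u \<omega>) \<in> borel_measurable (borel \<Otimes>\<^sub>M M)" by measurable
      show "(\<lambda>\<omega>. b0 u \<omega> + k u \<omega>) \<in> borel_measurable (F s)" if u: "u \<in> {a..s}" for u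
      proof -
        have "subalgebra (F s) (F u)"
          using filtration[of u s] subalg[of u] subalg[of s] u at \<open>s \<in> {a..t}\<close> by (auto simp: subalgebra_def)
        from measurable_from_subalg[OF this b0_adapted] measurable_from_subalg[OF this k_adapted] u at
        show ?thesis by auto
      qed
      show "AE \<omega> in M. set_integrable lborel {a..s} (\<lambda>u. b0 u \<omega> + k u \<omega>)"
        using good
      proof eventually_elim
        case (elim \<omega>)
        show ?case using path_weight.int_b[OF elim] that by (auto intro: set_integrable_subset)
      qed
      show "a \<le> s" using that by simp
    qed
    then obtain Z where Z: "Z \<in> borel_measurable (F s)" "AE \<omega> in M. (LBINT u:{a..s}. b0 u \<omega> + k u \<omega>) = Z \<omega>"
      by blast
    show ?thesis
    proof (rule bexI[of _ "\<lambda>\<omega>. exp (- Z \<omega>)"])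
      show "(\<lambda>\<omega>. exp (- Z \<omega>)) \<in> borel_measurable (F s)" using Z(1) by measurable
      show "AE \<omega> in M. \<eta> s \<omega> = exp (- Z \<omega>)" using Z(2) by eventually_elim (simp add: \<eta>_def)
    qed
  qed
  define D where "D n s \<omega> = St n s \<omega> - St n a \<omega>" for n s \<omega>
  have Sta[measurable]: "St n a \<in> borel_measurable M" "St n t \<in> borel_measurable M" for n
    by (auto intro: measurable_section_fst St_meas)
  have D_meas[measurable]: "(\<lambda>(s, \<omega>). D n s \<omega>) \<in> borel_measurable (borel \<Otimes>\<^sub>M M)" for n
    unfolding D_def by measurable
  have D_le: "AE \<omega> in M. \<forall>s\<in>{a..t}. \<bar>D n s \<omega>\<bar> \<le> C + c * (LBINT u:{a..s}. k u \<omega>)" for n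
    using good g_integrable AE_space
  proof eventually_elim
    case (elim \<omega>)
    interpret w: path_weight a t C0 c "\<lambda>s. b0 s \<omega>" "\<lambda>s. k s \<omega>" "\<lambda>s. g s \<omega>" by fact
    show ?case
    proof
      fix s assume s: "s \<in> {a..t}"
      \<comment> \<open>Stopping leaves the increment between \<open>p\<close> and \<open>q\<close>.
        Either the path was stopped by time \<open>a\<close> and this interval is degenerate, or it
        starts at \<open>a\<close>. So the drift in it is bounded through the integral of
        \<open>k\<close> from \<open>a\<close> to \<open>s\<close>, independently of
        \<open>n\<close>.\<close>
      define p q where "p = min a (\<tau> n \<omega>)" and "q = min s (\<tau> n \<omega>)"
      have pq: "0 \<le> p" "p \<le> q" "q \<le> s" "q = p \<or> p = a"
        using \<tau>_nonneg[OF elim(3), of n] at s by (auto simp: p_def q_def)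
      have "(LBINT u:{0..q}. g u \<omega>) = (LBINT u:{0..p}. g u \<omega>) + (LBINT u:{p..q}. g u \<omega>)"
        using elim(2) pq by (intro LBINT_split) auto
      then have "D n s \<omega> = f q \<omega> - f p \<omega> - (LBINT u:{p..q}. g u \<omega>)"
        by (simp add: D_def St_def S_def p_def q_def)
      moreover have "\<bar>LBINT u:{p..q}. g u \<omega>\<bar> \<le> c * (LBINT u:{a..s}. k u \<omega>)"
      proof (cases "p = a")
        case True
        then have "\<bar>LBINT u:{p..q}. g u \<omega>\<bar> \<le> c * (LBINT u:{a..q}. k u \<omega>)"
          using w.\<Gamma>_le[of q] pq s by (auto simp: w.\<Gamma>_def w.\<kappa>_def)
        also have "\<dots> \<le> c * (LBINT u:{a..s}. k u \<omega>)"
          using pq True s k_nonneg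
          by (intro mult_left_mono c LBINT_Icc_mono_set set_integrable_subset[OF w.int_k]) auto
        finally show ?thesis .
      next
        case False
        then have "q = p" using pq by simp
        then show ?thesis using w.\<kappa>_nonneg[OF s] c by (simp add: w.\<kappa>_def)
      qed
      moreover have "\<bar>f q \<omega> - f p \<omega>\<bar> \<le> C"
        using f_nonneg[of q \<omega>] f_nonneg[of p \<omega>] f_le[of q \<omega>] f_le[of p \<omega>] by linarith
      ultimately show "\<bar>D n s \<omega>\<bar> \<le> C + c * (LBINT u:{a..s}. k u \<omega>)" by linarith
    qed
  qed
  \<comment> \<open>\<open>H\<close> times the integral of \<open>\<eta>\<close> against the
    increments of \<open>St n\<close> from \<open>a\<close> to \<open>t\<close>, in the form
    produced by integration by parts. No stochastic integral is involved, since
    \<open>\<eta>\<close> is absolutely continuous with density \<open>- \<eta> * B\<close>.\<close>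
  define X where "X n \<omega> = H \<omega> * (\<eta> t \<omega> * D n t \<omega> + (LBINT s:{a..t}. \<eta> s \<omega> * B s \<omega> * D n s \<omega>))" for n \<omega>
  \<comment> \<open>Stated for a general \<open>d\<close> because it is applied both to the
    increments \<open>D n\<close> and to \<open>f\<close>.\<close>
  have int\<eta>BD: "set_integrable lborel {a..t} (\<lambda>s. \<eta> s \<omega> * B s \<omega> * d s) \<and>
      (LBINT s:{a..t}. \<bar>\<eta> s \<omega> * B s \<omega> * d s\<bar>) \<le> E * (C + 2 * c) * (C0 * (t - a) + 2)"
    if w: "path_weight a t C0 c (\<lambda>s. b0 s \<omega>) (\<lambda>s. k s \<omega>) (\<lambda>s. g s \<omega>)"
      and d: "d \<in> borel_measurable borel" "\<And>s. s \<in> {a..t} \<Longrightarrow> \<bar>d s\<bar> \<le> C + c * (LBINT u:{a..s}. k u \<omega>)"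
      and \<omega>: "\<omega> \<in> space M" for \<omega> and d :: "real \<Rightarrow> real"
  proof -
    interpret w: path_weight a t C0 c "\<lambda>s. b0 s \<omega>" "\<lambda>s. k s \<omega>" "\<lambda>s. g s \<omega>" by fact
    have le: "\<bar>\<eta> s \<omega> * B s \<omega> * d s\<bar> \<le> E * (C + 2 * c) * w.bnd s" if "s \<in> {a..t}" for s
      using w.weight_b_le[OF that _ C_nonneg, of "d s"] d(2)[OF that]
      by (simp add: w.\<eta>_def \<eta>_def B_def E_def w.E0_def w.\<kappa>_def)
    have b: "set_integrable lborel {a..t} (\<lambda>s. E * (C + 2 * c) * w.bnd s)"
      using w.int_bnd by simp
    have [measurable]: "(\<lambda>s. \<eta> s \<omega>) \<in> borel_measurable borel" "(\<lambda>s. B s \<omega>) \<in> borel_measurable borel"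
      using measurable_section_snd[OF \<eta>_meas \<omega>] measurable_section_snd[OF B_meas \<omega>] by auto
    have i: "set_integrable lborel {a..t} (\<lambda>s. \<eta> s \<omega> * B s \<omega> * d s)"
      unfolding set_integrable_def
    proof (rule Bochner_Integration.integrable_bound)
      show "integrable lborel (\<lambda>s. indicator {a..t} s *\<^sub>R (E * (C + 2 * c) * w.bnd s))"
        using b by (simp only: set_integrable_def)
      show "(\<lambda>s. indicator {a..t} s *\<^sub>R (\<eta> s \<omega> * B s \<omega> * d s)) \<in> borel_measurable lborel"
        using d(1) by simp
      have "norm (indicator {a..t} s *\<^sub>R (\<eta> s \<omega> * B s \<omega> * d s)) \<le> norm (indicator {a..t} s *\<^sub>R (E * (C + 2 * c) * w.bnd s))" for s
        using le[of s] by (auto simp: indicator_def)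
      then show "AE s in lborel. norm (indicator {a..t} s *\<^sub>R (\<eta> s \<omega> * B s \<omega> * d s)) \<le> norm (indicator {a..t} s *\<^sub>R (E * (C + 2 * c) * w.bnd s))"
        by simp
    qed
    have "(LBINT s:{a..t}. \<bar>\<eta> s \<omega> * B s \<omega> * d s\<bar>) \<le> (LBINT s:{a..t}. E * (C + 2 * c) * w.bnd s)"
      using le by (intro set_integral_mono set_integrable_abs i b) auto
    also have "\<dots> = E * (C + 2 * c) * (LBINT s:{a..t}. w.bnd s)" by simp
    also have "\<dots> \<le> E * (C + 2 * c) * (C0 * (t - a) + 2)"
      using w.LBINT_bnd_le C_nonneg c by (intro mult_left_mono) (auto simp: E_def)
    finally show ?thesis using i by simp
  qed
  have X0: "(\<integral>\<omega>. X n \<omega> \<partial>M) = 0" for n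
  proof -
    have D_sec: "(\<lambda>s. D n s \<omega>) \<in> borel_measurable borel" if "\<omega> \<in> space M" for \<omega>
      by (rule measurable_section_snd[OF D_meas that])
    have iD: "integrable M (D n t)"
      unfolding D_def using at by (intro Bochner_Integration.integrable_diff St_integrable) auto
    have iHD: "integrable M (\<lambda>\<omega>. H \<omega> * D n t \<omega>)"
      by (rule Bochner_Integration.integrable_bound[OF iD])
        (use H_le in \<open>auto simp: abs_mult D_def intro!: AE_I2 mult_left_le_one_le\<close>)
    have HD: "(\<integral>\<omega>. H \<omega> * D n t \<omega> \<partial>M) = 0"
      using iHD unfolding D_def by (intro St_increment[OF at H])
    have joint: "integrable (lborel \<Otimes>\<^sub>M M) (\<lambda>(s, \<omega>). indicator {a..t} s * (H \<omega> * (\<eta> s \<omega> * B s \<omega> * (D n t \<omega> - D n s \<omega>))))"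
    proof (rule integrable_pairI[where c = "\<lambda>\<omega>. E * (C0 * (t - a) + 2) * \<bar>D n t \<omega>\<bar> + E * (C + 2 * c) * (C0 * (t - a) + 2)"])
      have [measurable]: "D n t \<in> borel_measurable M" by (rule measurable_section_fst[OF D_meas])
      show "(\<lambda>(s, \<omega>). H \<omega> * (\<eta> s \<omega> * B s \<omega> * (D n t \<omega> - D n s \<omega>))) \<in> borel_measurable (borel \<Otimes>\<^sub>M M)"
        by measurable
      show "sigma_finite_measure M" ..
      show "integrable M (\<lambda>\<omega>. E * (C0 * (t - a) + 2) * \<bar>D n t \<omega>\<bar> + E * (C + 2 * c) * (C0 * (t - a) + 2))"
        using iD by simp
      show "AE \<omega> in M. set_integrable lborel {a..t} (\<lambda>s. H \<omega> * (\<eta> s \<omega> * B s \<omega> * (D n t \<omega> - D n s \<omega>))) \<and>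
         (LBINT s:{a..t}. \<bar>H \<omega> * (\<eta> s \<omega> * B s \<omega> * (D n t \<omega> - D n s \<omega>))\<bar>)
         \<le> E * (C0 * (t - a) + 2) * \<bar>D n t \<omega>\<bar> + E * (C + 2 * c) * (C0 * (t - a) + 2)"
        using good D_le[of n] AE_space
      proof eventually_elim
        case (elim \<omega>)
        interpret w: path_weight a t C0 c "\<lambda>s. b0 s \<omega>" "\<lambda>s. k s \<omega>" "\<lambda>s. g s \<omega>" by fact
        have 1: "set_integrable lborel {a..t} (\<lambda>s. \<eta> s \<omega> * B s \<omega>)"
          "(LBINT s:{a..t}. \<bar>\<eta> s \<omega> * B s \<omega>\<bar>) \<le> E * (C0 * (t - a) + 2)"
          using w.int_\<eta>b w.LBINT_\<eta>b_abs by (simp_all add: w.\<eta>_def \<eta>_def B_def E_def w.E0_def)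
        have p1: "set_integrable lborel {a..t} (\<lambda>s. \<eta> s \<omega> * B s \<omega> * D n t \<omega>)"
          "(LBINT s:{a..t}. \<bar>\<eta> s \<omega> * B s \<omega> * D n t \<omega>\<bar>) \<le> E * (C0 * (t - a) + 2) * \<bar>D n t \<omega>\<bar>"
          using 1 by (auto simp: abs_mult[of _ "D n t \<omega>"] intro: mult_right_mono)
        have 2: "set_integrable lborel {a..t} (\<lambda>s. \<eta> s \<omega> * B s \<omega> * D n s \<omega>)"
          "(LBINT s:{a..t}. \<bar>\<eta> s \<omega> * B s \<omega> * D n s \<omega>\<bar>) \<le> E * (C + 2 * c) * (C0 * (t - a) + 2)"
          using int\<eta>BD[OF elim(1) D_sec[OF elim(3)] _ elim(3)] elim(2) by auto
        have i: "set_integrable lborel {a..t} (\<lambda>s. \<eta> s \<omega> * B s \<omega> * (D n t \<omega> - D n s \<omega>))"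
          using set_integral_diff(1)[OF p1(1) 2(1)] by (simp add: right_diff_distrib)
        have "(LBINT s:{a..t}. \<bar>H \<omega> * (\<eta> s \<omega> * B s \<omega> * (D n t \<omega> - D n s \<omega>))\<bar>)
          \<le> (LBINT s:{a..t}. \<bar>\<eta> s \<omega> * B s \<omega> * D n t \<omega>\<bar> + \<bar>\<eta> s \<omega> * B s \<omega> * D n s \<omega>\<bar>)"
        proof (rule set_integral_mono)
          show "set_integrable lborel {a..t} (\<lambda>s. \<bar>H \<omega> * (\<eta> s \<omega> * B s \<omega> * (D n t \<omega> - D n s \<omega>))\<bar>)"
            using i by (intro set_integrable_abs) auto
          show "set_integrable lborel {a..t} (\<lambda>s. \<bar>\<eta> s \<omega> * B s \<omega> * D n t \<omega>\<bar> + \<bar>\<eta> s \<omega> * B s \<omega> * D n s \<omega>\<bar>)"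
            using p1 2 by (intro set_integral_add set_integrable_abs)
          fix s
          have "\<bar>H \<omega> * (\<eta> s \<omega> * B s \<omega> * (D n t \<omega> - D n s \<omega>))\<bar> \<le> 1 * \<bar>\<eta> s \<omega> * B s \<omega> * (D n t \<omega> - D n s \<omega>)\<bar>"
            unfolding abs_mult[of "H \<omega>"] by (intro mult_right_mono H_le) auto
          also have "\<dots> \<le> \<bar>\<eta> s \<omega> * B s \<omega> * D n t \<omega>\<bar> + \<bar>\<eta> s \<omega> * B s \<omega> * D n s \<omega>\<bar>"
            by (simp only: right_diff_distrib mult_1 abs_triangle_ineq4)
          finally show "\<bar>H \<omega> * (\<eta> s \<omega> * B s \<omega> * (D n t \<omega> - D n s \<omega>))\<bar> \<le> \<bar>\<eta> s \<omega> * B s \<omega> * D n t \<omega>\<bar> + \<bar>\<eta> s \<omega> * B s \<omega> * D n s \<omega>\<bar>" .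
        qed
        also have "\<dots> \<le> E * (C0 * (t - a) + 2) * \<bar>D n t \<omega>\<bar> + E * (C + 2 * c) * (C0 * (t - a) + 2)"
          using p1 2 by (subst set_integral_add) (auto intro!: set_integrable_abs)
        finally show ?case using i by simp
      qed
    qed
    note Fub = Fubini_Icc[OF sigma_finite_measure_axioms joint]
    have "AE s in lborel. s \<in> {a..t} \<longrightarrow> (\<integral>\<omega>. H \<omega> * (\<eta> s \<omega> * B s \<omega> * (D n t \<omega> - D n s \<omega>)) \<partial>M) = 0"
      using Fub(3)
    proof eventually_elim
      case (elim s)
      show ?case
      proof
        assume s: "s \<in> {a..t}"
        then have i: "integrable M (\<lambda>\<omega>. H \<omega> * (\<eta> s \<omega> * B s \<omega> * (D n t \<omega> - D n s \<omega>)))" using elim by simp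
        obtain Z where Z[measurable]: "Z \<in> borel_measurable (F s)" and Ze: "AE \<omega> in M. \<eta> s \<omega> = Z \<omega>"
          using \<eta>_adapted[OF s] by blast
        have "subalgebra (F s) (F a)"
          using filtration[of a s] subalg[of a] subalg[of s] s at by (auto simp: subalgebra_def)
        from measurable_from_subalg[OF this H] have [measurable]: "H \<in> borel_measurable (F s)" .
        have [measurable]: "B s \<in> borel_measurable (F s)"
          unfolding B_def using b0_adapted[of s] k_adapted[of s] s at by simp
        have mD[measurable]: "D n s \<in> borel_measurable M" "D n t \<in> borel_measurable M" for s
          by (rule measurable_section_fst[OF D_meas])+
        have mB[measurable]: "B s \<in> borel_measurable M" "Z \<in> borel_measurable M" "\<eta> s \<in> borel_measurable M"
          using measurable_section_fst[OF B_meas] measurable_from_subalg[OF subalg Z] s at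
            measurable_section_fst[OF \<eta>_meas] by auto
        have eq: "AE \<omega> in M. H \<omega> * (\<eta> s \<omega> * B s \<omega> * (D n t \<omega> - D n s \<omega>))
          = (H \<omega> * Z \<omega> * B s \<omega>) * (St n t \<omega> - St n s \<omega>)"
          using Ze by eventually_elim (simp add: D_def)
        have [measurable]: "St n s \<in> borel_measurable M" by (rule measurable_section_fst[OF St_meas])
        have i': "integrable M (\<lambda>\<omega>. (H \<omega> * Z \<omega> * B s \<omega>) * (St n t \<omega> - St n s \<omega>))"
          using i by (subst integrable_cong_AE[OF _ _ eq, symmetric]) measurable
        have "(\<integral>\<omega>. H \<omega> * (\<eta> s \<omega> * B s \<omega> * (D n t \<omega> - D n s \<omega>)) \<partial>M)
          = (\<integral>\<omega>. (H \<omega> * Z \<omega> * B s \<omega>) * (St n t \<omega> - St n s \<omega>) \<partial>M)"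
          by (rule integral_cong_AE[OF _ _ eq]) measurable
        also have "\<dots> = 0"
          using s at by (intro St_increment i') auto
        finally show "(\<integral>\<omega>. H \<omega> * (\<eta> s \<omega> * B s \<omega> * (D n t \<omega> - D n s \<omega>)) \<partial>M) = 0" .
      qed
    qed
    then have "(LBINT s:{a..t}. (\<integral>\<omega>. H \<omega> * (\<eta> s \<omega> * B s \<omega> * (D n t \<omega> - D n s \<omega>)) \<partial>M)) = 0"
      unfolding set_lebesgue_integral_def
      by (intro integral_eq_zero_AE) (auto elim!: eventually_mono simp: indicator_def)
    then have J0: "(\<integral>\<omega>. (LBINT s:{a..t}. H \<omega> * (\<eta> s \<omega> * B s \<omega> * (D n t \<omega> - D n s \<omega>))) \<partial>M) = 0"
      using Fub(1) by simp
    \<comment> \<open>Substituting \<open>1 - \<integral>\<eta> * B\<close> for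
      \<open>\<eta> t\<close> exposes the increments \<open>D n t - D n s\<close>, each orthogonal
      to the factor \<open>H * \<eta> s * B s\<close>, which is known at time \<open>s\<close> up to
      a null set.\<close>
    have "AE \<omega> in M. X n \<omega> = H \<omega> * D n t \<omega> - (LBINT s:{a..t}. H \<omega> * (\<eta> s \<omega> * B s \<omega> * (D n t \<omega> - D n s \<omega>)))"
      using good D_le[of n] AE_space
    proof eventually_elim
      case (elim \<omega>)
      interpret w: path_weight a t C0 c "\<lambda>s. b0 s \<omega>" "\<lambda>s. k s \<omega>" "\<lambda>s. g s \<omega>" by fact
      have 1: "set_integrable lborel {a..t} (\<lambda>s. \<eta> s \<omega> * B s \<omega>)" "(LBINT s:{a..t}. \<eta> s \<omega> * B s \<omega>) = 1 - \<eta> t \<omega>"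
        using w.int_\<eta>b w.LBINT_\<eta>b[of t] at by (simp_all add: w.\<eta>_def \<eta>_def B_def)
      have p1: "set_integrable lborel {a..t} (\<lambda>s. \<eta> s \<omega> * B s \<omega> * D n t \<omega>)" using 1(1) by simp
      have 2: "set_integrable lborel {a..t} (\<lambda>s. \<eta> s \<omega> * B s \<omega> * D n s \<omega>)"
        using int\<eta>BD[OF elim(1) D_sec[OF elim(3)] _ elim(3)] elim(2) by auto
      have "(LBINT s:{a..t}. H \<omega> * (\<eta> s \<omega> * B s \<omega> * (D n t \<omega> - D n s \<omega>)))
        = H \<omega> * (LBINT s:{a..t}. \<eta> s \<omega> * B s \<omega> * (D n t \<omega> - D n s \<omega>))"
        by simp
      also have "(LBINT s:{a..t}. \<eta> s \<omega> * B s \<omega> * (D n t \<omega> - D n s \<omega>))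
        = (LBINT s:{a..t}. \<eta> s \<omega> * B s \<omega> * D n t \<omega>) - (LBINT s:{a..t}. \<eta> s \<omega> * B s \<omega> * D n s \<omega>)"
        unfolding right_diff_distrib by (rule set_integral_diff(2)[OF p1 2])
      also have "(LBINT s:{a..t}. \<eta> s \<omega> * B s \<omega> * D n t \<omega>) = (1 - \<eta> t \<omega>) * D n t \<omega>"
        using 1(2) by simp
      finally show ?case by (simp add: X_def algebra_simps)
    qed
    then have "(\<integral>\<omega>. X n \<omega> \<partial>M) = (\<integral>\<omega>. H \<omega> * D n t \<omega> - (LBINT s:{a..t}. H \<omega> * (\<eta> s \<omega> * B s \<omega> * (D n t \<omega> - D n s \<omega>))) \<partial>M)"
    proof (rule integral_cong_AE[rotated 2])
      have mB: "(\<lambda>(s, \<omega>). \<eta> s \<omega> * B s \<omega> * D n s \<omega>) \<in> borel_measurable (borel \<Otimes>\<^sub>M M)" by measurable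
      note [measurable] = measurable_section_fst[OF borel_measurable_LBINT_Icc[OF mB], of a t]
        measurable_section_fst[OF \<eta>_meas, of t] measurable_section_fst[OF D_meas, of n t]
      show "X n \<in> borel_measurable M" unfolding X_def by measurable
      show "(\<lambda>\<omega>. H \<omega> * D n t \<omega> - (LBINT s:{a..t}. H \<omega> * (\<eta> s \<omega> * B s \<omega> * (D n t \<omega> - D n s \<omega>)))) \<in> borel_measurable M"
        using Fub(2) iHD by (intro borel_measurable_diff) auto
    qed
    also have "\<dots> = 0" using iHD Fub(2) HD J0 by (subst Bochner_Integration.integral_diff) auto
    finally show ?thesis .
  qed
  define Y where "Y \<omega> = H \<omega> * (\<eta> t \<omega> * f t \<omega>) - H \<omega> * f a \<omega>
    - H \<omega> * (LBINT s:{a..t}. \<eta> s \<omega> * (g s \<omega> - B s \<omega> * f s \<omega>))" for \<omega>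
  have mY: "(\<lambda>(s, \<omega>). \<eta> s \<omega> * (g s \<omega> - B s \<omega> * f s \<omega>)) \<in> borel_measurable (borel \<Otimes>\<^sub>M M)" by measurable
  have mY'[measurable]: "\<eta> t \<in> borel_measurable M" "f t \<in> borel_measurable M" "f a \<in> borel_measurable M"
    "(\<lambda>\<omega>. LBINT s:{a..t}. \<eta> s \<omega> * (g s \<omega> - B s \<omega> * f s \<omega>)) \<in> borel_measurable M"
    using measurable_section_fst[OF borel_measurable_LBINT_Icc[OF mY], of a t]
      measurable_section_fst[OF \<eta>_meas, of t] measurable_section_fst[OF f_meas] by auto
  \<comment> \<open>The first summand comes from \<open>weight_le\<close> for the boundary term, the
    second from \<open>int\<eta>BD\<close> for the integral. Neither involves \<open>n\<close>,
    which is what permits removing the localisation.\<close>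
  have Xbound: "AE \<omega> in M. \<bar>X n \<omega>\<bar> \<le> E * (C + 2 * c) + E * (C + 2 * c) * (C0 * (t - a) + 2)" for n
    using good D_le[of n] AE_space
  proof eventually_elim
    case (elim \<omega>)
    interpret w: path_weight a t C0 c "\<lambda>s. b0 s \<omega>" "\<lambda>s. k s \<omega>" "\<lambda>s. g s \<omega>" by fact
    have 2: "set_integrable lborel {a..t} (\<lambda>s. \<eta> s \<omega> * B s \<omega> * D n s \<omega>)"
      "(LBINT s:{a..t}. \<bar>\<eta> s \<omega> * B s \<omega> * D n s \<omega>\<bar>) \<le> E * (C + 2 * c) * (C0 * (t - a) + 2)"
      using int\<eta>BD[OF elim(1) measurable_section_snd[OF D_meas elim(3)] _ elim(3)] elim(2) by auto
    have "\<bar>LBINT s:{a..t}. \<eta> s \<omega> * B s \<omega> * D n s \<omega>\<bar> \<le> E * (C + 2 * c) * (C0 * (t - a) + 2)"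
      using order_trans[OF LBINT_abs_le[OF 2(1) set_integrable_abs[OF 2(1)]] 2(2)] by simp
    moreover have "\<eta> t \<omega> * \<bar>D n t \<omega>\<bar> \<le> E * (C + 2 * c) * exp (- w.\<kappa> t / 2)"
      using w.weight_le[of t "D n t \<omega>" C] elim(2) at C_nonneg by (simp add: w.\<eta>_def \<eta>_def E_def w.E0_def w.\<kappa>_def)
    moreover have "E * (C + 2 * c) * exp (- w.\<kappa> t / 2) \<le> E * (C + 2 * c) * 1"
      using w.\<kappa>_nonneg[of t] at C_nonneg c by (intro mult_left_mono) (auto simp: E_def)
    moreover have "\<bar>\<eta> t \<omega> * D n t \<omega>\<bar> = \<eta> t \<omega> * \<bar>D n t \<omega>\<bar>" by (simp add: abs_mult \<eta>_def)
    ultimately have "\<bar>\<eta> t \<omega> * D n t \<omega> + (LBINT s:{a..t}. \<eta> s \<omega> * B s \<omega> * D n s \<omega>)\<bar>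
      \<le> E * (C + 2 * c) + E * (C + 2 * c) * (C0 * (t - a) + 2)" by linarith
    then have "1 * \<bar>\<eta> t \<omega> * D n t \<omega> + (LBINT s:{a..t}. \<eta> s \<omega> * B s \<omega> * D n s \<omega>)\<bar>
      \<le> E * (C + 2 * c) + E * (C + 2 * c) * (C0 * (t - a) + 2)" by simp
    then show ?case
      unfolding X_def abs_mult[of "H \<omega>"] by (rule order_trans[rotated]) (intro mult_right_mono H_le abs_ge_zero)
  qed
  have Xlim: "AE \<omega> in M. (\<lambda>n. X n \<omega>) \<longlonglongrightarrow> Y \<omega>"
    using good \<tau>_lim g_integrable AE_space
  proof eventually_elim
    case (elim \<omega>)
    interpret w: path_weight a t C0 c "\<lambda>s. b0 s \<omega>" "\<lambda>s. k s \<omega>" "\<lambda>s. g s \<omega>" by fact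
    have [simp]: "w.\<eta> = (\<lambda>s. \<eta> s \<omega>)" by (simp add: fun_eq_iff w.\<eta>_def \<eta>_def)
    \<comment> \<open>Once \<open>\<tau> n\<close> exceeds \<open>t\<close>, stopping has no effect,
      so \<open>X n \<omega>\<close> is not merely close to \<open>Y \<omega>\<close> but equal to
      it for all large \<open>n\<close>.\<close>
    have ev: "\<forall>\<^sub>F n in sequentially. t \<le> \<tau> n \<omega>"
      using elim(2) by (simp add: filterlim_at_top)
    show ?case
    proof (rule tendsto_eventually, use ev in eventually_elim)
      case (elim n)
      have D: "D n s \<omega> = f s \<omega> - f a \<omega> - w.\<Gamma> s" if "s \<in> {a..t}" for s
      proof -
        have "(LBINT u:{0..s}. g u \<omega>) = (LBINT u:{0..a}. g u \<omega>) + (LBINT u:{a..s}. g u \<omega>)"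
          using that at \<open>\<forall>t\<ge>0. set_integrable lborel {0..t} (\<lambda>s. g s \<omega>)\<close> by (intro LBINT_split) auto
        then show ?thesis using that elim at by (simp add: D_def St_def S_def w.\<Gamma>_def)
      qed
      have i1: "set_integrable lborel {a..t} (\<lambda>s. \<eta> s \<omega> * B s \<omega> * f s \<omega>)"
        using int\<eta>BD[OF \<open>path_weight _ _ _ _ _ _ _\<close> f_sec[OF \<open>\<omega> \<in> space M\<close>] _ \<open>\<omega> \<in> space M\<close>] f_nonneg f_le
          w.\<kappa>_nonneg c by (simp add: w.\<kappa>_def add_increasing2)
      have i2: "set_integrable lborel {a..t} (\<lambda>s. \<eta> s \<omega> * B s \<omega> * f a \<omega>)"
        using w.int_\<eta>b by (simp add: B_def)
      have i3: "set_integrable lborel {a..t} (\<lambda>s. \<eta> s \<omega> * B s \<omega> * w.\<Gamma> s)"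
        using w.int_\<eta>b\<Gamma> by (simp add: B_def)
      have i4: "set_integrable lborel {a..t} (\<lambda>s. \<eta> s \<omega> * g s \<omega>)" using w.int_\<eta>g by simp
      have "(LBINT s:{a..t}. \<eta> s \<omega> * B s \<omega> * D n s \<omega>)
        = (LBINT s:{a..t}. \<eta> s \<omega> * B s \<omega> * f s \<omega> - \<eta> s \<omega> * B s \<omega> * f a \<omega> - \<eta> s \<omega> * B s \<omega> * w.\<Gamma> s)"
        by (intro set_lebesgue_integral_cong) (auto simp: D algebra_simps)
      also have "\<dots> = (LBINT s:{a..t}. \<eta> s \<omega> * B s \<omega> * f s \<omega>) - (LBINT s:{a..t}. \<eta> s \<omega> * B s \<omega> * f a \<omega>)
          - (LBINT s:{a..t}. \<eta> s \<omega> * B s \<omega> * w.\<Gamma> s)"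
        by (simp only: set_integral_diff(2)[OF set_integral_diff(1)[OF i1 i2] i3] set_integral_diff(2)[OF i1 i2])
      also have "(LBINT s:{a..t}. \<eta> s \<omega> * B s \<omega> * f a \<omega>) = (1 - \<eta> t \<omega>) * f a \<omega>"
        using w.LBINT_\<eta>b[of t] at by (simp add: B_def)
      also have "(LBINT s:{a..t}. \<eta> s \<omega> * B s \<omega> * w.\<Gamma> s) = (LBINT s:{a..t}. \<eta> s \<omega> * g s \<omega>) - \<eta> t \<omega> * w.\<Gamma> t"
        using w.LBINT_\<eta>g by (simp add: B_def)
      finally have "(LBINT s:{a..t}. \<eta> s \<omega> * B s \<omega> * D n s \<omega>)
        = (LBINT s:{a..t}. \<eta> s \<omega> * B s \<omega> * f s \<omega>) - (1 - \<eta> t \<omega>) * f a \<omega>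
          - ((LBINT s:{a..t}. \<eta> s \<omega> * g s \<omega>) - \<eta> t \<omega> * w.\<Gamma> t)" .
      moreover have Dt: "D n t \<omega> = f t \<omega> - f a \<omega> - w.\<Gamma> t" by (rule D) (use at in simp)
      ultimately have "\<eta> t \<omega> * D n t \<omega> + (LBINT s:{a..t}. \<eta> s \<omega> * B s \<omega> * D n s \<omega>)
        = \<eta> t \<omega> * f t \<omega> - f a \<omega> - ((LBINT s:{a..t}. \<eta> s \<omega> * g s \<omega>) - (LBINT s:{a..t}. \<eta> s \<omega> * B s \<omega> * f s \<omega>))"
        unfolding Dt by (simp add: algebra_simps)
      also have "(LBINT s:{a..t}. \<eta> s \<omega> * g s \<omega>) - (LBINT s:{a..t}. \<eta> s \<omega> * B s \<omega> * f s \<omega>)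
        = (LBINT s:{a..t}. \<eta> s \<omega> * (g s \<omega> - B s \<omega> * f s \<omega>))"
        using set_integral_diff(2)[OF i4 i1] by (simp add: right_diff_distrib mult.assoc)
      finally show "X n \<omega> = Y \<omega>" unfolding X_def Y_def by (simp only: right_diff_distrib)
    qed
  qed
  have Xm: "X n \<in> borel_measurable M" for n
  proof -
    have mB: "(\<lambda>(s, \<omega>). \<eta> s \<omega> * B s \<omega> * D n s \<omega>) \<in> borel_measurable (borel \<Otimes>\<^sub>M M)" by measurable
    note [measurable] = measurable_section_fst[OF borel_measurable_LBINT_Icc[OF mB], of a t]
      measurable_section_fst[OF \<eta>_meas, of t] measurable_section_fst[OF D_meas, of n t]
    show ?thesis unfolding X_def by measurable
  qed
  have "(\<lambda>n. \<integral>\<omega>. X n \<omega> \<partial>M) \<longlonglongrightarrow> (\<integral>\<omega>. Y \<omega> \<partial>M)"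
  proof (rule integral_dominated_convergence[where w = "\<lambda>_. E * (C + 2 * c) + E * (C + 2 * c) * (C0 * (t - a) + 2)"])
    show "Y \<in> borel_measurable M" unfolding Y_def by measurable
    show "AE \<omega> in M. norm (X n \<omega>) \<le> E * (C + 2 * c) + E * (C + 2 * c) * (C0 * (t - a) + 2)" for n
      using Xbound[of n] by simp
  qed (use Xm Xlim in auto)
  then have Y0: "(\<integral>\<omega>. Y \<omega> \<partial>M) = 0" using X0 LIMSEQ_unique[OF tendsto_const] by fastforce
  have \<eta>t_le: "AE \<omega> in M. \<eta> t \<omega> \<le> E"
    using good
  proof eventually_elim
    case (elim \<omega>)
    interpret w: path_weight a t C0 c "\<lambda>s. b0 s \<omega>" "\<lambda>s. k s \<omega>" "\<lambda>s. g s \<omega>" by fact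
    have "\<eta> t \<omega> \<le> E * exp (- w.\<kappa> t)"
      using w.\<eta>_le[of t] at by (simp add: w.\<eta>_def \<eta>_def E_def w.E0_def)
    also have "\<dots> \<le> E * 1" using w.\<kappa>_nonneg[of t] at by (intro mult_left_mono) (auto simp: E_def)
    finally show ?case by simp
  qed
  have Ypart: "integrable M (\<lambda>\<omega>. H \<omega> * (\<eta> t \<omega> * f t \<omega>))"
  proof (rule integrable_const_bound[where B = "E * C"])
    show "AE \<omega> in M. norm (H \<omega> * (\<eta> t \<omega> * f t \<omega>)) \<le> E * C"
      using \<eta>t_le
    proof eventually_elim
      case (elim \<omega>)
      have "\<bar>H \<omega>\<bar> * (\<eta> t \<omega> * f t \<omega>) \<le> 1 * (E * C)"
        using elim f_nonneg f_le C_nonneg H_le by (intro mult_mono) (auto simp: \<eta>_def E_def)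
      then show ?case using f_nonneg by (simp add: abs_mult \<eta>_def)
    qed
  qed simp
  have Ypart2: "integrable M (\<lambda>\<omega>. H \<omega> * f a \<omega>)"
  proof (rule integrable_const_bound[where B = "C"])
    have "\<bar>H \<omega>\<bar> * f a \<omega> \<le> 1 * C" for \<omega>
      using f_nonneg f_le H_le by (intro mult_mono) auto
    then show "AE \<omega> in M. norm (H \<omega> * f a \<omega>) \<le> C"
      using f_nonneg by (simp add: abs_mult)
  qed simp
  have Ybound: "AE \<omega> in M. norm (Y \<omega>) \<le> E * (C + 2 * c) + E * (C + 2 * c) * (C0 * (t - a) + 2)"
  proof -
    have "AE \<omega> in M. \<forall>n. \<bar>X n \<omega>\<bar> \<le> E * (C + 2 * c) + E * (C + 2 * c) * (C0 * (t - a) + 2)"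
      using Xbound by (simp add: AE_all_countable)
    with Xlim show ?thesis
    proof eventually_elim
      case (elim \<omega>)
      have "(\<lambda>n. \<bar>X n \<omega>\<bar>) \<longlonglongrightarrow> \<bar>Y \<omega>\<bar>" using elim(1) by (rule tendsto_rabs)
      then show ?case using elim(2) by (auto intro: LIMSEQ_le_const2)
    qed
  qed
  have Yi: "integrable M Y"
  proof (rule integrable_const_bound[OF Ybound])
    show "Y \<in> borel_measurable M" unfolding Y_def by measurable
  qed
  define Lt where "Lt \<omega> = H \<omega> * (LBINT s:{a..t}. \<eta> s \<omega> * (g s \<omega> - B s \<omega> * f s \<omega>))" for \<omega>
  \<comment> \<open>Integrability of the drift term is read off from the other terms of the identity
    and not from a bound on \<open>g\<close>, whose expectation may be infinite.\<close>
  have "integrable M (\<lambda>\<omega>. H \<omega> * (\<eta> t \<omega> * f t \<omega>) - H \<omega> * f a \<omega> - Y \<omega>)"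
    using Ypart Ypart2 Yi by (intro Bochner_Integration.integrable_diff)
  then have iL: "integrable M Lt" by (simp add: Y_def Lt_def[abs_def])
  then show ?int by (simp add: Lt_def[abs_def] B_def)
  have "(\<integral>\<omega>. Y \<omega> \<partial>M) = (\<integral>\<omega>. H \<omega> * (\<eta> t \<omega> * f t \<omega>) \<partial>M) - (\<integral>\<omega>. H \<omega> * f a \<omega> \<partial>M) - (\<integral>\<omega>. Lt \<omega> \<partial>M)"
    using Ypart Ypart2 iL unfolding Y_def Lt_def by simp
  then show ?eq using Y0 by (simp add: Lt_def B_def)
qed

end

section \<open>Supermartingale property until the meeting time\<close>

text \<open>\<open>f\<close> will be the distance of the coupled pair, \<open>g\<close> the
  generator applied to it and \<open>r\<close> the penalization rate along the first component. As
  \<open>r \<le> R < lam\<close>, the drift is nonpositive wherever \<open>f\<close> is not 0; at 0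
  it is arbitrary.\<close>

locale contracting_process = drift_process +
  fixes r :: "real \<Rightarrow> 'a \<Rightarrow> real" and R lam :: real
  assumes r_meas[measurable]: "(\<lambda>(s, \<omega>). r s \<omega>) \<in> borel_measurable (borel \<Otimes>\<^sub>M M)"
    and r_adapted: "\<And>s. 0 \<le> s \<Longrightarrow> r s \<in> borel_measurable (F s)"
    and r_nonneg: "\<And>s \<omega>. 0 \<le> r s \<omega>" and r_le: "\<And>s \<omega>. r s \<omega> \<le> R" and R_lam: "R < lam"
    and drift: "\<And>s \<omega>. f s \<omega> \<noteq> 0 \<Longrightarrow> g s \<omega> \<le> - (lam - r s \<omega>) * f s \<omega>"
begin

text \<open>A condition on almost every time instead of every time: this is what an exponential
  weight can detect, and what Fubini's theorem makes measurable, also jointly with the end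
  point.\<close>

definition free :: "real \<Rightarrow> real \<Rightarrow> 'a \<Rightarrow> bool" where
  "free a t \<omega> \<longleftrightarrow> (AE s in lborel. s \<in> {a..t} \<longrightarrow> f s \<omega> \<noteq> 0)"

lemma f_fst[measurable]: "f s \<in> borel_measurable M"
  by (rule measurable_section_fst[OF f_meas])

lemma free_iff:
  assumes "\<omega> \<in> space M"
  shows "free a t \<omega> \<longleftrightarrow> (LBINT s:{a..t}. indicator {0} (f s \<omega>) :: real) = 0"
proof -
  have [measurable]: "(\<lambda>s. f s \<omega>) \<in> borel_measurable borel" by (rule measurable_section_snd[OF f_meas assms])
  have i: "set_integrable lborel {a..t} (\<lambda>s. indicator {0} (f s \<omega>) :: real)"
    by (rule set_integrable_bounded_Icc[where C = 1]) (auto simp: indicator_def)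
  show ?thesis
    unfolding free_def set_lebesgue_integral_def
    by (subst integral_nonneg_eq_0_iff_AE) (use i in \<open>auto simp: set_integrable_def indicator_def elim!: eventually_mono\<close>)
qed

lemma free_meas_pair: "Measurable.pred (borel \<Otimes>\<^sub>M M) (\<lambda>p. free a (fst p) (snd p))"
proof -
  have "(\<lambda>(s, \<omega>). indicator {0} (f s \<omega>) :: real) \<in> borel_measurable (borel \<Otimes>\<^sub>M M)" by measurable
  note [measurable] = borel_measurable_LBINT_Icc[OF this, of a]
  have "Measurable.pred (borel \<Otimes>\<^sub>M M) (\<lambda>p. (LBINT s:{a..fst p}. indicator {0} (f s (snd p)) :: real) = 0)"
    by measurable
  then show ?thesis
    by (rule measurable_cong[THEN iffD1, rotated]) (auto simp: free_iff space_pair_measure)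
qed

lemma free_meas[measurable]: "Measurable.pred M (free a t)"
  using measurable_compose[of "\<lambda>\<omega>. (t, \<omega>)" M "borel \<Otimes>\<^sub>M M", OF _ free_meas_pair[of a]] by simp

lemma free_mono: "free a t \<omega> \<Longrightarrow> a \<le> a' \<Longrightarrow> t' \<le> t \<Longrightarrow> free a' t' \<omega>"
  unfolding free_def by (erule eventually_mono) auto

lemma free_split: "a \<le> c \<Longrightarrow> c \<le> t \<Longrightarrow> free a t \<omega> \<longleftrightarrow> free a c \<omega> \<and> free c t \<omega>"
  by (auto intro: free_mono) (unfold free_def, erule (1) eventually_elim2, auto)

text \<open>
  The drift is unconstrained where \<open>f = 0\<close>. The weight \<open>exp (- \<integral>k j)\<close> punishes time spent there at a
  rate of order \<open>j\<close>: the positive part of the drift then contributes at most \<open>O(1 / j)\<close>, and in the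
  limit only the paths that have spent no time at zero survive.
\<close>

lemma expectation_weighted_free_le:
  assumes at: "0 \<le> a" "a \<le> t"
    and H[measurable]: "H \<in> borel_measurable (F a)" and H0: "\<And>\<omega>. 0 \<le> H \<omega>" and H1: "\<And>\<omega>. H \<omega> \<le> 1"
  shows "(\<integral>\<omega>. H \<omega> * (exp (lam * (t - a) - (LBINT s:{a..t}. r s \<omega>)) * f t \<omega> * of_bool (free a t \<omega>)) \<partial>M)
    \<le> (\<integral>\<omega>. H \<omega> * f a \<omega> \<partial>M)"
proof -
  have [measurable]: "H \<in> borel_measurable M"
    by (rule measurable_from_subalg[OF subalg[OF at(1)] H])
  \<comment> \<open>The sign makes \<open>exp (- \<integral>b0)\<close> the growth factor
    \<open>exp (lam * (t - a) - \<integral>r)\<close> of the claim.\<close>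
  define b0 where "b0 s \<omega> = r s \<omega> - lam" for s \<omega>
  \<comment> \<open>The drift is nonpositive off 0, so \<open>p\<close> lives on the zero set, and
    the indicator makes it positive there. Hence its integral vanishes exactly when the path is
    free.\<close>
  define p where "p s \<omega> = max 0 (g s \<omega>) + indicator {0} (f s \<omega>)" for s \<omega>
  define m where "m s \<omega> = max 0 (- g s \<omega>)" for s \<omega>
  \<comment> \<open>The factor on \<open>p\<close> suppresses paths with time at zero and yields the
    gain \<open>p \<le> k j / real (Suc j)\<close>. The summand with \<open>m\<close> makes
    \<open>real (Suc j) * k j\<close> dominate \<open>\<bar>g\<bar>\<close>, as
    \<open>expectation_weighted\<close> demands, and is divided so that it fades in the
    limit.\<close>
  define k where "k j s \<omega> = real (Suc j) * p s \<omega> + m s \<omega> / real (Suc j)" for j s \<omega>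
  have meas[measurable]: "(\<lambda>(s, \<omega>). b0 s \<omega>) \<in> borel_measurable (borel \<Otimes>\<^sub>M M)"
    "(\<lambda>(s, \<omega>). p s \<omega>) \<in> borel_measurable (borel \<Otimes>\<^sub>M M)"
    "(\<lambda>(s, \<omega>). m s \<omega>) \<in> borel_measurable (borel \<Otimes>\<^sub>M M)"
    unfolding b0_def p_def m_def by measurable
  have p0: "0 \<le> p s \<omega>" and m0: "0 \<le> m s \<omega>" for s \<omega> by (auto simp: p_def m_def)
  have lam0: "0 \<le> lam" using r_nonneg[of 0 undefined] r_le[of 0 undefined] R_lam by linarith
  have int: "AE \<omega> in M. set_integrable lborel {a..t} (\<lambda>s. g s \<omega>) \<and> set_integrable lborel {a..t} (\<lambda>s. p s \<omega>)
      \<and> set_integrable lborel {a..t} (\<lambda>s. m s \<omega>)"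
    using g_integrable AE_space
  proof eventually_elim
    case (elim \<omega>)
    have g: "set_integrable lborel {a..t} (\<lambda>s. g s \<omega>)"
      by (rule set_integrable_subset[of _ "{0..t}"]) (use elim at in auto)
    have [measurable]: "(\<lambda>s. f s \<omega>) \<in> borel_measurable borel" by (rule measurable_section_snd[OF f_meas elim(2)])
    have i: "set_integrable lborel {a..t} (\<lambda>s. indicator {0} (f s \<omega>) :: real)"
      by (rule set_integrable_bounded_Icc[where C = 1]) (auto simp: indicator_def)
    have ga: "set_integrable lborel {a..t} (\<lambda>s. \<bar>g s \<omega>\<bar>)" using g by (rule set_integrable_abs)
    have 1: "set_integrable lborel {a..t} (\<lambda>s. (\<bar>g s \<omega>\<bar> + g s \<omega>) / 2)"
      "set_integrable lborel {a..t} (\<lambda>s. (\<bar>g s \<omega>\<bar> - g s \<omega>) / 2)"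
      using set_integral_add(1)[OF ga g] set_integral_diff(1)[OF ga g] by auto
    have 2: "(\<bar>x\<bar> + x) / 2 = max 0 x" "(\<bar>x\<bar> - x) / 2 = max 0 (- x)" for x :: real by auto
    show ?case using g set_integral_add(1)[OF 1(1) i] 1(2) by (simp add: 2 p_def m_def)
  qed
  define \<eta> where "\<eta> j s \<omega> = exp (- (LBINT u:{a..s}. b0 u \<omega> + k j u \<omega>))" for j s \<omega>
  have le: "(\<integral>\<omega>. H \<omega> * (\<eta> j t \<omega> * f t \<omega>) \<partial>M) \<le> (\<integral>\<omega>. H \<omega> * f a \<omega> \<partial>M) + exp (lam * (t - a)) / real (Suc j)" for j
  proof -
    have km: "(\<lambda>(s, \<omega>). k j s \<omega>) \<in> borel_measurable (borel \<Otimes>\<^sub>M M)"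
      unfolding k_def by measurable
    have b0_le: "\<bar>b0 s \<omega>\<bar> \<le> lam" for s \<omega>
      using r_nonneg[of s \<omega>] r_le[of s \<omega>] R_lam by (auto simp: b0_def)
    have k0: "0 \<le> k j s \<omega>" for s \<omega> using p0 m0 by (simp add: k_def)
    have p_le: "p s \<omega> \<le> k j s \<omega> / real (Suc j)" for s \<omega>
    proof -
      have "k j s \<omega> / real (Suc j) = p s \<omega> + m s \<omega> / (real (Suc j) * real (Suc j))"
        by (simp add: k_def add_divide_distrib del: of_nat_Suc)
      then show ?thesis using m0[of s \<omega>] by simp
    qed
    have g_le: "\<bar>g s \<omega>\<bar> \<le> real (Suc j) * k j s \<omega>" for s \<omega>
    proof -
      have "real (Suc j) * k j s \<omega> = (real (Suc j) * real (Suc j)) * p s \<omega> + m s \<omega>"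
        by (simp add: k_def distrib_left del: of_nat_Suc)
      moreover have "1 * p s \<omega> \<le> (real (Suc j) * real (Suc j)) * p s \<omega>"
        using mult_mono[of 1 "real (Suc j)" 1 "real (Suc j)"] by (intro mult_right_mono p0) simp
      moreover have "\<bar>g s \<omega>\<bar> \<le> p s \<omega> + m s \<omega>" by (auto simp: p_def m_def indicator_def)
      ultimately show ?thesis by linarith
    qed
    have k_int: "AE \<omega> in M. set_integrable lborel {a..t} (\<lambda>s. k j s \<omega>)"
      using int by eventually_elim (auto simp: k_def intro!: set_integral_add)
    have adapted: "b0 s \<in> borel_measurable (F s)" "k j s \<in> borel_measurable (F s)" if "0 \<le> s" for s
    proof -
      note [measurable] = f_adapted[OF that] g_adapted[OF that] r_adapted[OF that]
      show "b0 s \<in> borel_measurable (F s)" "k j s \<in> borel_measurable (F s)"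
        unfolding b0_def k_def p_def m_def by measurable
    qed
    have Habs: "\<bar>H \<omega>\<bar> \<le> 1" for \<omega> using H0[of \<omega>] H1[of \<omega>] by simp
    note W = expectation_weighted[OF at meas(1) km adapted b0_le k0 g_le _ k_int H Habs, folded \<eta>_def]
    have "(\<integral>\<omega>. H \<omega> * (LBINT s:{a..t}. \<eta> j s \<omega> * (g s \<omega> - (b0 s \<omega> + k j s \<omega>) * f s \<omega>)) \<partial>M)
      \<le> (\<integral>\<omega>. exp (lam * (t - a)) / real (Suc j) \<partial>M)"
    proof (rule integral_mono_AE)
      show "integrable M (\<lambda>\<omega>. H \<omega> * (LBINT s:{a..t}. \<eta> j s \<omega> * (g s \<omega> - (b0 s \<omega> + k j s \<omega>) * f s \<omega>)))"
        by (rule W(1)) auto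
      show "AE \<omega> in M. H \<omega> * (LBINT s:{a..t}. \<eta> j s \<omega> * (g s \<omega> - (b0 s \<omega> + k j s \<omega>) * f s \<omega>)) \<le> exp (lam * (t - a)) / real (Suc j)"
        using int k_int AE_space
      proof eventually_elim
        case (elim \<omega>)
        have fm: "(\<lambda>s. f s \<omega>) \<in> borel_measurable borel" by (rule measurable_section_snd[OF f_meas elim(3)])
        have b0i: "set_integrable lborel {a..t} (\<lambda>s. b0 s \<omega>)"
          by (rule set_integrable_bounded_Icc[where C = lam])
            (use measurable_section_snd[OF meas(1) elim(3)] b0_le in auto)
        interpret w: path_weight a t lam "real (Suc j)" "\<lambda>s. b0 s \<omega>" "\<lambda>s. k j s \<omega>" "\<lambda>s. g s \<omega>"
          by unfold_locales (use elim at b0i b0_le k0 g_le in auto)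
        have \<eta>e: "w.\<eta> = (\<lambda>s. \<eta> j s \<omega>)" by (simp add: fun_eq_iff w.\<eta>_def \<eta>_def)
        have pt: "\<eta> j s \<omega> * (g s \<omega> - (b0 s \<omega> + k j s \<omega>) * f s \<omega>) \<le> exp (lam * (t - a)) / real (Suc j) * (exp (- w.\<kappa> s) * k j s \<omega>)"
          if s: "s \<in> {a..t}" for s
        proof -
          \<comment> \<open>At 0 the terms with \<open>f\<close> disappear and \<open>p\<close>
            dominates \<open>g\<close>. Elsewhere the drift condition is
            \<open>g \<le> b0 * f\<close>, and \<open>k j * f\<close> has the favourable
            sign.\<close>
          have "g s \<omega> - (b0 s \<omega> + k j s \<omega>) * f s \<omega> \<le> p s \<omega>"
          proof (cases "f s \<omega> = 0")
            case True then show ?thesis by (simp add: p_def)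
          next
            case False
            have "0 \<le> k j s \<omega> * f s \<omega>" using k0 f_nonneg by simp
            then have "g s \<omega> - (b0 s \<omega> + k j s \<omega>) * f s \<omega> \<le> 0"
              using drift[OF False] by (simp add: b0_def algebra_simps)
            then show ?thesis using p0[of s \<omega>] by linarith
          qed
          also have "\<dots> \<le> k j s \<omega> / real (Suc j)" by (rule p_le)
          finally have 1: "g s \<omega> - (b0 s \<omega> + k j s \<omega>) * f s \<omega> \<le> k j s \<omega> / real (Suc j)" .
          have "\<eta> j s \<omega> * (g s \<omega> - (b0 s \<omega> + k j s \<omega>) * f s \<omega>) \<le> \<eta> j s \<omega> * (k j s \<omega> / real (Suc j))"
            by (intro mult_left_mono 1) (simp add: \<eta>_def)
          also have "\<dots> \<le> (exp (lam * (t - a)) * exp (- w.\<kappa> s)) * (k j s \<omega> / real (Suc j))"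
            using w.\<eta>_le[OF s] k0 by (intro mult_right_mono) (auto simp: \<eta>e w.E0_def)
          finally show ?thesis by simp
        qed
        have i1: "set_integrable lborel {a..t} (\<lambda>s. \<eta> j s \<omega> * (g s \<omega> - (b0 s \<omega> + k j s \<omega>) * f s \<omega>))"
        proof -
          have A: "set_integrable lborel {a..t} (\<lambda>s. \<eta> j s \<omega> * g s \<omega>)" using w.int_\<eta>g by (simp add: \<eta>e)
          have B: "set_integrable lborel {a..t} (\<lambda>s. \<eta> j s \<omega> * (b0 s \<omega> + k j s \<omega>))" using w.int_\<eta>b by (simp add: \<eta>e)
          have "set_integrable lborel {a..t} (\<lambda>s. \<eta> j s \<omega> * (b0 s \<omega> + k j s \<omega>) * f s \<omega>)"
            unfolding set_integrable_def
          proof (rule Bochner_Integration.integrable_bound)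
            show "integrable lborel (\<lambda>s. C * (indicator {a..t} s *\<^sub>R (\<eta> j s \<omega> * (b0 s \<omega> + k j s \<omega>))))"
              using B unfolding set_integrable_def by (rule integrable_mult_right[rotated])
            have "(\<lambda>s. (indicator {a..t} s *\<^sub>R (\<eta> j s \<omega> * (b0 s \<omega> + k j s \<omega>))) * f s \<omega>) \<in> borel_measurable lborel"
              using B fm unfolding set_integrable_def
              by (intro borel_measurable_times) (auto dest: borel_measurable_integrable)
            then show "(\<lambda>s. indicator {a..t} s *\<^sub>R (\<eta> j s \<omega> * (b0 s \<omega> + k j s \<omega>) * f s \<omega>)) \<in> borel_measurable lborel"
              by (simp add: mult.assoc)
            have "norm (indicator {a..t} s *\<^sub>R (\<eta> j s \<omega> * (b0 s \<omega> + k j s \<omega>) * f s \<omega>))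
                \<le> norm (C * (indicator {a..t} s *\<^sub>R (\<eta> j s \<omega> * (b0 s \<omega> + k j s \<omega>))))" for s
            proof -
              have "\<bar>f s \<omega>\<bar> \<le> \<bar>C\<bar>" using f_nonneg[of s \<omega>] f_le[of s \<omega>] by simp
              then have "\<bar>f s \<omega>\<bar> * \<bar>\<eta> j s \<omega> * (b0 s \<omega> + k j s \<omega>)\<bar> \<le> \<bar>C\<bar> * \<bar>\<eta> j s \<omega> * (b0 s \<omega> + k j s \<omega>)\<bar>"
                by (rule mult_right_mono) simp
              then show ?thesis by (simp add: indicator_def abs_mult mult.commute mult.left_commute)
            qed
            then show "AE s in lborel. norm (indicator {a..t} s *\<^sub>R (\<eta> j s \<omega> * (b0 s \<omega> + k j s \<omega>) * f s \<omega>))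
                \<le> norm (C * (indicator {a..t} s *\<^sub>R (\<eta> j s \<omega> * (b0 s \<omega> + k j s \<omega>))))" by simp
          qed
          from set_integral_diff(1)[OF A this] show ?thesis by (simp add: right_diff_distrib mult.assoc)
        qed
        have i2: "set_integrable lborel {a..t} (\<lambda>s. exp (lam * (t - a)) / real (Suc j) * (exp (- w.\<kappa> s) * k j s \<omega>))"
          using w.LBINT_exp_k(1)[of t] at by (intro set_integrable_mult_right) auto
        have "(LBINT s:{a..t}. \<eta> j s \<omega> * (g s \<omega> - (b0 s \<omega> + k j s \<omega>) * f s \<omega>))
          \<le> (LBINT s:{a..t}. exp (lam * (t - a)) / real (Suc j) * (exp (- w.\<kappa> s) * k j s \<omega>))"
          by (rule set_integral_mono[OF i1 i2 pt])
        also have "\<dots> = exp (lam * (t - a)) / real (Suc j) * (1 - exp (- w.\<kappa> t))"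
          using w.LBINT_exp_k(2)[of t] at by simp
        also have "\<dots> \<le> exp (lam * (t - a)) / real (Suc j) * 1" by (intro mult_left_mono) auto
        finally have 1: "(LBINT s:{a..t}. \<eta> j s \<omega> * (g s \<omega> - (b0 s \<omega> + k j s \<omega>) * f s \<omega>)) \<le> exp (lam * (t - a)) / real (Suc j)"
          by simp
        have "H \<omega> * (LBINT s:{a..t}. \<eta> j s \<omega> * (g s \<omega> - (b0 s \<omega> + k j s \<omega>) * f s \<omega>)) \<le> H \<omega> * (exp (lam * (t - a)) / real (Suc j))"
          by (intro mult_left_mono 1 H0)
        also have "\<dots> \<le> 1 * (exp (lam * (t - a)) / real (Suc j))"
          by (intro mult_right_mono H1) simp
        finally show ?case by simp
      qed
    qed simp
    also have "\<dots> = exp (lam * (t - a)) / real (Suc j)" by (simp add: prob_space)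
    finally show ?thesis using W(2) by simp
  qed
  define L where "L \<omega> = H \<omega> * (exp (lam * (t - a) - (LBINT s:{a..t}. r s \<omega>)) * f t \<omega> * of_bool (free a t \<omega>))" for \<omega>
  have rm: "(\<lambda>\<omega>. LBINT s:{a..t}. r s \<omega>) \<in> borel_measurable M"
    by (rule measurable_section_fst[OF borel_measurable_LBINT_Icc[OF r_meas]])
  have "(\<lambda>j. \<integral>\<omega>. H \<omega> * (\<eta> j t \<omega> * f t \<omega>) \<partial>M) \<longlonglongrightarrow> (\<integral>\<omega>. L \<omega> \<partial>M)"
  proof (rule integral_dominated_convergence[where w = "\<lambda>_. exp (lam * (t - a)) * C"])
    show "L \<in> borel_measurable M" unfolding L_def using rm by measurable
    show mj: "(\<lambda>\<omega>. H \<omega> * (\<eta> j t \<omega> * f t \<omega>)) \<in> borel_measurable M" for j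
    proof -
      have "(\<lambda>(u, \<omega>). b0 u \<omega> + k j u \<omega>) \<in> borel_measurable (borel \<Otimes>\<^sub>M M)" unfolding k_def by measurable
      note [measurable] = measurable_section_fst[OF borel_measurable_LBINT_Icc[OF this], of a t]
      show ?thesis unfolding \<eta>_def by measurable
    qed
    have ri: "set_integrable lborel {a..t} (\<lambda>s. r s \<omega>)" if "\<omega> \<in> space M" for \<omega>
      by (rule set_integrable_bounded_Icc[where C = R])
        (use measurable_section_snd[OF r_meas that] r_nonneg r_le in auto)
    have \<eta>eq: "AE \<omega> in M. \<forall>j. \<eta> j t \<omega> = exp (lam * (t - a) - (LBINT s:{a..t}. r s \<omega>))
        * exp (- (real (Suc j) * (LBINT s:{a..t}. p s \<omega>))) * exp (- ((LBINT s:{a..t}. m s \<omega>) / real (Suc j)))"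
      using int AE_space
    proof eventually_elim
      case (elim \<omega>)
      show ?case
      proof
        fix j
        have ip: "set_integrable lborel {a..t} (\<lambda>s. real (Suc j) * p s \<omega>)"
          and im: "set_integrable lborel {a..t} (\<lambda>s. m s \<omega> / real (Suc j))"
          using elim(1) by (auto intro!: set_integrable_mult_right simp del: of_nat_Suc)
        have ib: "set_integrable lborel {a..t} (\<lambda>s. b0 s \<omega>)"
          unfolding b0_def using ri[OF elim(2)] by (intro set_integral_diff(1)) auto
        have "(LBINT u:{a..t}. b0 u \<omega> + k j u \<omega>)
          = (LBINT u:{a..t}. b0 u \<omega>) + ((LBINT s:{a..t}. real (Suc j) * p s \<omega>) + (LBINT s:{a..t}. m s \<omega> / real (Suc j)))"
          unfolding k_def by (simp only: set_integral_add(2)[OF ib set_integral_add(1)[OF ip im]] set_integral_add(2)[OF ip im])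
        also have "(LBINT u:{a..t}. b0 u \<omega>) = (LBINT s:{a..t}. r s \<omega>) - lam * (t - a)"
          unfolding b0_def using set_integral_diff(2)[OF ri[OF elim(2)] set_integrable_const_Icc[of a t lam]]
          by (simp add: LBINT_const_Icc at)
        finally show "\<eta> j t \<omega> = exp (lam * (t - a) - (LBINT s:{a..t}. r s \<omega>))
          * exp (- (real (Suc j) * (LBINT s:{a..t}. p s \<omega>))) * exp (- ((LBINT s:{a..t}. m s \<omega>) / real (Suc j)))"
          by (simp add: \<eta>_def exp_add[symmetric] del: of_nat_Suc)
      qed
    qed
    have r_int0: "0 \<le> (LBINT s:{a..t}. r s \<omega>)" for \<omega>
      unfolding set_lebesgue_integral_def by (intro Bochner_Integration.integral_nonneg) (auto simp: r_nonneg indicator_def)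
    have p_int0: "0 \<le> (LBINT s:{a..t}. p s \<omega>)" and m_int0: "0 \<le> (LBINT s:{a..t}. m s \<omega>)" for \<omega>
      unfolding set_lebesgue_integral_def
      by (auto intro!: Bochner_Integration.integral_nonneg simp: p0 m0 indicator_def)
    show "AE \<omega> in M. norm (H \<omega> * (\<eta> j t \<omega> * f t \<omega>)) \<le> exp (lam * (t - a)) * C" for j
      using \<eta>eq
    proof eventually_elim
      case (elim \<omega>)
      have "\<eta> j t \<omega> \<le> exp (lam * (t - a)) * 1 * 1"
        unfolding elim[rule_format]
        by (intro mult_mono) (use r_int0[of \<omega>] p_int0[of \<omega>] m_int0[of \<omega>] in auto)
      then have "H \<omega> * (\<eta> j t \<omega> * f t \<omega>) \<le> 1 * (exp (lam * (t - a)) * C)"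
        using H0 H1 f_nonneg f_le C_nonneg by (intro mult_mono) (auto simp: \<eta>_def)
      then show ?case using H0 f_nonneg by (simp add: abs_mult \<eta>_def)
    qed
    show "AE \<omega> in M. (\<lambda>j. H \<omega> * (\<eta> j t \<omega> * f t \<omega>)) \<longlonglongrightarrow> L \<omega>"
      using \<eta>eq int AE_space
    proof eventually_elim
      case (elim \<omega>)
      define P where "P = (LBINT s:{a..t}. p s \<omega>)"
      define Nn where "Nn = (LBINT s:{a..t}. m s \<omega>)"
      have [measurable]: "(\<lambda>s. f s \<omega>) \<in> borel_measurable borel" by (rule measurable_section_snd[OF f_meas elim(3)])
      have free_P: "free a t \<omega> \<longleftrightarrow> P = 0"
      proof -
        have "P = 0 \<longleftrightarrow> (AE s in lborel. indicator {a..t} s *\<^sub>R p s \<omega> = 0)"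
          unfolding P_def set_lebesgue_integral_def
          by (rule integral_nonneg_eq_0_iff_AE) (use elim(2) p0 in \<open>auto simp: set_integrable_def\<close>)
        also have "\<dots> \<longleftrightarrow> free a t \<omega>"
          unfolding free_def
        proof (intro iffI; elim eventually_mono)
          fix s assume "indicator {a..t} s *\<^sub>R p s \<omega> = 0"
          then show "s \<in> {a..t} \<longrightarrow> f s \<omega> \<noteq> 0" by (auto simp: p_def indicator_def split: if_splits)
        next
          fix s assume s: "s \<in> {a..t} \<longrightarrow> f s \<omega> \<noteq> 0"
          have "g s \<omega> \<le> 0" if "f s \<omega> \<noteq> 0"
          proof -
            have "0 \<le> (lam - r s \<omega>) * f s \<omega>" using r_le[of s \<omega>] R_lam f_nonneg by simp
            then show ?thesis using drift[OF that] by (simp add: algebra_simps)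
          qed
          then show "indicator {a..t} s *\<^sub>R p s \<omega> = 0" using s by (auto simp: p_def indicator_def)
        qed
        finally show ?thesis by simp
      qed
      have mlim: "(\<lambda>j. exp (- (Nn / real (Suc j)))) \<longlonglongrightarrow> exp (- 0)"
        by (intro tendsto_exp tendsto_minus LIMSEQ_Suc[OF lim_const_over_n])
      have plim: "(\<lambda>j. exp (- (real (Suc j) * P))) \<longlonglongrightarrow> of_bool (P = 0)"
      proof (cases "P = 0")
        case True then show ?thesis by simp
      next
        case False
        then have "0 < P" using p_int0[of \<omega>] by (simp add: P_def)
        then have "filterlim (\<lambda>j. real (Suc j) * P) at_top sequentially"
          by (intro filterlim_tendsto_pos_mult_at_top_iff[THEN iffD2, OF tendsto_const] filterlim_compose[OF filterlim_real_sequentially filterlim_Suc] | subst mult.commute)+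
        then have "(\<lambda>j. exp (- (real (Suc j) * P))) \<longlonglongrightarrow> 0"
          by (intro filterlim_compose[OF exp_at_bot] filterlim_uminus_at_bot_at_top[THEN filterlim_compose])
        with False show ?thesis by simp
      qed
      have "(\<lambda>j. H \<omega> * (exp (lam * (t - a) - (LBINT s:{a..t}. r s \<omega>)) * exp (- (real (Suc j) * P)) * exp (- (Nn / real (Suc j))) * f t \<omega>))
        \<longlonglongrightarrow> H \<omega> * (exp (lam * (t - a) - (LBINT s:{a..t}. r s \<omega>)) * of_bool (P = 0) * exp (- 0) * f t \<omega>)"
        by (intro tendsto_intros plim mlim)
      then show ?case using elim(1) by (simp add: L_def free_P P_def Nn_def mult_ac)
    qed
  qed simp
  moreover have "(\<lambda>j. (\<integral>\<omega>. H \<omega> * f a \<omega> \<partial>M) + exp (lam * (t - a)) / real (Suc j)) \<longlonglongrightarrow> (\<integral>\<omega>. H \<omega> * f a \<omega> \<partial>M) + 0"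
    by (intro tendsto_add tendsto_const LIMSEQ_Suc[OF lim_const_over_n])
  ultimately have "(\<integral>\<omega>. L \<omega> \<partial>M) \<le> (\<integral>\<omega>. H \<omega> * f a \<omega> \<partial>M) + 0"
    by (rule LIMSEQ_le) (use le in auto)
  then show ?thesis by (simp add: L_def)
qed

end

section \<open>Detecting the meeting time on a countable grid\<close>

lemma pred_Bex_countable:
  assumes "countable X" "\<And>i. i \<in> X \<Longrightarrow> Measurable.pred M (P i)"
  shows "Measurable.pred M (\<lambda>x. \<exists>i\<in>X. P i x)"
  unfolding pred_def using assms by (intro sets.sets_Collect_countable_Ex') (auto simp: pred_def)

lemma pred_Ball_countable:
  assumes "countable X" "\<And>i. i \<in> X \<Longrightarrow> Measurable.pred M (P i)"
  shows "Measurable.pred M (\<lambda>x. \<forall>i\<in>X. P i x)"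
  unfolding pred_def using assms by (intro sets.sets_Collect_countable_All') (auto simp: pred_def)

lemma AE_eq_0_if_integral_le_0:
  fixes h :: "'w \<Rightarrow> real"
  assumes "integrable M h" "\<And>\<omega>. 0 \<le> h \<omega>" "(\<integral>\<omega>. h \<omega> \<partial>M) \<le> 0"
  shows "AE \<omega> in M. h \<omega> = 0"
proof -
  have "(\<integral>\<omega>. h \<omega> \<partial>M) = 0" using assms by (intro antisym Bochner_Integration.integral_nonneg)
  then show ?thesis using assms by (subst (asm) integral_nonneg_eq_0_iff_AE) auto
qed

context contracting_process
begin

lemma expectation_free_le:
  assumes at: "0 \<le> a" "a \<le> t"
    and H[measurable]: "H \<in> borel_measurable (F a)" and H0: "\<And>\<omega>. 0 \<le> H \<omega>" and H1: "\<And>\<omega>. H \<omega> \<le> 1"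
  shows "(\<integral>\<omega>. H \<omega> * (f t \<omega> * of_bool (free a t \<omega>)) \<partial>M) \<le> (\<integral>\<omega>. H \<omega> * f a \<omega> \<partial>M)"
proof -
  have [measurable]: "H \<in> borel_measurable M"
    by (rule measurable_from_subalg[OF subalg[OF at(1)] H])
  have rm[measurable]: "(\<lambda>\<omega>. LBINT s:{a..t}. r s \<omega>) \<in> borel_measurable M"
    by (rule measurable_section_fst[OF borel_measurable_LBINT_Icc[OF r_meas]])
  have ri: "set_integrable lborel {a..t} (\<lambda>s. r s \<omega>)" if "\<omega> \<in> space M" for \<omega>
    by (rule set_integrable_bounded_Icc[where C = R])
      (use measurable_section_snd[OF r_meas that] r_nonneg r_le in auto)
  have r0: "0 \<le> (LBINT s:{a..t}. r s \<omega>)" for \<omega>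
    unfolding set_lebesgue_integral_def by (intro Bochner_Integration.integral_nonneg) (auto simp: r_nonneg indicator_def)
  have "(\<integral>\<omega>. H \<omega> * (f t \<omega> * of_bool (free a t \<omega>)) \<partial>M)
    \<le> (\<integral>\<omega>. H \<omega> * (exp (lam * (t - a) - (LBINT s:{a..t}. r s \<omega>)) * f t \<omega> * of_bool (free a t \<omega>)) \<partial>M)"
  proof (rule integral_mono')
    show "integrable M (\<lambda>\<omega>. H \<omega> * (exp (lam * (t - a) - (LBINT s:{a..t}. r s \<omega>)) * f t \<omega> * of_bool (free a t \<omega>)))"
    proof (rule integrable_const_bound[where B = "exp (lam * (t - a)) * C"])
      have "H \<omega> * (exp (lam * (t - a) - (LBINT s:{a..t}. r s \<omega>)) * f t \<omega> * of_bool (free a t \<omega>)) \<le> 1 * (exp (lam * (t - a)) * C * 1)" for \<omega>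
        using r0[of \<omega>] H0[of \<omega>] H1[of \<omega>] f_nonneg[of t \<omega>] f_le[of t \<omega>] C_nonneg by (intro mult_mono) auto
      then show "AE \<omega> in M. norm (H \<omega> * (exp (lam * (t - a) - (LBINT s:{a..t}. r s \<omega>)) * f t \<omega> * of_bool (free a t \<omega>))) \<le> exp (lam * (t - a)) * C"
        using H0 f_nonneg by (intro AE_I2) (simp add: abs_mult)
    qed measurable
    fix \<omega> assume \<omega>: "\<omega> \<in> space M"
    have "(LBINT s:{a..t}. r s \<omega>) \<le> (LBINT s:{a..t}. R)"
      using ri[OF \<omega>] r_le by (intro set_integral_mono) auto
    also have "\<dots> = R * (t - a)" by (simp add: LBINT_const_Icc at)
    also have "\<dots> \<le> lam * (t - a)" using R_lam at by (intro mult_right_mono) auto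
    finally have "1 \<le> exp (lam * (t - a) - (LBINT s:{a..t}. r s \<omega>))" by simp
    then have "1 * (f t \<omega> * of_bool (free a t \<omega>)) \<le> exp (lam * (t - a) - (LBINT s:{a..t}. r s \<omega>)) * (f t \<omega> * of_bool (free a t \<omega>))"
      using f_nonneg by (intro mult_right_mono) auto
    then show "H \<omega> * (f t \<omega> * of_bool (free a t \<omega>))
      \<le> H \<omega> * (exp (lam * (t - a) - (LBINT s:{a..t}. r s \<omega>)) * f t \<omega> * of_bool (free a t \<omega>))"
      using H0 by (intro mult_left_mono) (auto simp: mult.assoc)
  qed (use H0 f_nonneg in auto)
  also have "\<dots> \<le> (\<integral>\<omega>. H \<omega> * f a \<omega> \<partial>M)" by (rule expectation_weighted_free_le[OF assms])
  finally show ?thesis .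
qed

text \<open>Starting from \<open>f s = 0\<close>, the weight with rate \<open>\<bar>g\<bar>\<close>
  bounds the weighted expectation of \<open>f\<close> at a later time by that of
  \<open>1 - exp (- \<integral>\<bar>g\<bar>)\<close>, whatever the sign of the drift. This tends to
  0 along grid times that approach \<open>s\<close> from the right, whereas on the bad event
  \<open>f\<close> is at least \<open>\<epsilon>\<close> at all of them.\<close>

lemma AE_small_after_zero:
  assumes s: "0 \<le> s" "0 < \<delta>" "0 < \<epsilon>" and T: "countable T" "\<And>u v. s \<le> u \<Longrightarrow> u < v \<Longrightarrow> \<exists>q\<in>T. u < q \<and> q < v"
  shows "AE \<omega> in M. f s \<omega> = 0 \<longrightarrow> (\<exists>q\<in>T. s \<le> q \<and> q \<le> s + \<delta> \<and> f q \<omega> < \<epsilon>)"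
proof -
  have "\<exists>q. q \<in> T \<and> s < q \<and> q < s + \<delta> / real (Suc n)" for n
    using T(2)[of s "s + \<delta> / real (Suc n)"] s by (auto simp del: of_nat_Suc)
  then obtain q where q: "\<And>n. q n \<in> T" "\<And>n. s < q n" "\<And>n. q n < s + \<delta> / real (Suc n)" by metis
  have q\<delta>: "q n \<le> s + \<delta>" for n
  proof -
    have "\<delta> / real (Suc n) \<le> \<delta> / 1" using s by (intro divide_left_mono) auto
    then show ?thesis using q(3)[of n] by simp
  qed
  have qlim: "q \<longlonglongrightarrow> s"
  proof (rule tendsto_sandwich[of "\<lambda>_. s" _ _ "\<lambda>n. s + \<delta> / real (Suc n)"])
    have "(\<lambda>n. s + \<delta> / real (Suc n)) \<longlonglongrightarrow> s + 0"
      by (intro tendsto_add tendsto_const LIMSEQ_Suc[OF lim_const_over_n])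
    then show "(\<lambda>n. s + \<delta> / real (Suc n)) \<longlonglongrightarrow> s" by simp
  qed (use less_imp_le[OF q(2)] less_imp_le[OF q(3)] in \<open>auto simp del: of_nat_Suc\<close>)
  define bad where "bad \<omega> \<longleftrightarrow> f s \<omega> = 0 \<and> (\<forall>q\<in>T \<inter> {s..s + \<delta>}. \<epsilon> \<le> f q \<omega>)" for \<omega>
  have bad_meas[measurable]: "Measurable.pred M bad"
    unfolding bad_def using T(1) by (intro pred_intros_logic pred_Ball_countable countable_Int1) measurable
  define \<kappa> where "\<kappa> t \<omega> = (LBINT u:{s..t}. \<bar>g u \<omega>\<bar>)" for t \<omega>
  have gm: "(\<lambda>(u, \<omega>). \<bar>g u \<omega>\<bar>) \<in> borel_measurable (borel \<Otimes>\<^sub>M M)" by measurable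
  have \<kappa>m[measurable]: "\<kappa> t \<in> borel_measurable M" for t
    unfolding \<kappa>_def by (rule measurable_section_fst[OF borel_measurable_LBINT_Icc[OF gm]])
  have int: "AE \<omega> in M. set_integrable lborel {s..s + \<delta>} (\<lambda>u. g u \<omega>)"
    using g_integrable by eventually_elim (rule set_integrable_subset[of _ "{0..s + \<delta>}"], use s in auto)
  have \<kappa>0: "0 \<le> \<kappa> t \<omega>" for t \<omega>
    unfolding \<kappa>_def set_lebesgue_integral_def by (intro Bochner_Integration.integral_nonneg) (auto simp: indicator_def)
  have le: "(\<integral>\<omega>. of_bool (bad \<omega>) * (exp (- \<kappa> (q n) \<omega>) * \<epsilon>) \<partial>M) \<le> (\<integral>\<omega>. 1 - exp (- \<kappa> (q n) \<omega>) \<partial>M)" for n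
  proof -
    define t where "t = q n"
    have st: "s \<le> t" "t \<le> s + \<delta>" using q(2)[of n] q\<delta>[of n] by (auto simp: t_def)
    \<comment> \<open>Only the part of the bad event known at time \<open>s\<close> enters
      \<open>H\<close>; the lower bound \<open>\<epsilon>\<close> at the grid time is used
      afterwards, under the expectation.\<close>
    define H where "H \<omega> = (indicator {0} (f s \<omega>) :: real)" for \<omega>
    have H[measurable]: "H \<in> borel_measurable (F s)"
      unfolding H_def using f_adapted[OF s(1)] by measurable
    have Hm[measurable]: "H \<in> borel_measurable M" unfolding H_def by measurable
    have Habs: "\<bar>H \<omega>\<bar> \<le> 1" for \<omega> by (auto simp: H_def indicator_def)
    have k_int: "AE \<omega> in M. set_integrable lborel {s..t} (\<lambda>u. \<bar>g u \<omega>\<bar>)"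
      using int by eventually_elim (rule set_integrable_abs, erule set_integrable_subset, use st in auto)
    have ad: "(\<lambda>\<omega>. \<bar>g u \<omega>\<bar>) \<in> borel_measurable (F u)" if "0 \<le> u" for u
      using g_adapted[OF that] by measurable
    define \<eta> where "\<eta> v \<omega> = exp (- (LBINT u:{s..v}. 0 + \<bar>g u \<omega>\<bar>))" for v \<omega>
    have \<eta>_eq: "\<eta> v \<omega> = exp (- \<kappa> v \<omega>)" for v \<omega> by (simp add: \<eta>_def \<kappa>_def)
    have triv: "(\<lambda>(v, \<omega>). 0 :: real) \<in> borel_measurable (borel \<Otimes>\<^sub>M M)" "\<And>v. (\<lambda>\<omega>. 0 :: real) \<in> borel_measurable (F v)"
      "\<And>v \<omega>. \<bar>0 :: real\<bar> \<le> 0" "\<And>v \<omega>. 0 \<le> \<bar>g v \<omega>\<bar>" "\<And>v \<omega>. \<bar>g v \<omega>\<bar> \<le> 1 * \<bar>g v \<omega>\<bar>" "0 \<le> (1 :: real)"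
      by auto
    note W = expectation_weighted[of s t "\<lambda>_ _. 0" "\<lambda>v \<omega>. \<bar>g v \<omega>\<bar>" 0 1 H,
        OF s(1) st(1) triv(1) gm triv(2) ad triv(3-6) k_int H Habs, folded \<eta>_def]
    have "(\<integral>\<omega>. of_bool (bad \<omega>) * (exp (- \<kappa> t \<omega>) * \<epsilon>) \<partial>M) \<le> (\<integral>\<omega>. H \<omega> * (\<eta> t \<omega> * f t \<omega>) \<partial>M)"
    proof (rule integral_mono')
      show "integrable M (\<lambda>\<omega>. H \<omega> * (\<eta> t \<omega> * f t \<omega>))"
      proof (rule integrable_const_bound[where B = C])
        have "\<bar>H \<omega>\<bar> * (\<bar>\<eta> t \<omega>\<bar> * \<bar>f t \<omega>\<bar>) \<le> 1 * (1 * C)" for \<omega>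
          using \<kappa>0[of t \<omega>] f_nonneg[of t \<omega>] f_le[of t \<omega>] Habs[of \<omega>] C_nonneg by (intro mult_mono) (auto simp: \<eta>_eq)
        then show "AE \<omega> in M. norm (H \<omega> * (\<eta> t \<omega> * f t \<omega>)) \<le> C" by (simp add: abs_mult)
        show "(\<lambda>\<omega>. H \<omega> * (\<eta> t \<omega> * f t \<omega>)) \<in> borel_measurable M" unfolding \<eta>_eq by measurable
      qed
      fix \<omega>
      have "\<epsilon> \<le> f t \<omega>" if "bad \<omega>" using that q(1)[of n] st by (auto simp: bad_def t_def)
      moreover have "H \<omega> = 1" if "bad \<omega>" using that by (auto simp: bad_def H_def)
      ultimately show "of_bool (bad \<omega>) * (exp (- \<kappa> t \<omega>) * \<epsilon>) \<le> H \<omega> * (\<eta> t \<omega> * f t \<omega>)"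
        using f_nonneg by (cases "bad \<omega>") (auto simp: \<eta>_eq H_def)
      show "0 \<le> H \<omega> * (\<eta> t \<omega> * f t \<omega>)" using f_nonneg by (auto simp: \<eta>_eq H_def)
    qed
    also have "\<dots> = (\<integral>\<omega>. H \<omega> * f s \<omega> \<partial>M) + (\<integral>\<omega>. H \<omega> * (LBINT v:{s..t}. \<eta> v \<omega> * (g v \<omega> - \<bar>g v \<omega>\<bar> * f v \<omega>)) \<partial>M)"
      using W(2) by simp
    also have "(\<integral>\<omega>. H \<omega> * f s \<omega> \<partial>M) = (\<integral>\<omega>. 0 \<partial>M)"
      by (intro Bochner_Integration.integral_cong) (auto simp: H_def indicator_def)
    also have "(\<integral>\<omega>. H \<omega> * (LBINT v:{s..t}. \<eta> v \<omega> * (g v \<omega> - \<bar>g v \<omega>\<bar> * f v \<omega>)) \<partial>M) \<le> (\<integral>\<omega>. 1 - exp (- \<kappa> t \<omega>) \<partial>M)"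
    proof (rule integral_mono_AE)
      show "integrable M (\<lambda>\<omega>. H \<omega> * (LBINT v:{s..t}. \<eta> v \<omega> * (g v \<omega> - \<bar>g v \<omega>\<bar> * f v \<omega>)))"
        using W(1) by simp
      show "integrable M (\<lambda>\<omega>. 1 - exp (- \<kappa> t \<omega>))"
        by (rule integrable_const_bound[where B = 1]) (use \<kappa>0 in auto)
      show "AE \<omega> in M. H \<omega> * (LBINT v:{s..t}. \<eta> v \<omega> * (g v \<omega> - \<bar>g v \<omega>\<bar> * f v \<omega>)) \<le> 1 - exp (- \<kappa> t \<omega>)"
        using int
      proof eventually_elim
        case (elim \<omega>)
        have gi: "set_integrable lborel {s..t} (\<lambda>u. g u \<omega>)"
          using elim by (rule set_integrable_subset) (use st in auto)
        interpret w: path_weight s t 0 1 "\<lambda>_. 0" "\<lambda>u. \<bar>g u \<omega>\<bar>" "\<lambda>u. g u \<omega>"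
          by unfold_locales (use gi st in \<open>auto intro: set_integrable_abs\<close>)
        have "(LBINT v:{s..t}. \<eta> v \<omega> * (g v \<omega> - \<bar>g v \<omega>\<bar> * f v \<omega>)) \<le> 1 - exp (- \<kappa> t \<omega>)"
        \<comment> \<open>If the integrand were not integrable, the integral would be 0 by
          convention and the bound trivial.\<close>
        proof (cases "set_integrable lborel {s..t} (\<lambda>v. \<eta> v \<omega> * (g v \<omega> - \<bar>g v \<omega>\<bar> * f v \<omega>))")
          case True
          have "(LBINT v:{s..t}. \<eta> v \<omega> * (g v \<omega> - \<bar>g v \<omega>\<bar> * f v \<omega>)) \<le> (LBINT v:{s..t}. exp (- w.\<kappa> v) * \<bar>g v \<omega>\<bar>)"
          proof (rule set_integral_mono[OF True])
            show "set_integrable lborel {s..t} (\<lambda>v. exp (- w.\<kappa> v) * \<bar>g v \<omega>\<bar>)"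
              using w.LBINT_exp_k(1)[of t] st by auto
            fix v
            have "0 \<le> \<bar>g v \<omega>\<bar> * f v \<omega>" using f_nonneg by simp
            then have "g v \<omega> - \<bar>g v \<omega>\<bar> * f v \<omega> \<le> \<bar>g v \<omega>\<bar>" by linarith
            then show "\<eta> v \<omega> * (g v \<omega> - \<bar>g v \<omega>\<bar> * f v \<omega>) \<le> exp (- w.\<kappa> v) * \<bar>g v \<omega>\<bar>"
              by (simp add: \<eta>_eq w.\<kappa>_def \<kappa>_def)
          qed
          also have "\<dots> = 1 - exp (- \<kappa> t \<omega>)"
            using w.LBINT_exp_k(2)[of t] st by (auto simp: w.\<kappa>_def \<kappa>_def)
          finally show ?thesis .
        next
          case False
          then have "(LBINT v:{s..t}. \<eta> v \<omega> * (g v \<omega> - \<bar>g v \<omega>\<bar> * f v \<omega>)) = 0"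
            by (simp add: set_lebesgue_integral_def set_integrable_def not_integrable_integral_eq)
          then show ?thesis using \<kappa>0 by simp
        qed
        then show ?case using \<kappa>0 by (auto simp: H_def indicator_def)
      qed
    qed
    finally show ?thesis by (simp add: t_def)
  qed
  have \<kappa>lim: "AE \<omega> in M. (\<lambda>n. \<kappa> (q n) \<omega>) \<longlonglongrightarrow> 0"
    using int
  proof eventually_elim
    case (elim \<omega>)
    have "continuous_on {s..s + \<delta>} (\<lambda>t. \<kappa> t \<omega>)"
      unfolding \<kappa>_def by (rule LBINT_continuous_on) (rule set_integrable_abs[OF elim])
    then have "(\<lambda>n. \<kappa> (q n) \<omega>) \<longlonglongrightarrow> \<kappa> s \<omega>"
      using s q\<delta> less_imp_le[OF q(2)] by (intro continuous_on_tendsto_compose[OF _ qlim]) (auto intro!: always_eventually)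
    then show ?case by (simp add: \<kappa>_def)
  qed
  have lim1: "(\<lambda>n. \<integral>\<omega>. of_bool (bad \<omega>) * (exp (- \<kappa> (q n) \<omega>) * \<epsilon>) \<partial>M) \<longlonglongrightarrow> (\<integral>\<omega>. of_bool (bad \<omega>) * (exp (- 0) * \<epsilon>) \<partial>M)"
  proof (rule integral_dominated_convergence[where w = "\<lambda>_. \<epsilon>"])
    show "AE \<omega> in M. (\<lambda>n. of_bool (bad \<omega>) * (exp (- \<kappa> (q n) \<omega>) * \<epsilon>)) \<longlonglongrightarrow> of_bool (bad \<omega>) * (exp (- 0) * \<epsilon>)"
      using \<kappa>lim by eventually_elim (intro tendsto_intros)
    show "AE \<omega> in M. norm (of_bool (bad \<omega>) * (exp (- \<kappa> (q n) \<omega>) * \<epsilon>)) \<le> \<epsilon>" for n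
      using s \<kappa>0 by (intro AE_I2) (auto simp: abs_mult mult_le_cancel_right1)
  qed auto
  have lim2: "(\<lambda>n. \<integral>\<omega>. 1 - exp (- \<kappa> (q n) \<omega>) \<partial>M) \<longlonglongrightarrow> (\<integral>\<omega>. 1 - exp (- 0) \<partial>M)"
  proof (rule integral_dominated_convergence[where w = "\<lambda>_. 1"])
    show "AE \<omega> in M. (\<lambda>n. 1 - exp (- \<kappa> (q n) \<omega>)) \<longlonglongrightarrow> 1 - exp (- 0)"
      using \<kappa>lim by eventually_elim (intro tendsto_intros)
    show "AE \<omega> in M. norm (1 - exp (- \<kappa> (q n) \<omega>)) \<le> 1" for n
      using \<kappa>0 by (intro AE_I2) auto
  qed auto
  have "(\<integral>\<omega>. of_bool (bad \<omega>) * (exp (- 0) * \<epsilon>) \<partial>M) \<le> (\<integral>\<omega>. 1 - exp (- 0) \<partial>M)"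
    by (rule LIMSEQ_le[OF lim1 lim2]) (use le in auto)
  then have "(\<integral>\<omega>. of_bool (bad \<omega>) * \<epsilon> \<partial>M) \<le> 0" by simp
  moreover have "integrable M (\<lambda>\<omega>. of_bool (bad \<omega>) * \<epsilon>)"
    by (rule integrable_const_bound[where B = \<epsilon>]) (use s in auto)
  ultimately have "AE \<omega> in M. of_bool (bad \<omega>) * \<epsilon> = 0"
    using s by (intro AE_eq_0_if_integral_le_0) auto
  then show ?thesis using \<open>0 < \<epsilon>\<close> by (elim eventually_mono) (auto simp: bad_def not_le)
qed

text \<open>
  The maximal inequality for nonnegative supermartingales, through the first grid time at which \<open>f\<close>
  is below \<open>\<epsilon>\<close>.
\<close>

lemma AE_zero_after_inf_zero:
  assumes a: "0 \<le> a" "u \<le> t" and T: "countable T" "T \<subseteq> {a..u}"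
  shows "AE \<omega> in M. (\<forall>n. \<exists>q\<in>T. f q \<omega> < 1 / real (Suc n)) \<longrightarrow> f t \<omega> = 0 \<or> \<not> free a t \<omega>"
proof (cases "T = {}")
  case True then show ?thesis by simp
next
  case False
  define e where "e = from_nat_into T"
  have e: "range e = T" unfolding e_def by (rule range_from_nat_into[OF False T(1)])
  define \<Phi> where "\<Phi> \<omega> = f t \<omega> * of_bool (free a t \<omega>)" for \<omega>
  have \<Phi>m[measurable]: "\<Phi> \<in> borel_measurable M" unfolding \<Phi>_def by measurable
  have \<Phi>0: "0 \<le> \<Phi> \<omega>" and \<Phi>C: "\<Phi> \<omega> \<le> C" for \<omega> using f_nonneg f_le C_nonneg by (auto simp: \<Phi>_def)
  have fin: "(\<integral>\<omega>. of_bool (\<exists>q\<in>J. f q \<omega> < \<epsilon>) * \<Phi> \<omega> \<partial>M) \<le> \<epsilon>" if J: "finite J" "J \<subseteq> T" and \<epsilon>: "0 < \<epsilon>" for J \<epsilon>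
  proof -
    \<comment> \<open>The events for different \<open>q\<close> are disjoint, each is known at time
      \<open>q\<close>, and on it \<open>f q\<close> is below \<open>\<epsilon>\<close>: this is
      what the summation over \<open>J\<close> rests on.\<close>
    define H where "H q \<omega> = (of_bool (f q \<omega> < \<epsilon> \<and> (\<forall>p\<in>{p\<in>J. p < q}. \<epsilon> \<le> f p \<omega>)) :: real)" for q \<omega>
    have Jau: "q \<in> {a..u}" if "q \<in> J" for q using that J T by auto
    have HF: "H q \<in> borel_measurable (F q)" if q: "q \<in> J" for q
    proof -
      have [measurable]: "f p \<in> borel_measurable (F q)" if "p \<in> J" "p \<le> q" for p
      proof -
        have "0 \<le> p" using Jau[OF that(1)] a by auto
        then have "subalgebra (F q) (F p)"
          using filtration[of p q] subalg[of p] subalg[of q] that by (auto simp: subalgebra_def)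
        from measurable_from_subalg[OF this f_adapted[OF \<open>0 \<le> p\<close>]] show ?thesis .
      qed
      have [measurable]: "Measurable.pred (F q) (\<lambda>\<omega>. \<forall>p\<in>{p\<in>J. p < q}. \<epsilon> \<le> f p \<omega>)"
        using J(1) by (intro pred_intros_finite) auto
      show ?thesis unfolding H_def using q by measurable
    qed
    have HM[measurable]: "H q \<in> borel_measurable M" if "q \<in> J" for q
      using measurable_from_subalg[OF subalg HF[OF that]] Jau[OF that] a by auto
    have sumH: "of_bool (\<exists>q\<in>J. f q \<omega> < \<epsilon>) = (\<Sum>q\<in>J. H q \<omega>)" for \<omega>
    proof (cases "\<exists>q\<in>J. f q \<omega> < \<epsilon>")
      case True
      define q where "q = Min {q\<in>J. f q \<omega> < \<epsilon>}"
      have q: "q \<in> J" "f q \<omega> < \<epsilon>" using Min_in[of "{q\<in>J. f q \<omega> < \<epsilon>}"] True J(1) by (auto simp: q_def)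
      have q': "q \<le> p" if "p \<in> J" "f p \<omega> < \<epsilon>" for p
        unfolding q_def using that J(1) by (intro Min_le) auto
      have "H p \<omega> = (if p = q then 1 else 0)" if "p \<in> J" for p
        using q q'[of p] q' that by (fastforce simp: H_def not_less)
      then show ?thesis using True q J(1) by (simp cong: sum.cong)
    next
      case False
      then show ?thesis by (simp add: H_def)
    qed
    have iH: "integrable M (\<lambda>\<omega>. H q \<omega> * \<Phi> \<omega>)" "integrable M (H q)" if "q \<in> J" for q
    proof -
      note [measurable] = HM[OF that]
      have H1: "\<bar>H q \<omega>\<bar> \<le> 1" for \<omega> by (simp add: H_def)
      show "integrable M (\<lambda>\<omega>. H q \<omega> * \<Phi> \<omega>)"
      proof (rule integrable_const_bound[where B = C])
        have "\<bar>H q \<omega>\<bar> * \<bar>\<Phi> \<omega>\<bar> \<le> 1 * C" for \<omega>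
          using H1 \<Phi>0 \<Phi>C by (intro mult_mono) auto
        then show "AE \<omega> in M. norm (H q \<omega> * \<Phi> \<omega>) \<le> C" by (simp add: abs_mult)
      qed measurable
      show "integrable M (H q)"
        by (rule integrable_const_bound[where B = 1]) (use H1 in auto)
    qed
    have each: "(\<integral>\<omega>. H q \<omega> * \<Phi> \<omega> \<partial>M) \<le> \<epsilon> * (\<integral>\<omega>. H q \<omega> \<partial>M)" if q: "q \<in> J" for q
    proof -
      note [measurable] = HM[OF q]
      have aq: "a \<le> q" "q \<le> t" using Jau[OF q] a by auto
      \<comment> \<open>Freeness from \<open>a\<close> is weakened to freeness from
        \<open>q\<close>, so that the supermartingale bound can be started at
        \<open>q\<close>.\<close>
      have "(\<integral>\<omega>. H q \<omega> * \<Phi> \<omega> \<partial>M) \<le> (\<integral>\<omega>. H q \<omega> * (f t \<omega> * of_bool (free q t \<omega>)) \<partial>M)"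
      proof (rule integral_mono')
        show "integrable M (\<lambda>\<omega>. H q \<omega> * (f t \<omega> * of_bool (free q t \<omega>)))"
        proof (rule integrable_const_bound[where B = C])
          show "AE \<omega> in M. norm (H q \<omega> * (f t \<omega> * of_bool (free q t \<omega>))) \<le> C"
            using f_nonneg f_le C_nonneg by (intro AE_I2) (auto simp: H_def)
        qed measurable
        show "H q \<omega> * \<Phi> \<omega> \<le> H q \<omega> * (f t \<omega> * of_bool (free q t \<omega>))" for \<omega>
          using free_mono[of a t \<omega> q t] aq f_nonneg[of t \<omega>] by (auto simp: \<Phi>_def H_def)
        show "0 \<le> H q \<omega> * (f t \<omega> * of_bool (free q t \<omega>))" for \<omega>
          using f_nonneg[of t \<omega>] by (auto simp: H_def)
      qed
      also have "\<dots> \<le> (\<integral>\<omega>. H q \<omega> * f q \<omega> \<partial>M)"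
        using aq a by (intro expectation_free_le HF[OF q]) (auto simp: H_def)
      also have "\<dots> \<le> (\<integral>\<omega>. \<epsilon> * H q \<omega> \<partial>M)"
      proof (rule integral_mono')
        show "integrable M (\<lambda>\<omega>. \<epsilon> * H q \<omega>)" using iH(2)[OF q] by simp
      qed (use \<epsilon> in \<open>auto simp: H_def\<close>)
      finally show ?thesis by simp
    qed
    have "(\<integral>\<omega>. of_bool (\<exists>q\<in>J. f q \<omega> < \<epsilon>) * \<Phi> \<omega> \<partial>M) = (\<Sum>q\<in>J. \<integral>\<omega>. H q \<omega> * \<Phi> \<omega> \<partial>M)"
      unfolding sumH sum_distrib_right by (rule Bochner_Integration.integral_sum) (rule iH)
    also have "\<dots> \<le> (\<Sum>q\<in>J. \<epsilon> * (\<integral>\<omega>. H q \<omega> \<partial>M))" by (rule sum_mono) (rule each)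
    also have "\<dots> = \<epsilon> * (\<integral>\<omega>. (\<Sum>q\<in>J. H q \<omega>) \<partial>M)"
      by (simp add: sum_distrib_left Bochner_Integration.integral_sum iH)
    also have "(\<integral>\<omega>. (\<Sum>q\<in>J. H q \<omega>) \<partial>M) \<le> (\<integral>\<omega>. 1 \<partial>M)"
      unfolding sumH[symmetric] by (rule integral_mono') auto
    finally show ?thesis using \<epsilon> by (simp add: prob_space)
  qed
  have all: "(\<integral>\<omega>. of_bool (\<exists>q\<in>T. f q \<omega> < \<epsilon>) * \<Phi> \<omega> \<partial>M) \<le> \<epsilon>" if \<epsilon>: "0 < \<epsilon>" for \<epsilon>
  proof -
    have "(\<lambda>n. \<integral>\<omega>. of_bool (\<exists>q\<in>e ` {..n}. f q \<omega> < \<epsilon>) * \<Phi> \<omega> \<partial>M) \<longlonglongrightarrow> (\<integral>\<omega>. of_bool (\<exists>q\<in>T. f q \<omega> < \<epsilon>) * \<Phi> \<omega> \<partial>M)"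
    proof (rule integral_dominated_convergence[where w = "\<lambda>_. C"])
      have "Measurable.pred M (\<lambda>\<omega>. \<exists>q\<in>T. f q \<omega> < \<epsilon>)"
        by (rule pred_Bex_countable[OF T(1)]) measurable
      then show "(\<lambda>\<omega>. of_bool (\<exists>q\<in>T. f q \<omega> < \<epsilon>) * \<Phi> \<omega>) \<in> borel_measurable M" by measurable
      have "Measurable.pred M (\<lambda>\<omega>. \<exists>q\<in>e ` {..n}. f q \<omega> < \<epsilon>)" for n
        by (intro pred_intros_finite) auto
      then show "(\<lambda>\<omega>. of_bool (\<exists>q\<in>e ` {..n}. f q \<omega> < \<epsilon>) * \<Phi> \<omega>) \<in> borel_measurable M" for n by measurable
      show "AE \<omega> in M. (\<lambda>n. of_bool (\<exists>q\<in>e ` {..n}. f q \<omega> < \<epsilon>) * \<Phi> \<omega>) \<longlonglongrightarrow> of_bool (\<exists>q\<in>T. f q \<omega> < \<epsilon>) * \<Phi> \<omega>"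
      proof (rule AE_I2, rule tendsto_eventually)
        fix \<omega>
        show "\<forall>\<^sub>F n in sequentially. of_bool (\<exists>q\<in>e ` {..n}. f q \<omega> < \<epsilon>) * \<Phi> \<omega> = of_bool (\<exists>q\<in>T. f q \<omega> < \<epsilon>) * \<Phi> \<omega>"
        proof (cases "\<exists>q\<in>T. f q \<omega> < \<epsilon>")
          case True
          then obtain i where "f (e i) \<omega> < \<epsilon>" using e by auto
          then have "\<exists>q\<in>e ` {..n}. f q \<omega> < \<epsilon>" if "i \<le> n" for n using that by auto
          then show ?thesis using True by (intro eventually_sequentiallyI[of i]) simp
        next
          case False
          then have "\<not> (\<exists>q\<in>e ` {..n}. f q \<omega> < \<epsilon>)" for n using e by auto
          with False show ?thesis by simp
        qed
      qed
      show "AE \<omega> in M. norm (of_bool (\<exists>q\<in>e ` {..n}. f q \<omega> < \<epsilon>) * \<Phi> \<omega>) \<le> C" for n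
        using \<Phi>0 \<Phi>C C_nonneg by (intro AE_I2) auto
    qed simp
    moreover have "(\<integral>\<omega>. of_bool (\<exists>q\<in>e ` {..n}. f q \<omega> < \<epsilon>) * \<Phi> \<omega> \<partial>M) \<le> \<epsilon>" for n
      by (rule fin) (use e \<epsilon> in auto)
    ultimately show ?thesis by (auto intro: LIMSEQ_le_const2)
  qed
  define small where "small \<omega> \<longleftrightarrow> (\<forall>n. \<exists>q\<in>T. f q \<omega> < 1 / real (Suc n))" for \<omega>
  have pm: "Measurable.pred M (\<lambda>\<omega>. \<exists>q\<in>T. f q \<omega> < \<epsilon>)" for \<epsilon>
    by (rule pred_Bex_countable[OF T(1)]) measurable
  then have sm[measurable]: "Measurable.pred M small"
    unfolding small_def by (intro pred_intros_countable) 
  have "(\<integral>\<omega>. of_bool (small \<omega>) * \<Phi> \<omega> \<partial>M) \<le> 1 / real (Suc n)" for n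
  proof -
    note [measurable] = pm[of "1 / real (Suc n)"]
    have "(\<integral>\<omega>. of_bool (small \<omega>) * \<Phi> \<omega> \<partial>M) \<le> (\<integral>\<omega>. of_bool (\<exists>q\<in>T. f q \<omega> < 1 / real (Suc n)) * \<Phi> \<omega> \<partial>M)"
    proof (rule integral_mono')
      show "integrable M (\<lambda>\<omega>. of_bool (\<exists>q\<in>T. f q \<omega> < 1 / real (Suc n)) * \<Phi> \<omega>)"
      proof (rule integrable_const_bound[where B = C])
        show "AE \<omega> in M. norm (of_bool (\<exists>q\<in>T. f q \<omega> < 1 / real (Suc n)) * \<Phi> \<omega>) \<le> C"
          using \<Phi>0 \<Phi>C C_nonneg by (intro AE_I2) auto
      qed measurable
    qed (use \<Phi>0 in \<open>auto simp: small_def simp del: of_nat_Suc\<close>)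
    also have "\<dots> \<le> 1 / real (Suc n)" by (rule all) simp
    finally show ?thesis .
  qed
  then have "(\<integral>\<omega>. of_bool (small \<omega>) * \<Phi> \<omega> \<partial>M) \<le> 0"
    using LIMSEQ_le_const[OF LIMSEQ_Suc[OF lim_1_over_n]] by (auto simp del: of_nat_Suc)
  moreover have "integrable M (\<lambda>\<omega>. of_bool (small \<omega>) * \<Phi> \<omega>)"
    by (rule integrable_const_bound[where B = C]) (use \<Phi>0 \<Phi>C C_nonneg in auto)
  ultimately have "AE \<omega> in M. of_bool (small \<omega>) * \<Phi> \<omega> = 0"
    using \<Phi>0 by (intro AE_eq_0_if_integral_le_0) auto
  then show ?thesis by eventually_elim (auto simp: small_def \<Phi>_def)
qed

text \<open>The infimum over the grid is asked to vanish, not to be attained, since the zeros of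
  \<open>f\<close> need not lie on the grid. The grid is \<open>a + \<rat>\<close>, so that shifting
  a path by \<open>a\<close> turns this into a condition on \<open>\<rat>\<close>; the strict
  inequality makes it depend on times before \<open>t\<close> only.\<close>

definition hit :: "real \<Rightarrow> real \<Rightarrow> 'a \<Rightarrow> bool" where
  "hit a t \<omega> \<longleftrightarrow> (\<exists>q\<in>\<rat>. 0 \<le> q \<and> a + q < t \<and> (\<forall>n. \<exists>p\<in>\<rat>. 0 \<le> p \<and> p \<le> q \<and> f (a + p) \<omega> < 1 / real (Suc n)))"

text \<open>The two preceding lemmas hold almost surely at each time. Fubini's theorem makes them
  hold, outside one null set of paths, at almost every time. Freeness does not see the exceptional
  times, which yields the equivalence for all \<open>t\<close> at once.\<close>

lemma AE_hit_iff_not_free: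
  assumes a: "0 \<le> a"
  shows "AE \<omega> in M. \<forall>t\<ge>a. hit a t \<omega> \<longleftrightarrow> \<not> free a t \<omega>"
proof -
  interpret L: pair_sigma_finite lborel M ..
  define T where "T = (+) a ` \<rat>"
  have T: "countable T" by (simp add: T_def countable_rat)
  have T_dense: "\<exists>q\<in>T. u < q \<and> q < v" if "u < v" for u v
    using Rats_dense_in_real[of "u - a" "v - a"] that by (force simp: T_def)
  define A where "A s \<omega> \<longleftrightarrow> (0 \<le> s \<longrightarrow> f s \<omega> = 0 \<longrightarrow>
    (\<forall>m n. \<exists>q\<in>T. s \<le> q \<and> q \<le> s + 1 / real (Suc m) \<and> f q \<omega> < 1 / real (Suc n)))" for s \<omega>
  have "AE \<omega> in M. A s \<omega>" for s
  proof (cases "0 \<le> s")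
    case True
    have "AE \<omega> in M. f s \<omega> = 0 \<longrightarrow> (\<exists>q\<in>T. s \<le> q \<and> q \<le> s + 1 / real (Suc m) \<and> f q \<omega> < 1 / real (Suc n))" for m n
      by (rule AE_small_after_zero) (use True T T_dense in auto)
    then have "AE \<omega> in M. \<forall>m n. f s \<omega> = 0 \<longrightarrow> (\<exists>q\<in>T. s \<le> q \<and> q \<le> s + 1 / real (Suc m) \<and> f q \<omega> < 1 / real (Suc n))"
      by (simp only: AE_all_countable) blast
    then show ?thesis by eventually_elim (auto simp: A_def)
  qed (simp add: A_def)
  then have "AE s in lborel. AE \<omega> in M. A s \<omega>" by simp
  moreover have "Measurable.pred (lborel \<Otimes>\<^sub>M M) (\<lambda>p. A (fst p) (snd p))"
  proof -
    have [measurable]: "(\<lambda>p. f (fst p) (snd p)) \<in> borel_measurable (lborel \<Otimes>\<^sub>M M)"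
      using f_meas by (simp add: split_def cong: measurable_cong_sets sets_pair_measure_cong)
    have [measurable]: "(\<lambda>p. f q (snd p)) \<in> borel_measurable (lborel \<Otimes>\<^sub>M M)" for q
      by (rule measurable_compose[OF measurable_snd f_fst])
    have [measurable]: "Measurable.pred (lborel \<Otimes>\<^sub>M M) (\<lambda>p. \<exists>q\<in>T. fst p \<le> q \<and> q \<le> fst p + 1 / real (Suc m) \<and> f q (snd p) < 1 / real (Suc n))" for m n
      by (rule pred_Bex_countable[OF T]) measurable
    show ?thesis unfolding A_def by measurable
  qed
  ultimately have E1: "AE \<omega> in M. AE s in lborel. A s \<omega>"
    using L.AE_commute[of A] by (simp add: pred_def)
  define small where "small q \<omega> \<longleftrightarrow> (\<forall>n. \<exists>p\<in>T \<inter> {a..a + q}. f p \<omega> < 1 / real (Suc n))" for q \<omega>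
  define B where "B q t \<omega> \<longleftrightarrow> (a + q \<le> t \<longrightarrow> small q \<omega> \<longrightarrow> f t \<omega> = 0 \<or> \<not> free a t \<omega>)" for q t \<omega>
  have "AE \<omega> in M. AE t in lborel. B q t \<omega>" for q
  proof -
    have "AE \<omega> in M. B q t \<omega>" for t
    proof (cases "a + q \<le> t")
      case True
      show ?thesis
        using AE_zero_after_inf_zero[OF a True countable_Int1[OF T], of "{a..a + q}"] by (simp add: B_def small_def)
    qed (simp add: B_def)
    then have "AE t in lborel. AE \<omega> in M. B q t \<omega>" by simp
    moreover have "Measurable.pred (lborel \<Otimes>\<^sub>M M) (\<lambda>p. B q (fst p) (snd p))"
    proof -
      have [measurable]: "(\<lambda>p. f (fst p) (snd p)) \<in> borel_measurable (lborel \<Otimes>\<^sub>M M)"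
        using f_meas by (simp add: split_def cong: measurable_cong_sets sets_pair_measure_cong)
      have [measurable]: "Measurable.pred (lborel \<Otimes>\<^sub>M M) (\<lambda>p. free a (fst p) (snd p))"
        using free_meas_pair[of a] by (simp cong: measurable_cong_sets sets_pair_measure_cong)
      have "Measurable.pred M (\<lambda>\<omega>. \<exists>p\<in>T \<inter> {a..a + q}. f p \<omega> < 1 / real (Suc n))" for n
        by (rule pred_Bex_countable[OF countable_Int1[OF T]]) measurable
      then have [measurable]: "Measurable.pred M (small q)" unfolding small_def by measurable
      show ?thesis unfolding B_def by measurable
    qed
    ultimately show ?thesis using L.AE_commute[of "B q"] by (simp add: pred_def)
  qed
  then have E2: "AE \<omega> in M. \<forall>q\<in>\<rat>. AE t in lborel. B q t \<omega>"
    by (subst AE_ball_countable) (auto simp: countable_rat)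
  show ?thesis
    using E1 E2
  proof eventually_elim
    case (elim \<omega>)
    show ?case
    proof (intro allI impI iffI)
      fix t assume "a \<le> t" and "hit a t \<omega>"
      then obtain q where q: "q \<in> \<rat>" "0 \<le> q" "a + q < t"
        "\<And>n. \<exists>p\<in>\<rat>. 0 \<le> p \<and> p \<le> q \<and> f (a + p) \<omega> < 1 / real (Suc n)" by (auto simp: hit_def)
      have sm: "small q \<omega>"
        unfolding small_def
      proof
        fix n obtain p where "p \<in> \<rat>" "0 \<le> p" "p \<le> q" "f (a + p) \<omega> < 1 / real (Suc n)" using q(4) by blast
        then show "\<exists>p\<in>T \<inter> {a..a + q}. f p \<omega> < 1 / real (Suc n)"
          by (intro bexI[of _ "a + p"]) (auto simp: T_def)
      qed
      show "\<not> free a t \<omega>"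
      proof
        assume fr: "free a t \<omega>"
        have "AE s in lborel. B q s \<omega>" using elim(2) q by blast
        moreover have "AE s in lborel. s \<in> {a..t} \<longrightarrow> f s \<omega> \<noteq> 0" using fr by (simp add: free_def)
        \<comment> \<open>From time \<open>a + q\<close> on, the path could almost always only be at
          0, and freeness allows that on a null set only. So almost no time lies in this interval,
          although its length is positive.\<close>
        ultimately have "AE s in lborel. s \<notin> {a + q..t}"
        proof eventually_elim
          case (elim s)
          show ?case
          proof
            assume s: "s \<in> {a + q..t}"
            then have "free a s \<omega>" using fr by (auto intro: free_mono)
            then show False using elim s sm q by (auto simp: B_def)
          qed
        qed
        then have "emeasure lborel {a + q..t} = 0"
          by (subst (asm) AE_iff_null_sets[symmetric]) (auto simp: null_sets_def)
        then show False using q(3) by simp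
      qed
    next
      fix t assume at: "a \<le> t" and nf: "\<not> free a t \<omega>"
      \<comment> \<open>Some of the time at zero is accumulated strictly before \<open>t\<close>,
        which leaves room for a rational offset \<open>q\<close> between \<open>t' - a\<close> and
        \<open>t - a\<close>.\<close>
      have "\<exists>n. \<not> free a (t - 1 / real (Suc n)) \<omega>"
      proof (rule ccontr)
        assume "\<not> ?thesis"
        then have "AE s in lborel. \<forall>n. s \<in> {a..t - 1 / real (Suc n)} \<longrightarrow> f s \<omega> \<noteq> 0"
          by (simp only: AE_all_countable not_ex not_not free_def) simp
        then have "AE s in lborel. s \<in> {a..t} \<longrightarrow> f s \<omega> \<noteq> 0"
          using AE_lborel_singleton[of t]
        proof eventually_elim
          case (elim s)
          show ?case
          proof
            assume s: "s \<in> {a..t}"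
            then have "0 < t - s" using elim by auto
            then obtain n where "1 / real (Suc n) < t - s" using nat_approx_posE by metis
            then show "f s \<omega> \<noteq> 0" using elim(1)[rule_format, of n] s by auto
          qed
        qed
        with nf show False by (simp add: free_def)
      qed
      then obtain t' where t': "t' < t" "\<not> free a t' \<omega>"
        by (metis diff_less_eq less_add_same_cancel1 of_nat_0_less_iff zero_less_Suc zero_less_divide_1_iff)
      \<comment> \<open>The zeros up to \<open>t'\<close> do not form a null set, whereas
        \<open>A\<close> fails on a null set only.\<close>
      have "\<exists>s\<in>{a..t'}. f s \<omega> = 0 \<and> A s \<omega>"
      proof (rule ccontr)
        assume "\<not> ?thesis"
        then have "AE s in lborel. s \<in> {a..t'} \<longrightarrow> f s \<omega> \<noteq> 0"
          using elim(1) by (elim eventually_mono) blast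
        with t' show False by (simp add: free_def)
      qed
      then obtain s where s: "a \<le> s" "s \<le> t'" "f s \<omega> = 0" "A s \<omega>" by auto
      obtain q where q: "q \<in> \<rat>" "t' - a < q" "q < t - a"
        using Rats_dense_in_real[of "t' - a" "t - a"] t' by auto
      obtain m where m: "1 / real (Suc m) < a + q - t'" using nat_approx_posE[of "a + q - t'"] q by auto
      show "hit a t \<omega>"
        unfolding hit_def
      proof (rule bexI[of _ q], intro conjI allI)
        show "0 \<le> q" "a + q < t" "q \<in> \<rat>" using q s by auto
        fix n
        obtain p where p: "p \<in> T" "s \<le> p" "p \<le> s + 1 / real (Suc m)" "f p \<omega> < 1 / real (Suc n)"
          using s a unfolding A_def by (meson order_trans)
        then obtain p' where "p' \<in> \<rat>" "p = a + p'" by (auto simp: T_def)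
        then show "\<exists>p\<in>\<rat>. 0 \<le> p \<and> p \<le> q \<and> f (a + p) \<omega> < 1 / real (Suc n)"
          using p s m by (intro bexI[of _ p']) auto
      qed
    qed
  qed
qed

end

section \<open>Markov processes and path laws\<close>

lemma space_natural_filtration [simp]: "space (natural_filtration N I X t) = space N"
  unfolding natural_filtration_def by (rule space_measure_of) auto

lemma sets_natural_filtration:
  "sets (natural_filtration N I X t) = sigma_sets (space N) {X s -` A \<inter> space N | s A. s \<in> I \<and> s \<le> t \<and> A \<in> sets borel}"
  unfolding natural_filtration_def by (rule sets_measure_of) auto

lemma sets_natural_filtration_subset:
  assumes "space G = space N" "\<And>s. s \<in> I \<Longrightarrow> s \<le> t \<Longrightarrow> X s \<in> G \<rightarrow>\<^sub>M borel"
  shows "sets (natural_filtration N I X t) \<subseteq> sets G"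
proof -
  have "{X s -` A \<inter> space N | s A. s \<in> I \<and> s \<le> t \<and> A \<in> sets borel} \<subseteq> sets G"
    using measurable_sets[OF assms(2)] assms(1) by auto
  from sets.sigma_sets_subset[OF this] show ?thesis
    unfolding sets_natural_filtration by (simp add: assms(1))
qed

lemma natural_filtration_adapted:
  assumes "s \<in> I" "s \<le> t"
  shows "X s \<in> natural_filtration N I X t \<rightarrow>\<^sub>M borel"
proof (rule measurableI)
  fix A :: "'b set" assume "A \<in> sets borel"
  then show "X s -` A \<inter> space (natural_filtration N I X t) \<in> sets (natural_filtration N I X t)"
    unfolding sets_natural_filtration space_natural_filtration using assms by (intro sigma_sets.Basic) blast
qed simp

lemma natural_filtration_mono: "s \<le> t \<Longrightarrow> sets (natural_filtration N I X s) \<subseteq> sets (natural_filtration N I X t)"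
  by (rule sets_natural_filtration_subset) (auto intro: natural_filtration_adapted)

lemma subalgebra_natural_filtration:
  "(\<And>s. s \<in> I \<Longrightarrow> X s \<in> N \<rightarrow>\<^sub>M borel) \<Longrightarrow> subalgebra N (natural_filtration N I X t)"
  unfolding subalgebra_def by (auto dest: sets_natural_filtration_subset[THEN subsetD, rotated 2])

abbreviation paths :: "real set \<Rightarrow> (real \<Rightarrow> 's::topological_space) measure" where
  "paths I \<equiv> (\<Pi>\<^sub>M t\<in>I. borel)"

lemma measurable_path:
  assumes "\<And>s. s \<in> I \<Longrightarrow> X s \<in> M \<rightarrow>\<^sub>M borel"
  shows "(\<lambda>\<omega>. \<lambda>t\<in>I. X t \<omega>) \<in> M \<rightarrow>\<^sub>M paths I"
  using assms by (rule measurable_restrict)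

lemma measure_path_law:
  assumes "\<And>s. s \<in> I \<Longrightarrow> X s \<in> M \<rightarrow>\<^sub>M borel" "A \<in> sets (paths I)"
  shows "measure (path_law I M X) A = measure M {\<omega> \<in> space M. (\<lambda>t\<in>I. X t \<omega>) \<in> A}"
  unfolding path_law_def using assms measurable_path[OF assms(1)]
  by (subst measure_distr) (auto simp: vimage_def Int_def intro!: arg_cong[where f = "measure M"])

context markov_process
begin

lemma space_P: "space (P x) = space N"
  by (rule sets_eq_imp_space_eq[OF sets_P])

lemma X_meas: assumes "t \<in> I" shows "X t \<in> N \<rightarrow>\<^sub>M borel"
proof -
  have "(\<lambda>\<omega>. (t, \<omega>)) \<in> N \<rightarrow>\<^sub>M restrict_space borel I \<Otimes>\<^sub>M N"
    using assms by (intro measurable_Pair) (auto simp: space_restrict_space)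
  from measurable_compose[OF this measurable_X] show ?thesis by simp
qed

lemma X_meas_P: "t \<in> I \<Longrightarrow> X t \<in> P x \<rightarrow>\<^sub>M borel"
  using X_meas[of t] by (simp cong: measurable_cong_sets add: sets_P)

lemma subalgebra_P: "t \<in> I \<Longrightarrow> subalgebra (P x) (F t)"
  using subalgebra_F[of t] by (simp add: subalgebra_def sets_P space_P)

lemma sigma_finite_sub_P: "t \<in> I \<Longrightarrow> sigma_finite_subalgebra (P x) (F t)"
proof -
  assume t: "t \<in> I"
  interpret prob_space "P x" by (rule prob_space_P)
  show ?thesis using subalgebra_P[OF t]
    by (simp add: finite_measure_subalgebra_is_sigma_finite finite_measure_subalgebra_def
        finite_measure_subalgebra_axioms_def finite_measure_axioms)
qed

lemma law_measurable:
  assumes "t \<in> I" "A \<in> sets (paths I)"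
  shows "(\<lambda>\<omega>. measure (path_law I (P (X t \<omega>)) X) A) \<in> borel_measurable (F t)"
  by (rule measurable_compose[OF adapted_X[OF assms(1)] measurable_law[OF assms(2)]])

lemma shifted_path_event:
  assumes "t \<in> I" "\<And>s. s \<in> I \<Longrightarrow> t + s \<in> I" "A \<in> sets (paths I)"
  shows "{\<omega> \<in> space N. (\<lambda>s\<in>I. X (t + s) \<omega>) \<in> A} \<in> sets N"
proof -
  have "(\<lambda>\<omega>. \<lambda>s\<in>I. X (t + s) \<omega>) \<in> N \<rightarrow>\<^sub>M paths I"
    by (rule measurable_path) (intro X_meas assms)
  from measurable_sets[OF this assms(3)] show ?thesis by (simp add: vimage_def Int_def conj_commute)
qed

text \<open>In this integrated form of the Markov property, events can be altered on null sets and
  \<open>B\<close> can be cut into pieces, which is how the coalesced pair is treated.\<close>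

lemma markov_integral:
  assumes t: "t \<in> I" "\<And>s. s \<in> I \<Longrightarrow> t + s \<in> I" and A: "A \<in> sets (paths I)" and B: "B \<in> sets (F t)"
  shows "measure (P x) (B \<inter> {\<omega> \<in> space N. (\<lambda>s\<in>I. X (t + s) \<omega>) \<in> A})
    = (\<integral>\<omega>. indicator B \<omega> * measure (path_law I (P (X t \<omega>)) X) A \<partial>P x)"
proof -
  interpret prob_space "P x" by (rule prob_space_P)
  interpret sub: sigma_finite_subalgebra "P x" "F t" by (rule sigma_finite_sub_P) fact
  define D where "D = {\<omega> \<in> space N. (\<lambda>s\<in>I. X (t + s) \<omega>) \<in> A}"
  have D[measurable]: "D \<in> sets (P x)" unfolding D_def sets_P by (rule shifted_path_event[OF t A])
  have B'[measurable]: "B \<in> sets (P x)" using B subalgebra_P[OF t(1), of x] by (auto simp: subalgebra_def)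
  have "measure (P x) (B \<inter> D) = (\<integral>\<omega>. indicator B \<omega> * indicator D \<omega> \<partial>P x)"
    by (simp add: indicator_inter_arith[symmetric])
  also have "\<dots> = (\<integral>\<omega>. indicator B \<omega> * real_cond_exp (P x) (F t) (indicator D) \<omega> \<partial>P x)"
  proof (rule sub.real_cond_exp_intg(2)[symmetric])
    show "integrable (P x) (\<lambda>\<omega>. indicator B \<omega> * indicator D \<omega> :: real)"
      by (rule integrable_const_bound[where B = 1]) (auto simp: indicator_def)
  qed (use B in auto)
  also have "\<dots> = (\<integral>\<omega>. indicator B \<omega> * measure (path_law I (P (X t \<omega>)) X) A \<partial>P x)"
  proof (rule integral_cong_AE)
    show "(\<lambda>\<omega>. indicator B \<omega> * real_cond_exp (P x) (F t) (indicator D) \<omega>) \<in> borel_measurable (P x)" by measurable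
    show "(\<lambda>\<omega>. indicator B \<omega> * measure (path_law I (P (X t \<omega>)) X) A) \<in> borel_measurable (P x)"
      using measurable_from_subalg[OF subalgebra_P[OF t(1)] law_measurable[OF t(1) A]] by measurable
    show "AE \<omega> in P x. indicator B \<omega> * real_cond_exp (P x) (F t) (indicator D) \<omega> = indicator B \<omega> * measure (path_law I (P (X t \<omega>)) X) A"
      using markov[OF t(1) A, of x, folded D_def] by eventually_elim simp
  qed
  finally show ?thesis by (simp add: D_def)
qed

end

text \<open>The way back from the integrated form, for a sub-sigma-algebra \<open>G\<close> that may
  be smaller than the one for which the identity was first proved.\<close>

lemma (in prob_space) markov_from_integral:
  assumes sub: "subalgebra M G" and D: "D \<in> sets M" and \<phi>: "\<phi> \<in> borel_measurable G"
    and \<phi>01: "\<And>\<omega>. 0 \<le> \<phi> \<omega> \<and> \<phi> \<omega> \<le> 1"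
    and eq: "\<And>B. B \<in> sets G \<Longrightarrow> measure M (B \<inter> D) = (\<integral>\<omega>. indicator B \<omega> * \<phi> \<omega> \<partial>M)"
  shows "AE \<omega> in M. real_cond_exp M G (indicator D) \<omega> = \<phi> \<omega>"
proof -
  interpret sub: sigma_finite_subalgebra M G
    using sub by (simp add: finite_measure_subalgebra_is_sigma_finite finite_measure_subalgebra_def
        finite_measure_subalgebra_axioms_def finite_measure_axioms)
  have \<phi>M[measurable]: "\<phi> \<in> borel_measurable M" by (rule measurable_from_subalg[OF sub \<phi>])
  show ?thesis
  proof (rule sub.real_cond_exp_charact)
    show "integrable M (indicator D :: _ \<Rightarrow> real)"
      by (rule integrable_const_bound[where B = 1]) (use D in auto)
    show "integrable M \<phi>" by (rule integrable_const_bound[where B = 1]) (use \<phi>01 in auto)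
    show "\<phi> \<in> borel_measurable G" by (rule \<phi>)
    fix B assume B: "B \<in> sets G"
    have "B \<in> sets M" using B sub by (auto simp: subalgebra_def)
    then show "(\<integral>\<omega>\<in>B. indicator D \<omega> \<partial>M) = (\<integral>\<omega>\<in>B. \<phi> \<omega> \<partial>M)"
      using eq[OF B] D by (simp add: set_lebesgue_integral_def indicator_inter_arith[symmetric])
  qed
qed

context contracting_process
begin

text \<open>
  If one switches at rate \<open>m\<close> while \<open>f = 0\<close>, then \<open>1 - exp (- m * Oc t)\<close> is the probability of having
  switched by time \<open>t\<close>, and the hypothesis on \<open>h\<close> applies at the moment of switching.
\<close>

lemma expectation_not_free_eq_0:
  assumes t: "0 \<le> t" and h[measurable]: "h \<in> borel_measurable M" and h1: "\<And>\<omega>. \<bar>h \<omega>\<bar> \<le> 1"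
    and ce: "\<And>s. s \<in> {0..t} \<Longrightarrow> AE \<omega> in M. f s \<omega> = 0 \<longrightarrow> real_cond_exp M (F s) h \<omega> = 0"
  shows "(\<integral>\<omega>. h \<omega> * of_bool (\<not> free 0 t \<omega>) \<partial>M) = 0"
proof -
  define zi where "zi s \<omega> = (indicator {0} (f s \<omega>) :: real)" for s \<omega>
  have om[measurable]: "(\<lambda>(s, \<omega>). zi s \<omega>) \<in> borel_measurable (borel \<Otimes>\<^sub>M M)" unfolding zi_def by measurable
  define Oc where "Oc s \<omega> = (LBINT u:{0..s}. zi u \<omega>)" for s \<omega>
  have Om[measurable]: "(\<lambda>(s, \<omega>). Oc s \<omega>) \<in> borel_measurable (borel \<Otimes>\<^sub>M M)"
    unfolding Oc_def by (rule borel_measurable_LBINT_Icc[OF om])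
  have O0: "0 \<le> Oc s \<omega>" for s \<omega>
    unfolding Oc_def set_lebesgue_integral_def by (intro Bochner_Integration.integral_nonneg) (auto simp: zi_def)
  have oi: "set_integrable lborel {0..s} (\<lambda>u. zi u \<omega>)" if "\<omega> \<in> space M" for s \<omega>
    by (rule set_integrable_bounded_Icc[where C = 1]) (use measurable_section_snd[OF om that] in \<open>auto simp: zi_def indicator_def\<close>)
  have zero: "(\<integral>\<omega>. h \<omega> * (1 - exp (- (real m * Oc t \<omega>))) \<partial>M) = 0" for m
  proof -
    define e where "e s \<omega> = exp (- (real m * Oc s \<omega>))" for s \<omega>
    have em[measurable]: "(\<lambda>(s, \<omega>). e s \<omega>) \<in> borel_measurable (borel \<Otimes>\<^sub>M M)" unfolding e_def by measurable
    have e01: "0 \<le> e s \<omega>" "e s \<omega> \<le> 1" for s \<omega> using O0 by (auto simp: e_def)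
    \<comment> \<open>\<open>e s * (real m * zi s)\<close> is the density at \<open>s\<close> of the
      switching time given the path, so the time integral of \<open>x\<close> is \<open>h\<close>
      times the conditional probability of having switched.\<close>
    define x where "x s \<omega> = h \<omega> * (e s \<omega> * (real m * zi s \<omega>))" for s \<omega>
    have xm: "(\<lambda>(s, \<omega>). x s \<omega>) \<in> borel_measurable (borel \<Otimes>\<^sub>M M)" unfolding x_def by measurable
    have x_le: "\<bar>x s \<omega>\<bar> \<le> real m" for s \<omega>
    proof -
      have "\<bar>h \<omega>\<bar> * (\<bar>e s \<omega>\<bar> * (real m * \<bar>zi s \<omega>\<bar>)) \<le> 1 * (1 * (real m * 1))"
        using e01[of s \<omega>] h1[of \<omega>] by (intro mult_mono) (auto simp: zi_def indicator_def)
      then show ?thesis by (simp add: x_def abs_mult)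
    qed
    have xi: "set_integrable lborel {0..t} (\<lambda>s. x s \<omega>)" if "\<omega> \<in> space M" for \<omega>
      by (rule set_integrable_bounded_Icc[where C = "real m"]) (use measurable_section_snd[OF xm that] x_le in auto)
    have joint: "integrable (lborel \<Otimes>\<^sub>M M) (\<lambda>(s, \<omega>). indicator {0..t} s * x s \<omega>)"
    proof (rule integrable_pairI[OF xm, where c = "\<lambda>_. real m * t"])
      show "sigma_finite_measure M" ..
      have "(LBINT s:{0..t}. \<bar>x s \<omega>\<bar>) \<le> real m * t" if "\<omega> \<in> space M" for \<omega>
      proof -
        have "(LBINT s:{0..t}. \<bar>x s \<omega>\<bar>) \<le> (LBINT s:{0..t}. real m)"
          using xi[OF that] x_le by (intro set_integral_mono set_integrable_abs) auto
        then show ?thesis using t by (simp add: LBINT_const_Icc)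
      qed
      then show "AE \<omega> in M. set_integrable lborel {0..t} (\<lambda>u. x u \<omega>) \<and> (LBINT u:{0..t}. \<bar>x u \<omega>\<bar>) \<le> real m * t"
        using xi by (intro AE_I2) auto
    qed simp
    have "(\<integral>\<omega>. h \<omega> * (1 - e t \<omega>) \<partial>M) = (\<integral>\<omega>. (LBINT s:{0..t}. x s \<omega>) \<partial>M)"
    proof (rule Bochner_Integration.integral_cong[OF refl])
      fix \<omega> assume \<omega>: "\<omega> \<in> space M"
      have "(LBINT s:{0..t}. exp (- (LBINT u:{0..s}. real m * zi u \<omega>)) * (real m * zi s \<omega>)) = 1 - exp (- (LBINT u:{0..t}. real m * zi u \<omega>))"
        by (rule LBINT_exp_chain_rule[OF t]) (use oi[OF \<omega>] in simp)
      then have "(LBINT s:{0..t}. e s \<omega> * (real m * zi s \<omega>)) = 1 - e t \<omega>" by (simp add: e_def Oc_def)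
      then show "h \<omega> * (1 - e t \<omega>) = (LBINT s:{0..t}. x s \<omega>)"
        unfolding x_def by (subst set_integral_mult_right) simp
    qed
    also have "\<dots> = (LBINT s:{0..t}. (\<integral>\<omega>. x s \<omega> \<partial>M))"
      by (rule Fubini_Icc(1)[OF sigma_finite_measure_axioms joint])
    also have "\<dots> = (LBINT s:{0..t}. 0)"
    proof (rule set_lebesgue_integral_cong)
      show "\<forall>s. s \<in> {0..t} \<longrightarrow> (\<integral>\<omega>. x s \<omega> \<partial>M) = 0"
      proof (intro allI impI)
        fix s assume s: "s \<in> {0..t}"
        interpret sub: sigma_finite_subalgebra M "F s" by (rule sigma_finite_sub) (use s in auto)
        have "\<exists>Z\<in>borel_measurable (F s). AE \<omega> in M. (LBINT u:{0..s}. zi u \<omega>) = Z \<omega>"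
        proof (rule AE_adapted_LBINT_bounded[where C = 1])
          show "subalgebra M (F s)" using subalg s by auto
          show "zi u \<in> borel_measurable (F s)" if u: "u \<in> {0..s}" for u
          proof -
            have "subalgebra (F s) (F u)"
              using filtration[of u s] subalg[of u] subalg[of s] u by (auto simp: subalgebra_def)
            from measurable_from_subalg[OF this f_adapted] u have [measurable]: "f u \<in> borel_measurable (F s)" by simp
            show ?thesis unfolding zi_def by measurable
          qed
        qed (use s om in \<open>auto simp: zi_def indicator_def\<close>)
        then obtain Z where Z[measurable]: "Z \<in> borel_measurable (F s)" and ZO: "AE \<omega> in M. Oc s \<omega> = Z \<omega>"
          unfolding Oc_def by blast
        \<comment> \<open>A version of the switching density that is \<open>F s\<close>-measurable;
          it vanishes unless the path is at zero at time \<open>s\<close>, and there the hypothesis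
          \<open>ce\<close> applies.\<close>
        define Y where "Y \<omega> = exp (- (real m * Z \<omega>)) * (real m * zi s \<omega>)" for \<omega>
        have [measurable]: "f s \<in> borel_measurable (F s)" using f_adapted s by simp
        have Y[measurable]: "Y \<in> borel_measurable (F s)" unfolding Y_def zi_def by measurable
        have YM[measurable]: "Y \<in> borel_measurable M" using measurable_from_subalg[OF subalg Y] s by simp
        have xM[measurable]: "x s \<in> borel_measurable M" by (rule measurable_section_fst[OF xm])
        have xY: "AE \<omega> in M. x s \<omega> = Y \<omega> * h \<omega>"
          using ZO by eventually_elim (simp add: x_def Y_def e_def)
        have ix: "integrable M (x s)" by (rule integrable_const_bound[where B = "real m"]) (use x_le in auto)
        then have iY: "integrable M (\<lambda>\<omega>. Y \<omega> * h \<omega>)"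
          by (subst integrable_cong_AE[OF _ _ xY, symmetric]) measurable
        have "(\<integral>\<omega>. x s \<omega> \<partial>M) = (\<integral>\<omega>. Y \<omega> * h \<omega> \<partial>M)"
          by (rule integral_cong_AE[OF _ _ xY]) measurable
        also have "\<dots> = (\<integral>\<omega>. Y \<omega> * real_cond_exp M (F s) h \<omega> \<partial>M)"
          by (rule sub.real_cond_exp_intg(2)[OF iY Y h, symmetric])
        also have "\<dots> = 0"
          by (rule integral_eq_zero_AE) (use ce[OF s] in \<open>eventually_elim, auto simp: Y_def zi_def indicator_def\<close>)
        finally show "(\<integral>\<omega>. x s \<omega> \<partial>M) = 0" .
      qed
    qed simp
    finally show ?thesis by (simp add: e_def set_lebesgue_integral_def)
  qed
  have OtM[measurable]: "Oc t \<in> borel_measurable M" by (rule measurable_section_fst[OF Om])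
  \<comment> \<open>As \<open>m\<close> grows, switching becomes immediate: the probability of
    having switched tends to the indicator of positive occupation time.\<close>
  have "(\<lambda>m. \<integral>\<omega>. h \<omega> * (1 - exp (- (real m * Oc t \<omega>))) \<partial>M) \<longlonglongrightarrow> (\<integral>\<omega>. h \<omega> * of_bool (\<not> free 0 t \<omega>) \<partial>M)"
  proof (rule integral_dominated_convergence[where w = "\<lambda>_. 1"])
    show "AE \<omega> in M. (\<lambda>m. h \<omega> * (1 - exp (- (real m * Oc t \<omega>)))) \<longlonglongrightarrow> h \<omega> * of_bool (\<not> free 0 t \<omega>)"
    proof (rule AE_I2)
      fix \<omega> assume \<omega>: "\<omega> \<in> space M"
      have fr: "free 0 t \<omega> \<longleftrightarrow> Oc t \<omega> = 0" using free_iff[OF \<omega>] by (simp add: Oc_def zi_def)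
      show "(\<lambda>m. h \<omega> * (1 - exp (- (real m * Oc t \<omega>)))) \<longlonglongrightarrow> h \<omega> * of_bool (\<not> free 0 t \<omega>)"
      proof (cases "Oc t \<omega> = 0")
        case True then show ?thesis using fr by simp
      next
        case False
        then have "0 < Oc t \<omega>" using O0[of t \<omega>] by simp
        then have "filterlim (\<lambda>m. Oc t \<omega> * real m) at_top sequentially"
          by (rule filterlim_tendsto_pos_mult_at_top[OF tendsto_const _ filterlim_real_sequentially])
        then have "(\<lambda>m. exp (- (real m * Oc t \<omega>))) \<longlonglongrightarrow> 0"
          by (intro filterlim_compose[OF exp_at_bot] filterlim_uminus_at_bot_at_top[THEN filterlim_compose]) (simp add: mult.commute)
        then have "(\<lambda>m. h \<omega> * (1 - exp (- (real m * Oc t \<omega>)))) \<longlonglongrightarrow> h \<omega> * (1 - 0)" by (intro tendsto_intros)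
        then show ?thesis using fr False by simp
      qed
    qed
    show "AE \<omega> in M. norm (h \<omega> * (1 - exp (- (real m * Oc t \<omega>)))) \<le> 1" for m
    proof (rule AE_I2)
      fix \<omega>
      have "\<bar>h \<omega>\<bar> * \<bar>1 - exp (- (real m * Oc t \<omega>))\<bar> \<le> 1 * 1"
        using h1 O0 by (intro mult_mono) auto
      then show "norm (h \<omega> * (1 - exp (- (real m * Oc t \<omega>)))) \<le> 1" by (simp add: abs_mult)
    qed
  qed measurable
  then show ?thesis using zero LIMSEQ_unique[OF tendsto_const] by fastforce
qed

end

section \<open>Coalescing the coupling\<close>

text \<open>
  Unlike the time spent on the diagonal, \<open>met\<close> involves only countably many times, so that the coalesced
  pair is a measurable function of the path. For a contractive coupling both notions of meeting
  agree almost surely (\<open>AE_met_iff\<close>).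
\<close>

definition met :: "(real \<Rightarrow> 'e::metric_space \<times> 'e) \<Rightarrow> real \<Rightarrow> bool" where
  "met p t \<longleftrightarrow> (\<exists>q\<in>\<rat>. 0 \<le> q \<and> q < t \<and> (\<forall>n. \<exists>r\<in>\<rat>. 0 \<le> r \<and> r \<le> q \<and> dist (fst (p r)) (snd (p r)) < 1 / real (Suc n)))"

definition merge :: "(real \<Rightarrow> 'e::metric_space \<times> 'e) \<Rightarrow> real \<Rightarrow> 'e \<times> 'e" where
  "merge p t = (fst (p t), if met p t then fst (p t) else snd (p t))"

text \<open>Used to freeze a path at time \<open>t\<close>, which gives adaptedness, and to restrict
  a path to nonnegative times.\<close>

lemma met_cong:
  assumes "\<And>r. 0 \<le> r \<Longrightarrow> r < t \<Longrightarrow> p r = p' r" shows "met p t \<longleftrightarrow> met p' t"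
proof -
  have "met a t \<Longrightarrow> met b t" if "\<And>r. 0 \<le> r \<Longrightarrow> r < t \<Longrightarrow> a r = b r" for a b :: "real \<Rightarrow> 'a \<times> 'a"
    unfolding met_def using that by (metis order_le_less_trans)
  from this[of p p'] this[of p' p] assms show ?thesis by auto
qed

lemma met_mono: "met p s \<Longrightarrow> s \<le> t \<Longrightarrow> met p t"
  unfolding met_def by (meson order_less_le_trans)

lemma not_met_0 [simp]: "\<not> met p 0" by (auto simp: met_def)

lemma met_start: assumes "fst (p 0) = snd (p 0)" "0 < t" shows "met p t"
  unfolding met_def using assms by (intro bexI[of _ 0] conjI allI) (auto intro!: bexI[of _ 0])

lemma measurable_fst_borel [measurable]: "fst \<in> (borel :: ('a::topological_space \<times> 'b::topological_space) measure) \<rightarrow>\<^sub>M borel"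
  by (intro borel_measurable_continuous_onI continuous_intros)

lemma measurable_snd_borel [measurable]: "snd \<in> (borel :: ('a::topological_space \<times> 'b::topological_space) measure) \<rightarrow>\<^sub>M borel"
  by (intro borel_measurable_continuous_onI continuous_intros)

lemma measurable_Pair_borel:
  fixes f :: "'c \<Rightarrow> 'a::second_countable_topology" and g :: "'c \<Rightarrow> 'b::second_countable_topology"
  assumes "f \<in> M \<rightarrow>\<^sub>M borel" "g \<in> M \<rightarrow>\<^sub>M borel"
  shows "(\<lambda>x. (f x, g x)) \<in> M \<rightarrow>\<^sub>M borel"
  using measurable_Pair[OF assms] by (simp add: borel_prod)

text \<open>Letting \<open>T\<close> vary with the point covers joint measurability in time and
  path. Only rational coordinates are evaluated, and \<open>T\<close> enters through the inequality
  \<open>q < T\<close> alone.\<close>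

lemma pred_met:
  fixes Y :: "'c \<Rightarrow> real \<Rightarrow> 'e::polish_space \<times> 'e"
  assumes T[measurable]: "T \<in> borel_measurable M" and Y: "\<And>r. r \<in> \<rat> \<Longrightarrow> 0 \<le> r \<Longrightarrow> (\<lambda>x. Y x r) \<in> M \<rightarrow>\<^sub>M borel"
  shows "Measurable.pred M (\<lambda>x. met (Y x) (T x))"
proof -
  have d: "(\<lambda>p. dist (fst p) (snd p)) \<in> borel_measurable (borel :: ('e \<times> 'e) measure)"
    by (intro borel_measurable_continuous_onI continuous_intros)
  have 1: "Measurable.pred M (\<lambda>x. 0 \<le> r \<and> r \<le> q \<and> dist (fst (Y x r)) (snd (Y x r)) < 1 / real (Suc n))" if "r \<in> \<rat>" for r q n
  proof (cases "0 \<le> r")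
    case True
    note [measurable] = measurable_compose[OF Y[OF that True] d]
    show ?thesis by measurable
  qed simp
  have [measurable]: "Measurable.pred M (\<lambda>x. \<exists>r\<in>\<rat>. 0 \<le> r \<and> r \<le> q \<and> dist (fst (Y x r)) (snd (Y x r)) < 1 / real (Suc n))" for q n
    by (rule pred_Bex_countable[OF countable_rat 1])
  show ?thesis unfolding met_def by (rule pred_Bex_countable[OF countable_rat]) measurable
qed

lemma measurable_merge:
  fixes Y :: "'c \<Rightarrow> real \<Rightarrow> 'e::polish_space \<times> 'e"
  assumes "T \<in> borel_measurable M" "\<And>r. 0 \<le> r \<Longrightarrow> (\<lambda>x. Y x r) \<in> M \<rightarrow>\<^sub>M borel" "(\<lambda>x. Y x (T x)) \<in> M \<rightarrow>\<^sub>M borel"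
  shows "(\<lambda>x. merge (Y x) (T x)) \<in> M \<rightarrow>\<^sub>M borel"
proof -
  note [measurable] = pred_met[OF assms(1) assms(2)] assms(3)
  show ?thesis unfolding merge_def by (intro measurable_Pair_borel) measurable
qed

lemma martingale_cong:
  assumes eq: "\<And>t \<omega>. 0 \<le> t \<Longrightarrow> \<omega> \<in> space M \<Longrightarrow> S t \<omega> = S' t \<omega>" and m: "martingale M F S"
  shows "martingale M F S'"
  unfolding martingale_def
proof (intro conjI allI impI)
  fix t :: real assume t: "0 \<le> t"
  show sub: "subalgebra M (F t)" using m t by (simp add: martingale_def)
  have sp: "space (F t) = space M" using sub by (simp add: subalgebra_def)
  show "S' t \<in> borel_measurable (F t)"
    using m t eq[OF t] by (subst measurable_cong[where g = "S t"]) (auto simp: martingale_def sp)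
  show "integrable M (S' t)"
    using m t eq[OF t] by (subst Bochner_Integration.integrable_cong[where g = "S t"]) (auto simp: martingale_def)
next
  fix s t :: real assume st: "0 \<le> s" "s \<le> t"
  then have t: "0 \<le> t" by simp
  have i: "integrable M (S t)" "integrable M (S s)" using m st by (auto simp: martingale_def)
  have c: "AE \<omega> in M. real_cond_exp M (F s) (S t) \<omega> = S s \<omega>" using m st by (simp add: martingale_def)
  have "AE \<omega> in M. real_cond_exp M (F s) (S' t) \<omega> = real_cond_exp M (F s) (S t) \<omega>"
  proof -
    have [measurable]: "S t \<in> borel_measurable M" using i by auto
    have [measurable]: "S' t \<in> borel_measurable M" using eq[OF t] by (subst measurable_cong[where g = "S t"]) auto
    \<comment> \<open>Functions that agree on the space give the same density measures, so the
      conditional expectations coincide as functions.\<close>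
    have "nn_cond_exp M (F s) (\<lambda>x. ennreal (S' t x)) = nn_cond_exp M (F s) (\<lambda>x. ennreal (S t x))"
      "nn_cond_exp M (F s) (\<lambda>x. ennreal (- S' t x)) = nn_cond_exp M (F s) (\<lambda>x. ennreal (- S t x))"
      unfolding nn_cond_exp_def using eq[OF t]
      by (auto intro!: arg_cong[where f = "\<lambda>D. RN_deriv (restr_to_subalg M (F s)) (restr_to_subalg D (F s))"] density_cong)
    then show ?thesis by (simp add: real_cond_exp_def)
  qed
  then show "AE \<omega> in M. real_cond_exp M (F s) (S' t) \<omega> = S' s \<omega>"
    using c AE_space by eventually_elim (simp add: eq[OF st(1)])
qed

section \<open>The distance of a coupled pair as a contracting process\<close>

text \<open>The data of part (ii) with \<open>lam = R - \<sigma>\<close>. \<open>Ld_le\<close> is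
  the bound by the supremum, multiplied by the distance; it is silent about the diagonal.\<close>

locale contractive_coupling =
  fixes N :: "'w measure" and F and P :: "'e::polish_space \<Rightarrow> 'w measure" and X
    and N' :: "'v measure" and Q U V and Ld :: "'e \<times> 'e \<Rightarrow> real" and rho :: "'e \<Rightarrow> real" and lam R dbar :: real
  assumes mp: "markov_process N {0..} F P X"
    and mc: "markovian_coupling {0..} P X N' Q U V"
    and eg: "extended_generator N' Q (\<lambda>t \<omega>. (U t \<omega>, V t \<omega>)) (\<lambda>(x, y). dist x y) Ld"
    and dist_le: "\<And>x y :: 'e. dist x y \<le> dbar"
    and rho_nonneg: "\<And>x. 0 \<le> rho x" and rho_le: "\<And>x. rho x \<le> R"
    and rho_meas[measurable]: "rho \<in> borel_measurable borel"
    and R_less: "R < lam"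
    and Ld_le: "\<And>x y. x \<noteq> y \<Longrightarrow> Ld (x, y) \<le> - (lam - rho x) * dist x y"
begin

abbreviation W :: "real \<Rightarrow> 'v \<Rightarrow> 'e \<times> 'e" where "W \<equiv> \<lambda>t \<omega>. (U t \<omega>, V t \<omega>)"

abbreviation "G \<equiv> natural_filtration N' {0..} W"

sublocale X: markov_process N "{0..}" F P X by (rule mp)

sublocale W: markov_process N' "{0..}" G Q W
  using mc by (simp add: markovian_coupling_def)

lemma law_U: "path_law {0..} (Q (x, y)) U = path_law {0..} (P x) X"
  and law_V: "path_law {0..} (Q (x, y)) V = path_law {0..} (P y) X"
  using mc by (simp_all add: markovian_coupling_def)

lemma Wm: "0 \<le> t \<Longrightarrow> W t \<in> N' \<rightarrow>\<^sub>M borel" using W.X_meas[of t] by simp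

lemma Um: "0 \<le> t \<Longrightarrow> U t \<in> N' \<rightarrow>\<^sub>M borel" using measurable_compose[OF Wm measurable_fst_borel] by simp
lemma Vm: "0 \<le> t \<Longrightarrow> V t \<in> N' \<rightarrow>\<^sub>M borel" using measurable_compose[OF Wm measurable_snd_borel] by simp

lemma Wa: "0 \<le> s \<Longrightarrow> s \<le> t \<Longrightarrow> W s \<in> G t \<rightarrow>\<^sub>M borel"
  using natural_filtration_adapted[of s "{0..}" t W N'] by simp
lemma Ua: "0 \<le> s \<Longrightarrow> s \<le> t \<Longrightarrow> U s \<in> G t \<rightarrow>\<^sub>M borel" using measurable_compose[OF Wa measurable_fst_borel] by simp
lemma Va: "0 \<le> s \<Longrightarrow> s \<le> t \<Longrightarrow> V s \<in> G t \<rightarrow>\<^sub>M borel" using measurable_compose[OF Wa measurable_snd_borel] by simp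

lemma Q_cong: "f \<in> Q z \<rightarrow>\<^sub>M B \<longleftrightarrow> f \<in> N' \<rightarrow>\<^sub>M B"
  by (simp cong: measurable_cong_sets add: W.sets_P)

lemma joint_W: "(\<lambda>(s, \<omega>). W (max 0 s) \<omega>) \<in> borel \<Otimes>\<^sub>M N' \<rightarrow>\<^sub>M borel"
proof -
  have "(\<lambda>p. (max 0 (fst p), snd p)) \<in> (borel :: real measure) \<Otimes>\<^sub>M N' \<rightarrow>\<^sub>M restrict_space borel {0..} \<Otimes>\<^sub>M N'"
    by (intro measurable_Pair measurable_restrict_space2) auto
  from measurable_compose[OF this W.measurable_X] show ?thesis by (simp add: split_def)
qed

lemma dist_meas[measurable]: "(\<lambda>p. dist (fst p) (snd p)) \<in> borel_measurable (borel :: ('e \<times> 'e) measure)"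
  by (intro borel_measurable_continuous_onI continuous_intros)

text \<open>
  Clipping at \<open>0\<close> makes these processes jointly measurable on the whole real line; only nonnegative
  times matter.
\<close>

definition "fd s \<omega> = dist (U (max 0 s) \<omega>) (V (max 0 s) \<omega>)"
definition "gd s \<omega> = Ld (U (max 0 s) \<omega>, V (max 0 s) \<omega>)"
definition "rd s \<omega> = rho (U (max 0 s) \<omega>)"

text \<open>The localising times belong to the law \<open>Q z\<close> and change with
  \<open>z\<close>, hence the existential form.\<close>

lemma contracting: "\<exists>\<tau>. contracting_process (Q z) G fd gd \<tau> dbar (dist (fst z) (snd z)) rd R lam"
proof -
  have Ldm[measurable]: "Ld \<in> borel_measurable borel" using eg by (simp add: extended_generator_def)
  have lm: "local_martingale (Q z) G (\<lambda>t \<omega>. dist (U t \<omega>) (V t \<omega>) - dist (fst z) (snd z) - (LBINT s:{0..t}. Ld (U s \<omega>, V s \<omega>)))"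
    using eg by (cases z) (simp add: extended_generator_def case_prod_beta)
  obtain \<tau> where \<tau>: "\<forall>n. stopping_time G (\<tau> n) \<and> (\<forall>\<omega>\<in>space (Q z). 0 \<le> \<tau> n \<omega>)"
    "AE \<omega> in Q z. incseq (\<lambda>n. \<tau> n \<omega>) \<and> filterlim (\<lambda>n. \<tau> n \<omega>) at_top sequentially"
    "\<forall>n. martingale (Q z) G (\<lambda>t \<omega>. dist (U (min t (\<tau> n \<omega>)) \<omega>) (V (min t (\<tau> n \<omega>)) \<omega>) - dist (fst z) (snd z)
      - (LBINT s:{0..min t (\<tau> n \<omega>)}. Ld (U s \<omega>, V s \<omega>)))"
    using lm unfolding local_martingale_def by blast
  have st: "stopping_time G (\<tau> n)" and \<tau>0: "\<omega> \<in> space N' \<Longrightarrow> 0 \<le> \<tau> n \<omega>"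
    and mart: "martingale (Q z) G (\<lambda>t \<omega>. dist (U (min t (\<tau> n \<omega>)) \<omega>) (V (min t (\<tau> n \<omega>)) \<omega>) - dist (fst z) (snd z)
      - (LBINT s:{0..min t (\<tau> n \<omega>)}. Ld (U s \<omega>, V s \<omega>)))" for n \<omega>
    using \<tau> by (auto simp: W.space_P)
  have \<tau>lim: "AE \<omega> in Q z. filterlim (\<lambda>n. \<tau> n \<omega>) at_top sequentially"
    using \<tau>(2) by eventually_elim simp
  have gint: "AE \<omega> in Q z. \<forall>t\<ge>0. set_integrable lborel {0..t} (\<lambda>s. Ld (U s \<omega>, V s \<omega>))"
    using eg unfolding extended_generator_def by blast
  have prod: "sets (borel \<Otimes>\<^sub>M Q z) = sets (borel \<Otimes>\<^sub>M N')" for z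
    by (intro sets_pair_measure_cong) (auto simp: W.sets_P)
  have jm: "(\<lambda>(s, \<omega>). \<phi> (W (max 0 s) \<omega>)) \<in> borel_measurable (borel \<Otimes>\<^sub>M Q z)"
    if "\<phi> \<in> borel_measurable borel" for \<phi> :: "'e \<times> 'e \<Rightarrow> real"
    using measurable_compose[OF joint_W that] by (simp add: split_def cong: measurable_cong_sets add: prod)
  have am: "(\<lambda>\<omega>. \<phi> (W (max 0 s) \<omega>)) \<in> borel_measurable (G s)"
    if "\<phi> \<in> borel_measurable borel" "0 \<le> s" for \<phi> :: "'e \<times> 'e \<Rightarrow> real" and s
    using measurable_compose[OF Wa[of s s] that(1)] that(2) by simp
  interpret prob_space "Q z" by (rule W.prob_space_P)
  have "contracting_process (Q z) G fd gd \<tau> dbar (dist (fst z) (snd z)) rd R lam"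
  proof (unfold_locales)
    show "subalgebra (Q z) (G t)" if "0 \<le> t" for t using W.subalgebra_P[of t] that by simp
    show "sets (G s) \<subseteq> sets (G t)" if "s \<le> t" for s t by (rule natural_filtration_mono[OF that])
    show "(\<lambda>(s, \<omega>). fd s \<omega>) \<in> borel_measurable (borel \<Otimes>\<^sub>M Q z)"
      using jm[OF dist_meas] by (simp add: fd_def)
    show "(\<lambda>(s, \<omega>). gd s \<omega>) \<in> borel_measurable (borel \<Otimes>\<^sub>M Q z)"
      using jm[OF Ldm] by (simp add: gd_def)
    have rm: "(\<lambda>p. rho (fst p)) \<in> borel_measurable (borel :: ('e \<times> 'e) measure)" by measurable
    show "(\<lambda>(s, \<omega>). rd s \<omega>) \<in> borel_measurable (borel \<Otimes>\<^sub>M Q z)"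
      using jm[OF rm] by (simp add: rd_def)
    fix s :: real assume s: "0 \<le> s"
    show "fd s \<in> borel_measurable (G s)" using am[OF dist_meas s] by (simp add: fd_def[abs_def])
    show "gd s \<in> borel_measurable (G s)" using am[OF Ldm s] by (simp add: gd_def[abs_def])
    show "rd s \<in> borel_measurable (G s)" using am[OF rm s] by (simp add: rd_def[abs_def])
  next
    show "0 \<le> fd s \<omega>" "fd s \<omega> \<le> dbar" "0 \<le> rd s \<omega>" "rd s \<omega> \<le> R" "R < lam" for s \<omega>
      by (auto simp: fd_def rd_def dist_le rho_nonneg rho_le R_less)
    show "fd s \<omega> \<noteq> 0 \<Longrightarrow> gd s \<omega> \<le> - (lam - rd s \<omega>) * fd s \<omega>" for s \<omega>
      using Ld_le by (simp add: fd_def gd_def rd_def)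
    show "AE \<omega> in Q z. \<forall>t\<ge>0. set_integrable lborel {0..t} (\<lambda>s. gd s \<omega>)"
      using gint
    proof eventually_elim
      case (elim \<omega>)
      have "set_integrable lborel {0..t} (\<lambda>s. gd s \<omega>) = set_integrable lborel {0..t} (\<lambda>s. Ld (U s \<omega>, V s \<omega>))" for t
        by (intro set_integrable_cong) (auto simp: gd_def max_def)
      then show ?case using elim by simp
    qed
    show "\<tau> n \<in> borel_measurable (Q z)" for n
    proof (rule borel_measurable_iff_le[THEN iffD2], rule allI)
      fix t
      show "{\<omega> \<in> space (Q z). \<tau> n \<omega> \<le> t} \<in> sets (Q z)"
      proof (cases "0 \<le> t")
        case True
        have "{\<omega> \<in> space N'. \<tau> n \<omega> \<le> t} \<in> sets (G t)"
          using stopping_timeD[OF st[of n], of t] by (simp add: pred_def)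
        then show ?thesis using W.subalgebra_F[of t] True by (auto simp: subalgebra_def W.sets_P W.space_P)
      next
        \<comment> \<open>Before time 0 the event is empty because \<open>\<tau> n\<close> is
          nonnegative, so the filtration is not consulted there.\<close>
        case False
        then have "{\<omega> \<in> space (Q z). \<tau> n \<omega> \<le> t} = {}"
          using \<tau>0[of _ n] by (force simp: W.space_P)
        then show ?thesis by (simp only: sets.empty_sets)
      qed
    qed
    show "0 \<le> \<tau> n \<omega>" if "\<omega> \<in> space (Q z)" for n \<omega> using \<tau>0 that by (simp add: W.space_P)
    show "AE \<omega> in Q z. filterlim (\<lambda>n. \<tau> n \<omega>) at_top sequentially" by (rule \<tau>lim)
    show "martingale (Q z) G (\<lambda>t \<omega>. fd (min t (\<tau> n \<omega>)) \<omega> - dist (fst z) (snd z) - (LBINT s:{0..min t (\<tau> n \<omega>)}. gd s \<omega>))" for n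
    proof (rule martingale_cong[OF _ mart[of n]])
      fix t :: real and \<omega> assume "0 \<le> t" "\<omega> \<in> space (Q z)"
      then have "0 \<le> min t (\<tau> n \<omega>)" using \<tau>0[of \<omega> n] by (simp add: W.space_P)
      moreover have "(LBINT s:{0..u}. gd s \<omega>) = (LBINT s:{0..u}. Ld (U s \<omega>, V s \<omega>))" for u
        by (intro set_lebesgue_integral_cong) (auto simp: gd_def max_def)
      ultimately show "dist (U (min t (\<tau> n \<omega>)) \<omega>) (V (min t (\<tau> n \<omega>)) \<omega>) - dist (fst z) (snd z) - (LBINT s:{0..min t (\<tau> n \<omega>)}. Ld (U s \<omega>, V s \<omega>))
        = fd (min t (\<tau> n \<omega>)) \<omega> - dist (fst z) (snd z) - (LBINT s:{0..min t (\<tau> n \<omega>)}. gd s \<omega>)"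
        by (simp add: fd_def max_def)
    qed
  qed
  then show ?thesis by blast
qed

text \<open>\<open>free\<close> depends on the process \<open>fd\<close> alone, neither on the
  starting point nor on the localising times; a separate name makes this usable across all the laws
  \<open>Q z\<close>.\<close>

definition "apart a t \<omega> = contracting_process.free fd a t \<omega>"

text \<open>Needed from an arbitrary time \<open>a\<close> on, for the shift property of
  \<open>met\<close>; one null set serves all \<open>t\<close>.\<close>

lemma AE_met_iff:
  assumes a: "0 \<le> a"
  shows "AE \<omega> in Q z. \<forall>t\<ge>0. met (\<lambda>s. W (a + s) \<omega>) t \<longleftrightarrow> \<not> apart a (a + t) \<omega>"
proof -
  obtain \<tau> where "contracting_process (Q z) G fd gd \<tau> dbar (dist (fst z) (snd z)) rd R lam" using contracting by blast
  then interpret c: contracting_process "Q z" G fd gd \<tau> dbar "dist (fst z) (snd z)" rd R lam .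
  have h: "c.hit a (a + t) \<omega> \<longleftrightarrow> met (\<lambda>s. W (a + s) \<omega>) t" for t \<omega>
  proof -
    have "fd (a + p) \<omega> = dist (U (a + p) \<omega>) (V (a + p) \<omega>)" if "0 \<le> p" for p
      using a that by (simp add: fd_def)
    then show ?thesis unfolding c.hit_def met_def by (simp cong: conj_cong)
  qed
  show ?thesis
    using c.AE_hit_iff_not_free[OF a]
  proof eventually_elim
    case (elim \<omega>)
    show ?case using elim[rule_format, of "a + _"] a by (auto simp: h apart_def)
  qed
qed

lemma apart_split: "a \<le> c \<Longrightarrow> c \<le> t \<Longrightarrow> apart a t \<omega> \<longleftrightarrow> apart a c \<omega> \<and> apart c t \<omega>"
proof -
  assume "a \<le> c" "c \<le> t"
  \<comment> \<open>Any starting point will do: it only serves to obtain an instance of the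
    locale.\<close>
  fix z :: "'e \<times> 'e"
  obtain \<tau> where "contracting_process (Q z) G fd gd \<tau> dbar (dist (fst z) (snd z)) rd R lam" using contracting by blast
  from contracting_process.free_split[OF this \<open>a \<le> c\<close> \<open>c \<le> t\<close>] show ?thesis by (simp add: apart_def)
qed

text \<open>This can fail along single paths, since the two sides look at the different grids
  \<open>\<rat>\<close> and \<open>a + \<rat>\<close>. Almost surely both detect occupation time,
  which splits at \<open>a\<close>. It lets the coalescence be restarted at time
  \<open>a\<close>.\<close>

lemma AE_met_shift:
  assumes a: "0 \<le> a"
  shows "AE \<omega> in Q z. \<forall>t\<ge>0. met (\<lambda>s. W s \<omega>) (a + t) \<longleftrightarrow> met (\<lambda>s. W s \<omega>) a \<or> met (\<lambda>s. W (a + s) \<omega>) t"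
  using AE_met_iff[OF a, of z] AE_met_iff[of 0 z, simplified]
proof eventually_elim
  case (elim \<omega>)
  show ?case using elim a apart_split[of 0 a "a + _" \<omega>] by auto
qed

lemma expectation_apart_le:
  assumes t: "0 \<le> t"
  shows "(\<integral>\<omega>. exp (lam * t - (LBINT s:{0..t}. rho (U s \<omega>))) * dist (U t \<omega>) (V t \<omega>) * of_bool (apart 0 t \<omega>) \<partial>Q (x, y)) \<le> dist x y"
proof -
  obtain \<tau> where "contracting_process (Q (x, y)) G fd gd \<tau> dbar (dist (fst (x, y)) (snd (x, y))) rd R lam" using contracting by blast
  then interpret c: contracting_process "Q (x, y)" G fd gd \<tau> dbar "dist (fst (x, y)) (snd (x, y))" rd R lam .
  have "(LBINT s:{0..t}. rd s \<omega>) = (LBINT s:{0..t}. rho (U s \<omega>))" for \<omega>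
    by (intro set_lebesgue_integral_cong) (auto simp: rd_def max_def)
  moreover have "(\<integral>\<omega>. fd 0 \<omega> \<partial>Q (x, y)) = dist x y"
  proof -
    have "(\<integral>\<omega>. fd 0 \<omega> \<partial>Q (x, y)) = (\<integral>\<omega>. dist x y \<partial>Q (x, y))"
    proof (rule integral_cong_AE)
      show "AE \<omega> in Q (x, y). fd 0 \<omega> = dist x y"
        using W.start[of "(x, y)"] by eventually_elim (simp add: fd_def)
    qed (use c.f_fst in auto)
    then show ?thesis by (simp add: c.prob_space)
  qed
  ultimately show ?thesis
    using c.expectation_weighted_free_le[of 0 t "\<lambda>_. 1"] t by (simp add: apart_def fd_def)
qed

lemma expectation_not_apart:
  assumes "0 \<le> t" "h \<in> borel_measurable (Q z)" "\<And>\<omega>. \<bar>h \<omega>\<bar> \<le> 1"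
    and "\<And>s. s \<in> {0..t} \<Longrightarrow> AE \<omega> in Q z. U s \<omega> = V s \<omega> \<longrightarrow> real_cond_exp (Q z) (G s) h \<omega> = 0"
  shows "(\<integral>\<omega>. h \<omega> * of_bool (\<not> apart 0 t \<omega>) \<partial>Q z) = 0"
proof -
  obtain \<tau> where "contracting_process (Q z) G fd gd \<tau> dbar (dist (fst z) (snd z)) rd R lam" using contracting by blast
  then interpret c: contracting_process "Q z" G fd gd \<tau> dbar "dist (fst z) (snd z)" rd R lam .
  show ?thesis
    unfolding apart_def
  proof (rule c.expectation_not_free_eq_0[OF assms(1-3)])
    fix s assume "s \<in> {0..t}"
    then show "AE \<omega> in Q z. fd s \<omega> = 0 \<longrightarrow> real_cond_exp (Q z) (G s) h \<omega> = 0"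
      using assms(4)[of s] by (auto simp: fd_def max_def elim!: eventually_mono)
  qed
qed

end

section \<open>The coalesced pair and its Markov property\<close>

context contractive_coupling
begin

abbreviation "I \<equiv> {0..} :: real set"

definition "V' t \<omega> = (if met (\<lambda>s. W s \<omega>) t then U t \<omega> else V t \<omega>)"

abbreviation W' :: "real \<Rightarrow> 'v \<Rightarrow> 'e \<times> 'e" where "W' \<equiv> \<lambda>t \<omega>. (U t \<omega>, V' t \<omega>)"

lemma W'_merge: "W' t \<omega> = merge (\<lambda>s. W s \<omega>) t"
  by (simp add: V'_def merge_def)

text \<open>The path frozen at \<open>t\<close> gives the same value of \<open>met\<close> and
  involves only coordinates that are \<open>G t\<close>-measurable.\<close>

lemma met_adapted: "Measurable.pred (G t) (\<lambda>\<omega>. met (\<lambda>s. W s \<omega>) t)"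
proof (cases "0 \<le> t")
  case True
  have "met (\<lambda>s. W s \<omega>) t \<longleftrightarrow> met (\<lambda>s. W (min s t) \<omega>) t" for \<omega>
    by (rule met_cong) simp
  moreover have "Measurable.pred (G t) (\<lambda>\<omega>. met (\<lambda>s. W (min s t) \<omega>) t)"
    using True by (intro pred_met Wa) auto
  ultimately show ?thesis by simp
next
  case False
  then have "\<not> met (\<lambda>s. W s \<omega>) t" for \<omega> by (auto simp: met_def)
  then show ?thesis by simp
qed

lemma W'a: assumes "0 \<le> s" "s \<le> t" shows "W' s \<in> G t \<rightarrow>\<^sub>M borel"
proof -
  have "subalgebra (G t) (G s)" unfolding subalgebra_def using natural_filtration_mono[OF assms(2)] by simp
  then have [measurable]: "Measurable.pred (G t) (\<lambda>\<omega>. met (\<lambda>s. W s \<omega>) s)"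
    using met_adapted[of s] by (rule measurable_from_subalg)
  note [measurable] = Ua[OF assms] Va[OF assms]
  show ?thesis unfolding V'_def by (intro measurable_Pair_borel) measurable
qed

lemma sub_G: "0 \<le> t \<Longrightarrow> subalgebra N' (G t)" using W.subalgebra_F[of t] by simp

lemma W'm: "0 \<le> t \<Longrightarrow> W' t \<in> N' \<rightarrow>\<^sub>M borel"
  using measurable_from_subalg[OF sub_G W'a[of t t]] by simp

lemma V'm: "0 \<le> t \<Longrightarrow> V' t \<in> N' \<rightarrow>\<^sub>M borel"
  using measurable_compose[OF W'm measurable_snd_borel] by simp

definition "\<Psi> p = (\<lambda>t\<in>I. merge p t)"

lemma coord[measurable]: "0 \<le> t \<Longrightarrow> (\<lambda>p. p t) \<in> paths I \<rightarrow>\<^sub>M borel"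
  by (rule measurable_component_singleton) simp

lemma \<Psi>_meas: "\<Psi> \<in> paths I \<rightarrow>\<^sub>M (paths I :: (real \<Rightarrow> 'e \<times> 'e) measure)"
  unfolding \<Psi>_def by (intro measurable_restrict measurable_merge) auto

lemma path_W': "(\<lambda>t\<in>I. W' t \<omega>) = \<Psi> (\<lambda>t\<in>I. W t \<omega>)"
proof -
  have "merge (\<lambda>s. W s \<omega>) t = merge (\<lambda>t\<in>I. W t \<omega>) t" if "0 \<le> t" for t
    using that met_cong[of t "\<lambda>s. W s \<omega>" "\<lambda>t\<in>I. W t \<omega>"] by (simp add: merge_def)
  then show ?thesis unfolding W'_merge \<Psi>_def by (auto simp: restrict_def)
qed

definition "law z A = measure (path_law I (Q z) W') A"

lemma \<Psi>_sets: "A \<in> sets (paths I) \<Longrightarrow> \<Psi> -` A \<inter> space (paths I) \<in> sets (paths I :: (real \<Rightarrow> 'e \<times> 'e) measure)"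
  by (rule measurable_sets[OF \<Psi>_meas])

lemma Q_meas: "f \<in> N' \<rightarrow>\<^sub>M B \<Longrightarrow> f \<in> Q z \<rightarrow>\<^sub>M B"
  using Q_cong by blast

lemma restrict_in_paths [simp]: "(\<lambda>t\<in>I. p t) \<in> space (paths I)"
  by (simp add: space_PiM)

lemma law_event: "A \<in> sets (paths I) \<Longrightarrow> law z A = measure (Q z) {\<omega> \<in> space N'. (\<lambda>t\<in>I. W' t \<omega>) \<in> A}"
  unfolding law_def by (subst measure_path_law) (auto intro: Q_meas W'm simp: W.space_P)

lemma lawW_event: "A \<in> sets (paths I) \<Longrightarrow> measure (path_law I (Q z) W) A = measure (Q z) {\<omega> \<in> space N'. (\<lambda>t\<in>I. W t \<omega>) \<in> A}"
  by (subst measure_path_law) (auto intro: Q_meas Wm simp: W.space_P)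

text \<open>The coalesced law is the image of the original one under the fixed path map
  \<open>\<Psi>\<close>; measurability in the starting point is inherited this way.\<close>

lemma law_eq: "A \<in> sets (paths I) \<Longrightarrow> law z A = measure (path_law I (Q z) W) (\<Psi> -` A \<inter> space (paths I))"
  unfolding law_event lawW_event[OF \<Psi>_sets] path_W'
  using restrict_in_paths by (intro arg_cong[where f = "measure (Q z)"]) blast

lemma law_meas: "A \<in> sets (paths I) \<Longrightarrow> (\<lambda>z. law z A) \<in> borel_measurable borel"
  unfolding law_eq by (intro W.measurable_law \<Psi>_sets)

lemma law_01: "0 \<le> law z A \<and> law z A \<le> 1"
proof -
  interpret prob_space "Q z" by (rule W.prob_space_P)
  have "prob_space (path_law I (Q z) W')"
    unfolding path_law_def by (rule prob_space_distr) (intro measurable_path Q_meas W'm, simp)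
  then show ?thesis by (simp add: law_def prob_space.prob_le_1)
qed

definition "diag A = {p \<in> space (paths I). (\<lambda>s\<in>I. (p s, p s)) \<in> A}"

lemma diag_sets: "A \<in> sets (paths I) \<Longrightarrow> diag A \<in> sets (paths I :: (real \<Rightarrow> 'e) measure)"
proof -
  assume A: "A \<in> sets (paths I)"
  have "(\<lambda>p. \<lambda>s\<in>I. (p s, p s)) \<in> paths I \<rightarrow>\<^sub>M (paths I :: (real \<Rightarrow> 'e \<times> 'e) measure)"
    by (intro measurable_restrict measurable_Pair_borel coord) auto
  from measurable_sets[OF this A] show ?thesis by (simp add: diag_def vimage_def Int_def conj_commute)
qed

lemma law_U_event:
  assumes "A \<in> sets (paths I)"
  shows "measure (Q (x, y)) {\<omega> \<in> space N'. (\<lambda>t\<in>I. U t \<omega>) \<in> A} = measure (path_law I (P x) X) A"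
  using measure_path_law[of I U "Q (x, y)" A] assms by (simp add: law_U Q_meas Um W.space_P)

lemma law_V_event:
  assumes "A \<in> sets (paths I)"
  shows "measure (Q (x, y)) {\<omega> \<in> space N'. (\<lambda>t\<in>I. V t \<omega>) \<in> A} = measure (path_law I (P y) X) A"
  using measure_path_law[of I V "Q (x, y)" A] assms by (simp add: law_V Q_meas Vm W.space_P)

lemma UU_event:
  assumes A: "A \<in> sets (paths I)"
  shows "measure (Q (x, y)) {\<omega> \<in> space N'. (\<lambda>s\<in>I. (U s \<omega>, U s \<omega>)) \<in> A} = measure (path_law I (P x) X) (diag A)"
proof -
  have "{\<omega> \<in> space N'. (\<lambda>s\<in>I. (U s \<omega>, U s \<omega>)) \<in> A} = {\<omega> \<in> space N'. (\<lambda>s\<in>I. U s \<omega>) \<in> diag A}"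
    unfolding diag_def using restrict_in_paths by (auto cong: restrict_cong)
  then show ?thesis using law_U_event[OF diag_sets[OF A]] by simp
qed

lemma path_event_sets:
  fixes Y :: "real \<Rightarrow> 'v \<Rightarrow> 'b::topological_space"
  assumes "A \<in> sets (paths I)" "\<And>s. 0 \<le> s \<Longrightarrow> Y s \<in> N' \<rightarrow>\<^sub>M borel"
  shows "{\<omega> \<in> space N'. (\<lambda>s\<in>I. Y s \<omega>) \<in> A} \<in> sets N'"
proof -
  have "(\<lambda>\<omega>. \<lambda>s\<in>I. Y s \<omega>) \<in> N' \<rightarrow>\<^sub>M paths I" by (rule measurable_path) (use assms in auto)
  from measurable_sets[OF this assms(1)] show ?thesis by (simp add: vimage_def Int_def conj_commute)
qed

text \<open>Started on the diagonal, the pair has met at every positive time by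
  \<open>met_start\<close>, so it is the doubled first component and its law depends on
  \<open>P x\<close> alone. This identifies the continuation after coalescence, when the uncoalesced
  \<open>V\<close> may be anywhere.\<close>

lemma law_diag:
  assumes A: "A \<in> sets (paths I)"
  shows "law (x, x) A = measure (path_law I (P x) X) (diag A)"
proof -
  interpret prob_space "Q (x, x)" by (rule W.prob_space_P)
  have "measure (Q (x, x)) {\<omega> \<in> space N'. (\<lambda>t\<in>I. W' t \<omega>) \<in> A}
    = measure (Q (x, x)) {\<omega> \<in> space N'. (\<lambda>s\<in>I. (U s \<omega>, U s \<omega>)) \<in> A}"
  proof (rule finite_measure_eq_AE)
    show "AE \<omega> in Q (x, x). \<omega> \<in> {\<omega> \<in> space N'. (\<lambda>t\<in>I. W' t \<omega>) \<in> A} \<longleftrightarrow> \<omega> \<in> {\<omega> \<in> space N'. (\<lambda>s\<in>I. (U s \<omega>, U s \<omega>)) \<in> A}"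
      using W.start[of "(x, x)"]
    proof eventually_elim
      case (elim \<omega>)
      have "V' s \<omega> = U s \<omega>" if "0 \<le> s" for s
      proof (cases "s = 0")
        case True then show ?thesis using elim by (simp add: V'_def)
      next
        case False
        then have "met (\<lambda>s. W s \<omega>) s" using elim that by (intro met_start) auto
        then show ?thesis by (simp add: V'_def)
      qed
      then have "(\<lambda>t\<in>I. W' t \<omega>) = (\<lambda>s\<in>I. (U s \<omega>, U s \<omega>))" by (intro restrict_ext) simp
      then show ?case by simp
    qed
  qed (auto intro!: path_event_sets A W'm measurable_Pair_borel Um simp: W.sets_P)
  then show ?thesis by (simp add: law_event[OF A] UU_event[OF A])
qed

text \<open>\<open>B\<close> is cut along the event \<open>S\<close> of having met by time
  \<open>t\<close>. Off \<open>S\<close> the two pairs still agree at \<open>t\<close>, and by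
  \<open>AE_met_shift\<close> the future of \<open>W'\<close> is the coalesced future of
  \<open>W\<close>. On \<open>S\<close> the future is the doubled path of \<open>U\<close>. In both
  cases the Markov property of the original coupling applies to a suitable event
  \<open>A'\<close>.\<close>

lemma W'_markov_integral:
  assumes t: "0 \<le> t" and A: "A \<in> sets (paths I)" and B: "B \<in> sets (G t)"
  shows "measure (Q z) (B \<inter> {\<omega> \<in> space N'. (\<lambda>s\<in>I. W' (t + s) \<omega>) \<in> A}) = (\<integral>\<omega>. indicator B \<omega> * law (W' t \<omega>) A \<partial>Q z)"
proof -
  interpret prob_space "Q z" by (rule W.prob_space_P)
  define E where "E = {\<omega> \<in> space N'. (\<lambda>s\<in>I. W' (t + s) \<omega>) \<in> A}"
  define S where "S = {\<omega> \<in> space N'. met (\<lambda>s. W s \<omega>) t}"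
  have S: "S \<in> sets (G t)" using met_adapted[of t] by (simp add: S_def pred_def)
  have GQ: "C \<in> sets (Q z)" if "C \<in> sets (G t)" for C
    using that sub_G[OF t] by (auto simp: subalgebra_def W.sets_P)
  have E: "E \<in> sets (Q z)" unfolding E_def W.sets_P
    using t by (intro path_event_sets A W'm) simp
  have tI: "t \<in> I" "\<And>s. s \<in> I \<Longrightarrow> t + s \<in> I" using t by auto
  have law_int: "integrable (Q z) (\<lambda>\<omega>. indicator C \<omega> * law (W' t \<omega>) A)" if "C \<in> sets (G t)" for C
  proof (rule integrable_const_bound[where B = 1])
    show "(\<lambda>\<omega>. indicator C \<omega> * law (W' t \<omega>) A) \<in> borel_measurable (Q z)"
      using GQ[OF that] measurable_compose[OF Q_meas[OF W'm[OF t]] law_meas[OF A]] by measurable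
  qed (use law_01 in \<open>auto simp: indicator_def\<close>)
  have 1: "measure (Q z) ((B - S) \<inter> E) = (\<integral>\<omega>. indicator (B - S) \<omega> * law (W' t \<omega>) A \<partial>Q z)"
  proof -
    define A' :: "(real \<Rightarrow> 'e \<times> 'e) set" where "A' = \<Psi> -` A \<inter> space (paths I)"
    have A': "A' \<in> sets (paths I :: (real \<Rightarrow> 'e \<times> 'e) measure)" unfolding A'_def by (rule \<Psi>_sets[OF A])
    have BS: "B - S \<in> sets (G t)" using B S by simp
    have "measure (Q z) ((B - S) \<inter> E) = measure (Q z) ((B - S) \<inter> {\<omega> \<in> space N'. (\<lambda>s\<in>I. W (t + s) \<omega>) \<in> A'})"
    proof (rule finite_measure_eq_AE)
      show "AE \<omega> in Q z. \<omega> \<in> (B - S) \<inter> E \<longleftrightarrow> \<omega> \<in> (B - S) \<inter> {\<omega> \<in> space N'. (\<lambda>s\<in>I. W (t + s) \<omega>) \<in> A'}"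
        using AE_met_shift[OF t, of z] AE_space
      proof eventually_elim
        case (elim \<omega>)
        show ?case
        proof (cases "\<omega> \<in> S")
          case False
          then have nm: "\<not> met (\<lambda>s. W s \<omega>) t" using elim(2) by (simp add: S_def W.space_P)
          have "W' (t + s) \<omega> = merge (\<lambda>s. W (t + s) \<omega>) s" if "0 \<le> s" for s
            using elim(1)[rule_format, OF that] nm by (simp add: V'_def merge_def)
          moreover have "merge (\<lambda>s\<in>I. W (t + s) \<omega>) s = merge (\<lambda>s. W (t + s) \<omega>) s" if "0 \<le> s" for s
            using that met_cong[of s "\<lambda>s\<in>I. W (t + s) \<omega>" "\<lambda>s. W (t + s) \<omega>"] by (simp add: merge_def)
          ultimately have "(\<lambda>s\<in>I. W' (t + s) \<omega>) = \<Psi> (\<lambda>s\<in>I. W (t + s) \<omega>)"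
            unfolding \<Psi>_def by (intro restrict_ext) auto
          then show ?thesis using restrict_in_paths by (auto simp: E_def A'_def)
        qed auto
      qed
      show "(B - S) \<inter> E \<in> events" using GQ[OF BS] E by auto
      show "(B - S) \<inter> {\<omega> \<in> space N'. (\<lambda>s\<in>I. W (t + s) \<omega>) \<in> A'} \<in> events"
        using GQ[OF BS] t by (auto simp: W.sets_P intro!: sets.Int path_event_sets A' Wm)
    qed
    also have "\<dots> = (\<integral>\<omega>. indicator (B - S) \<omega> * measure (path_law I (Q (W t \<omega>)) W) A' \<partial>Q z)"
      by (rule W.markov_integral[OF tI A' BS])
    also have "\<dots> = (\<integral>\<omega>. indicator (B - S) \<omega> * law (W' t \<omega>) A \<partial>Q z)"
    proof (rule Bochner_Integration.integral_cong[OF refl])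
      fix \<omega> assume "\<omega> \<in> space (Q z)"
      then show "indicator (B - S) \<omega> * measure (path_law I (Q (W t \<omega>)) W) A' = indicator (B - S) \<omega> * law (W' t \<omega>) A"
        by (auto simp: indicator_def S_def V'_def law_eq[OF A] A'_def W.space_P)
    qed
    finally show ?thesis .
  qed
  have 2: "measure (Q z) ((B \<inter> S) \<inter> E) = (\<integral>\<omega>. indicator (B \<inter> S) \<omega> * law (W' t \<omega>) A \<partial>Q z)"
  proof -
    define A' :: "(real \<Rightarrow> 'e \<times> 'e) set" where "A' = {p \<in> space (paths I). (\<lambda>s\<in>I. (fst (p s), fst (p s))) \<in> A}"
    have A': "A' \<in> sets (paths I :: (real \<Rightarrow> 'e \<times> 'e) measure)"
    proof -
      have "(\<lambda>p. \<lambda>s\<in>I. (fst (p s), fst (p s))) \<in> (paths I :: (real \<Rightarrow> 'e \<times> 'e) measure) \<rightarrow>\<^sub>M (paths I :: (real \<Rightarrow> 'e \<times> 'e) measure)"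
        by (intro measurable_restrict measurable_Pair_borel measurable_compose[OF coord measurable_fst_borel]) auto
      from measurable_sets[OF this A] show ?thesis by (simp add: A'_def vimage_def Int_def conj_commute)
    qed
    have BS: "B \<inter> S \<in> sets (G t)" using B S by simp
    have "(B \<inter> S) \<inter> E = (B \<inter> S) \<inter> {\<omega> \<in> space N'. (\<lambda>s\<in>I. W (t + s) \<omega>) \<in> A'}"
    proof -
      have "(\<lambda>s\<in>I. W' (t + s) \<omega>) = (\<lambda>s\<in>I. (U (t + s) \<omega>, U (t + s) \<omega>))" if "\<omega> \<in> S" for \<omega>
      proof (intro restrict_ext)
        fix s :: real assume "s \<in> I"
        then have "met (\<lambda>s. W s \<omega>) (t + s)" using that met_mono[of _ t "t + s"] by (auto simp: S_def)
        then show "W' (t + s) \<omega> = (U (t + s) \<omega>, U (t + s) \<omega>)" by (simp add: V'_def)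
      qed
      moreover have "(\<lambda>s\<in>I. (fst ((\<lambda>s\<in>I. W (t + s) \<omega>) s), fst ((\<lambda>s\<in>I. W (t + s) \<omega>) s))) = (\<lambda>s\<in>I. (U (t + s) \<omega>, U (t + s) \<omega>))" for \<omega>
        by (intro restrict_ext) auto
      ultimately show ?thesis
        unfolding E_def A'_def using restrict_in_paths by auto
    qed
    then have "measure (Q z) ((B \<inter> S) \<inter> E) = measure (Q z) ((B \<inter> S) \<inter> {\<omega> \<in> space N'. (\<lambda>s\<in>I. W (t + s) \<omega>) \<in> A'})"
      by simp
    also have "\<dots> = (\<integral>\<omega>. indicator (B \<inter> S) \<omega> * measure (path_law I (Q (W t \<omega>)) W) A' \<partial>Q z)"
      by (rule W.markov_integral[OF tI A' BS])
    also have "\<dots> = (\<integral>\<omega>. indicator (B \<inter> S) \<omega> * law (W' t \<omega>) A \<partial>Q z)"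
    proof (rule Bochner_Integration.integral_cong[OF refl])
      fix \<omega> assume "\<omega> \<in> space (Q z)"
      \<comment> \<open>The second coordinate of the uncoalesced pair drops out: the doubled first
        component has the same law from \<open>(x, y)\<close> as from \<open>(x, x)\<close>.\<close>
      have "measure (path_law I (Q (x, y)) W) A' = law (x, x) A" for x y
      proof -
        have "{\<omega> \<in> space N'. (\<lambda>s\<in>I. W s \<omega>) \<in> A'} = {\<omega> \<in> space N'. (\<lambda>s\<in>I. (U s \<omega>, U s \<omega>)) \<in> A}"
        proof -
          have "(\<lambda>s\<in>I. (fst ((\<lambda>s\<in>I. W s \<omega>) s), fst ((\<lambda>s\<in>I. W s \<omega>) s))) = (\<lambda>s\<in>I. (U s \<omega>, U s \<omega>))" for \<omega>
            by (intro restrict_ext) auto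
          then show ?thesis unfolding A'_def using restrict_in_paths by auto
        qed
        then show ?thesis using lawW_event[OF A', of "(x, y)"] UU_event[OF A, of x y] law_diag[OF A, of x] by simp
      qed
      then show "indicator (B \<inter> S) \<omega> * measure (path_law I (Q (W t \<omega>)) W) A' = indicator (B \<inter> S) \<omega> * law (W' t \<omega>) A"
        by (auto simp: indicator_def S_def V'_def)
    qed
    finally show ?thesis .
  qed
  have BS: "B - S \<in> sets (G t)" "B \<inter> S \<in> sets (G t)" using B S by auto
  have "measure (Q z) (B \<inter> E) = measure (Q z) ((B - S) \<inter> E) + measure (Q z) ((B \<inter> S) \<inter> E)"
  proof -
    have "B \<inter> E = ((B - S) \<inter> E) \<union> ((B \<inter> S) \<inter> E)" by auto
    then show ?thesis
      using finite_measure_Union[of "(B - S) \<inter> E" "(B \<inter> S) \<inter> E"] GQ[OF BS(1)] GQ[OF BS(2)] E by auto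
  qed
  also have "\<dots> = (\<integral>\<omega>. indicator (B - S) \<omega> * law (W' t \<omega>) A + indicator (B \<inter> S) \<omega> * law (W' t \<omega>) A \<partial>Q z)"
    unfolding 1 2 by (rule Bochner_Integration.integral_add[symmetric]) (intro law_int BS)+
  also have "\<dots> = (\<integral>\<omega>. indicator B \<omega> * law (W' t \<omega>) A \<partial>Q z)"
    by (intro Bochner_Integration.integral_cong) (auto simp: indicator_def)
  finally show ?thesis by (simp add: E_def)
qed

text \<open>The Markov property was proved relative to \<open>G\<close>. It passes to the natural
  filtration of \<open>W'\<close>, which is contained in \<open>G\<close> and for which
  \<open>law (W' t \<omega>) A\<close> is already measurable.\<close>

lemma markov_process_W': "markov_process N' I (natural_filtration N' I W') Q W'"
proof (rule markov_process.intro)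
  show "prob_space (Q z)" "sets (Q z) = sets N'" for z by (rule W.prob_space_P W.sets_P)+
  show sub: "subalgebra N' (natural_filtration N' I W' t)" if "t \<in> I" for t
    by (rule subalgebra_natural_filtration) (simp add: W'm)
  show "sets (natural_filtration N' I W' s) \<subseteq> sets (natural_filtration N' I W' t)" if "s \<le> t" for s t
    by (rule natural_filtration_mono[OF that])
  show "(\<lambda>(t, \<omega>). W' t \<omega>) \<in> restrict_space borel I \<Otimes>\<^sub>M N' \<rightarrow>\<^sub>M borel"
  proof -
    have "(\<lambda>p. merge (\<lambda>s. W s (snd p)) (fst p)) \<in> restrict_space borel I \<Otimes>\<^sub>M N' \<rightarrow>\<^sub>M borel"
    proof (rule measurable_merge)
      show "fst \<in> borel_measurable (restrict_space borel I \<Otimes>\<^sub>M N')"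
        by (rule measurable_compose[OF measurable_fst measurable_restrict_space1]) simp
      show "(\<lambda>p. W r (snd p)) \<in> restrict_space borel I \<Otimes>\<^sub>M N' \<rightarrow>\<^sub>M borel" if "0 \<le> r" for r
        by (rule measurable_compose[OF measurable_snd Wm[OF that]])
      show "(\<lambda>p. W (fst p) (snd p)) \<in> restrict_space borel I \<Otimes>\<^sub>M N' \<rightarrow>\<^sub>M borel"
        using W.measurable_X by (simp add: split_def)
    qed
    then show ?thesis unfolding W'_merge by (simp add: split_def)
  qed
  show "W' t \<in> natural_filtration N' I W' t \<rightarrow>\<^sub>M borel" if "t \<in> I" for t
    using natural_filtration_adapted[OF that order_refl, of W' N'] .
  show "AE \<omega> in Q z. W' 0 \<omega> = z" for z
    using W.start[of z] by eventually_elim (simp add: V'_def)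
  show "(\<lambda>z. measure (path_law I (Q z) W') A) \<in> borel_measurable borel" if "A \<in> sets (paths I)" for A
    using law_meas[OF that] by (simp add: law_def)
  fix z t and A :: "(real \<Rightarrow> 'e \<times> 'e) set" assume t: "t \<in> I" and A: "A \<in> sets (paths I)"
  interpret prob_space "Q z" by (rule W.prob_space_P)
  have t0: "0 \<le> t" using t by simp
  have "AE \<omega> in Q z. real_cond_exp (Q z) (natural_filtration N' I W' t) (indicator {\<omega> \<in> space N'. (\<lambda>s\<in>I. W' (t + s) \<omega>) \<in> A}) \<omega> = law (W' t \<omega>) A"
  proof (rule markov_from_integral)
    show "subalgebra (Q z) (natural_filtration N' I W' t)"
      using sub[OF t] by (simp add: subalgebra_def W.sets_P W.space_P)
    show "{\<omega> \<in> space N'. (\<lambda>s\<in>I. W' (t + s) \<omega>) \<in> A} \<in> events"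
      unfolding W.sets_P using t0 by (intro path_event_sets A W'm) simp
    show "(\<lambda>\<omega>. law (W' t \<omega>) A) \<in> borel_measurable (natural_filtration N' I W' t)"
      by (rule measurable_compose[OF natural_filtration_adapted[OF t order_refl, of W' N'] law_meas[OF A]])
    show "0 \<le> law (W' t \<omega>) A \<and> law (W' t \<omega>) A \<le> 1" for \<omega> by (rule law_01)
    fix B assume "B \<in> sets (natural_filtration N' I W' t)"
    moreover have "sets (natural_filtration N' I W' t) \<subseteq> sets (G t)"
      by (rule sets_natural_filtration_subset) (auto intro: W'a)
    ultimately show "measure (Q z) (B \<inter> {\<omega> \<in> space N'. (\<lambda>s\<in>I. W' (t + s) \<omega>) \<in> A}) = (\<integral>\<omega>. indicator B \<omega> * law (W' t \<omega>) A \<partial>Q z)"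
      by (intro W'_markov_integral[OF t0 A]) auto
  qed
  then show "AE \<omega> in Q z. real_cond_exp (Q z) (natural_filtration N' I W' t) (indicator {\<omega> \<in> space N'. (\<lambda>s\<in>I. W' (t + s) \<omega>) \<in> A}) \<omega>
    = measure (path_law I (Q (W' t \<omega>)) W') A"
    by (simp add: law_def)
qed

section \<open>The law of the second component after coalescence\<close>

text \<open>One and the same \<open>\<psi>\<close> serves both components, because both marginals
  are laws of \<open>X\<close>. Hence the two conditional probabilities agree wherever
  \<open>U s = V s\<close>.\<close>

lemma AE_cond_exp_component:
  assumes s: "0 \<le> s" "s \<le> t" and B: "B \<in> sets borel"
  defines "\<psi> \<equiv> \<lambda>x. measure (path_law I (P x) X) {p \<in> space (paths I). p (t - s) \<in> B}"
  shows "AE \<omega> in Q z. real_cond_exp (Q z) (G s) (indicator {\<omega> \<in> space N'. U t \<omega> \<in> B}) \<omega> = \<psi> (U s \<omega>)"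
    and "AE \<omega> in Q z. real_cond_exp (Q z) (G s) (indicator {\<omega> \<in> space N'. V t \<omega> \<in> B}) \<omega> = \<psi> (V s \<omega>)"
proof -
  have ev: "{p \<in> space (paths I). h (p (t - s)) \<in> B} \<in> sets (paths I)" if "h \<in> borel \<rightarrow>\<^sub>M borel"
    for h :: "'b::topological_space \<Rightarrow> 'e"
    using measurable_sets[OF measurable_compose[OF coord that] B] s
    by (simp add: vimage_def Int_def conj_commute)
  have evX: "{p \<in> space (paths I). p (t - s) \<in> B} \<in> sets (paths I :: (real \<Rightarrow> 'e) measure)"
    using ev[of "\<lambda>x. x"] by simp
  have *: "AE \<omega> in Q z. real_cond_exp (Q z) (G s) (indicator {\<omega> \<in> space N'. h (W t \<omega>) \<in> B}) \<omega>
      = measure (Q (W s \<omega>)) {\<omega> \<in> space N'. h (W (t - s) \<omega>) \<in> B}" if h: "h \<in> borel \<rightarrow>\<^sub>M borel" for h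
  proof -
    have r: "(\<lambda>u\<in>I. w u) (t - s) = w (t - s)" for w :: "real \<Rightarrow> 'e \<times> 'e" using s by simp
    show ?thesis
      using W.markov[of s "{p \<in> space (paths I). h (p (t - s)) \<in> B}" z, OF _ ev[OF h]] s restrict_in_paths
      by (simp add: lawW_event[OF ev[OF h]] r)
  qed
  show "AE \<omega> in Q z. real_cond_exp (Q z) (G s) (indicator {\<omega> \<in> space N'. U t \<omega> \<in> B}) \<omega> = \<psi> (U s \<omega>)"
    using *[OF measurable_fst_borel] law_U_event[OF evX] s
    by (simp add: \<psi>_def)
  show "AE \<omega> in Q z. real_cond_exp (Q z) (G s) (indicator {\<omega> \<in> space N'. V t \<omega> \<in> B}) \<omega> = \<psi> (V s \<omega>)"
    using *[OF measurable_snd_borel] law_V_event[OF evX] s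
    by (simp add: \<psi>_def)
qed

lemma AE_met_0: "AE \<omega> in Q z. \<forall>t\<ge>0. met (\<lambda>s. W s \<omega>) t \<longleftrightarrow> \<not> apart 0 t \<omega>"
  using AE_met_iff[of 0 z] by simp

text \<open>Having met is almost surely the same as not being apart, so replacing \<open>V\<close>
  by \<open>U\<close> changes the indicator of \<open>B\<close> by \<open>h\<close> on that event.
  On the diagonal \<open>h\<close> has conditional expectation 0, and
  \<open>expectation_not_apart\<close> shows that the change averages to 0.\<close>

lemma V'_marginal:
  assumes t: "0 \<le> t" and B: "B \<in> sets borel"
  shows "measure (Q z) {\<omega> \<in> space N'. V' t \<omega> \<in> B} = measure (Q z) {\<omega> \<in> space N'. V t \<omega> \<in> B}"
proof -
  interpret prob_space "Q z" by (rule W.prob_space_P)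
  define u v v' where "u = {\<omega> \<in> space N'. U t \<omega> \<in> B}" and "v = {\<omega> \<in> space N'. V t \<omega> \<in> B}" and "v' = {\<omega> \<in> space N'. V' t \<omega> \<in> B}"
  have sets: "u \<in> events" "v \<in> events" "v' \<in> events"
    using measurable_sets[OF Um[OF t] B] measurable_sets[OF Vm[OF t] B] measurable_sets[OF V'm[OF t] B]
    by (auto simp: u_def v_def v'_def W.sets_P vimage_def Int_def conj_commute)
  have ind: "integrable (Q z) (indicator C :: _ \<Rightarrow> real)" if "C \<in> events" for C
    by (rule integrable_const_bound[where B = 1]) (use that in auto)
  define h :: "'v \<Rightarrow> real" where "h \<omega> = indicator u \<omega> - indicator v \<omega>" for \<omega>
  have h: "h \<in> borel_measurable (Q z)" unfolding h_def using sets by measurable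
  have 0: "(\<integral>\<omega>. h \<omega> * of_bool (\<not> apart 0 t \<omega>) \<partial>Q z) = 0"
  proof (rule expectation_not_apart[OF t h])
    show "\<bar>h \<omega>\<bar> \<le> 1" for \<omega> by (simp add: h_def indicator_def)
    fix s assume "s \<in> {0..t}"
    then have s: "0 \<le> s" "s \<le> t" by auto
    interpret sub: sigma_finite_subalgebra "Q z" "G s" using W.sigma_finite_sub_P[of s z] s by simp
    have "AE \<omega> in Q z. real_cond_exp (Q z) (G s) h \<omega> = real_cond_exp (Q z) (G s) (indicator u) \<omega> - real_cond_exp (Q z) (G s) (indicator v) \<omega>"
      unfolding h_def using ind sets by (intro sub.real_cond_exp_diff)
    then show "AE \<omega> in Q z. U s \<omega> = V s \<omega> \<longrightarrow> real_cond_exp (Q z) (G s) h \<omega> = 0"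
      using AE_cond_exp_component(1)[OF s B, of z, folded u_def] AE_cond_exp_component(2)[OF s B, of z, folded v_def]
      by eventually_elim simp
  qed
  have "AE \<omega> in Q z. indicator v' \<omega> = indicator v \<omega> + h \<omega> * of_bool (\<not> apart 0 t \<omega>)"
    using AE_met_0[of z] AE_space
    by eventually_elim (use t in \<open>auto simp: h_def u_def v_def v'_def V'_def indicator_def W.space_P\<close>)
  then have eq: "AE \<omega> in Q z. h \<omega> * of_bool (\<not> apart 0 t \<omega>) = indicator v' \<omega> - indicator v \<omega>"
    by eventually_elim simp
  have "(\<integral>\<omega>. indicator v' \<omega> - indicator v \<omega> \<partial>Q z) = (0 :: real)"
  proof -
    have "(\<lambda>\<omega>. h \<omega> * of_bool (\<not> apart 0 t \<omega>)) \<in> borel_measurable (Q z)"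
    proof -
      obtain \<tau> where "contracting_process (Q z) G fd gd \<tau> dbar (dist (fst z) (snd z)) rd R lam" using contracting by blast
      then interpret c: contracting_process "Q z" G fd gd \<tau> dbar "dist (fst z) (snd z)" rd R lam .
      have [measurable]: "Measurable.pred (Q z) (apart 0 t)" unfolding apart_def by (rule c.free_meas)
      show ?thesis using h by measurable
    qed
    then show ?thesis using 0 sets by (subst integral_cong_AE[OF _ _ eq, symmetric]) auto
  qed
  then have "measure (Q z) v' - measure (Q z) v = 0"
    using ind sets by (subst (asm) Bochner_Integration.integral_diff) auto
  then show ?thesis by (simp add: v_def v'_def)
qed

lemma distr_V': "0 \<le> t \<Longrightarrow> distr (Q (x, y)) borel (V' t) = distr (P y) borel (X t)"
proof -
  assume t: "0 \<le> t"
  interpret Qp: prob_space "Q (x, y)" by (rule W.prob_space_P)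
  interpret Pp: prob_space "P y" by (rule X.prob_space_P)
  have mV': "V' t \<in> Q (x, y) \<rightarrow>\<^sub>M borel" using Q_meas[OF V'm[OF t]] .
  have mX: "X t \<in> P y \<rightarrow>\<^sub>M borel" using X.X_meas_P[of t y] t by simp
  show ?thesis
  proof (rule measure_eqI)
    fix B assume "B \<in> sets (distr (Q (x, y)) borel (V' t))"
    then have B: "B \<in> sets borel" by simp
    have ev: "{p \<in> space (paths I). p t \<in> B} \<in> sets (paths I :: (real \<Rightarrow> 'e) measure)"
      using measurable_sets[OF coord[OF t] B] by (simp add: vimage_def Int_def conj_commute)
    have "measure (Q (x, y)) (V' t -` B \<inter> space (Q (x, y))) = measure (Q (x, y)) {\<omega> \<in> space N'. V t \<omega> \<in> B}"
      using V'_marginal[OF t B] by (simp add: vimage_def Int_def conj_commute W.space_P)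
    also have "\<dots> = measure (path_law I (P y) X) {p \<in> space (paths I). p t \<in> B}"
      using law_V_event[OF ev, of x y] t restrict_in_paths by simp
    also have "\<dots> = measure (P y) (X t -` B \<inter> space (P y))"
      using measure_path_law[of I X "P y", OF X.X_meas_P ev] t restrict_in_paths
      by (simp add: vimage_def Int_def conj_commute)
    finally show "emeasure (distr (Q (x, y)) borel (V' t)) B = emeasure (distr (P y) borel (X t)) B"
      using B mV' mX by (simp add: emeasure_distr Qp.emeasure_eq_measure Pp.emeasure_eq_measure)
  qed simp
qed

definition cyl :: "real set \<Rightarrow> (real \<Rightarrow> 'e set) \<Rightarrow> (real \<Rightarrow> 'e) set" where
  "cyl J A = {p \<in> space (paths I). \<forall>j\<in>J. p j \<in> A j}"

lemma cyl_sets: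
  assumes "finite J" "J \<subseteq> I" "\<And>j. j \<in> J \<Longrightarrow> A j \<in> sets borel"
  shows "cyl J A \<in> sets (paths I)"
proof -
  have "{p \<in> space (paths I). p j \<in> A j} \<in> sets (paths I)" if "j \<in> J" for j
    using measurable_sets[OF coord[of j] assms(3)[OF that]] that assms(2)
    by (auto simp: vimage_def Int_def conj_commute)
  then show ?thesis unfolding cyl_def using assms(1) by (intro sets.sets_Collect_finite_All) auto
qed

text \<open>\<open>V'\<close> is not yet known to be Markov by itself, only the pair
  \<open>W'\<close> is. Induction on the number of times, for all starting points, splits off the
  smallest time \<open>s\<close>: the later times are governed by the law of the pair from
  \<open>W' s\<close>, which by induction depends on \<open>V' s\<close> only, and the law of
  \<open>V' s\<close> is right by \<open>distr_V'\<close>.\<close>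

lemma cylinder_law:
  assumes "finite J" "J \<subseteq> I" "\<And>j. j \<in> J \<Longrightarrow> A j \<in> sets borel"
  shows "measure (Q (x, y)) {\<omega> \<in> space N'. (\<lambda>t\<in>I. V' t \<omega>) \<in> cyl J A} = measure (P y) {\<omega> \<in> space N. (\<lambda>t\<in>I. X t \<omega>) \<in> cyl J A}"
  using assms
proof (induction "card J" arbitrary: J A x y rule: less_induct)
  case less
  interpret Qp: prob_space "Q (x, y)" by (rule W.prob_space_P)
  interpret Pp: prob_space "P y" by (rule X.prob_space_P)
  show ?case
  proof (cases "J = {}")
    case True
    then have "cyl J A = space (paths I)" by (simp add: cyl_def)
    then show ?thesis using restrict_in_paths Qp.prob_space Pp.prob_space by (simp add: W.space_P X.space_P)
  next
    case False
    define s where "s = Min J"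
    have s: "s \<in> J" "\<And>j. j \<in> J \<Longrightarrow> s \<le> j" using False less.prems(1) by (auto simp: s_def)
    then have s0: "0 \<le> s" and sI: "s \<in> I" using less.prems(2) by auto
    \<comment> \<open>Removing \<open>s\<close> before shifting makes the index set strictly
      smaller, also when \<open>s\<close> is 0.\<close>
    define J' where "J' = (\<lambda>j. j - s) ` (J - {s})"
    define A' where "A' j = A (s + j)" for j
    have J': "finite J'" "J' \<subseteq> I" "card J' < card J" "\<And>j. j \<in> J' \<Longrightarrow> A' j \<in> sets borel"
    proof -
      show "finite J'" using less.prems(1) by (simp add: J'_def)
      show "J' \<subseteq> I" using s by (auto simp: J'_def)
      have "card J' \<le> card (J - {s})" unfolding J'_def by (rule card_image_le) (use less.prems(1) in simp)
      also have "\<dots> < card J" using s less.prems(1) by (intro card_Diff1_less)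
      finally show "card J' < card J" .
      show "A' j \<in> sets borel" if "j \<in> J'" for j using that less.prems(3) by (auto simp: J'_def A'_def)
    qed
    have C': "cyl J' A' \<in> sets (paths I)" by (rule cyl_sets) (use J' in auto)
    define cl where "cl v = measure (path_law I (P v) X) (cyl J' A')" for v
    have clm: "cl \<in> borel_measurable borel" unfolding cl_def by (rule X.measurable_law[OF C'])
    have cl_eq: "cl v = measure (P v) {\<omega> \<in> space N. (\<lambda>t\<in>I. X t \<omega>) \<in> cyl J' A'}" for v
      unfolding cl_def using measure_path_law[of I X "P v", OF X.X_meas_P C'] by (simp add: X.space_P)
    have split: "(\<lambda>t\<in>I. Y t) \<in> cyl J A \<longleftrightarrow> Y s \<in> A s \<and> (\<lambda>t\<in>I. Y (s + t)) \<in> cyl J' A'" for Y :: "real \<Rightarrow> 'e"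
    proof -
      have "(\<forall>j\<in>J. Y j \<in> A j) \<longleftrightarrow> Y s \<in> A s \<and> (\<forall>j\<in>J'. Y (s + j) \<in> A' j)"
        using s(1) by (auto simp: J'_def A'_def)
      moreover have "(\<forall>j\<in>J. (\<lambda>t\<in>I. Y t) j \<in> A j) \<longleftrightarrow> (\<forall>j\<in>J. Y j \<in> A j)"
        using less.prems(2) by (intro ball_cong) auto
      moreover have "(\<forall>j\<in>J'. (\<lambda>t\<in>I. Y (s + t)) j \<in> A' j) \<longleftrightarrow> (\<forall>j\<in>J'. Y (s + j) \<in> A' j)"
        using J'(2) by (intro ball_cong) auto
      ultimately show ?thesis unfolding cyl_def using restrict_in_paths by simp
    qed
    have As: "A s \<in> sets borel" using less.prems(3) s by simp
    have "measure (P y) {\<omega> \<in> space N. (\<lambda>t\<in>I. X t \<omega>) \<in> cyl J A} = (\<integral>v. indicator (A s) v * cl v \<partial>distr (P y) borel (X s))"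
    proof -
      define B where "B = {\<omega> \<in> space N. X s \<omega> \<in> A s}"
      have B: "B \<in> sets (F s)"
        using measurable_sets[OF X.adapted_X[OF sI] As] X.subalgebra_F[OF sI]
        by (simp add: B_def vimage_def Int_def conj_commute subalgebra_def)
      have "{\<omega> \<in> space N. (\<lambda>t\<in>I. X t \<omega>) \<in> cyl J A} = B \<inter> {\<omega> \<in> space N. (\<lambda>t\<in>I. X (s + t) \<omega>) \<in> cyl J' A'}"
        using split by (auto simp: B_def)
      then have "measure (P y) {\<omega> \<in> space N. (\<lambda>t\<in>I. X t \<omega>) \<in> cyl J A} = (\<integral>\<omega>. indicator B \<omega> * cl (X s \<omega>) \<partial>P y)"
        using X.markov_integral[OF sI _ C' B, of y] s0 by (simp add: cl_def)
      also have "\<dots> = (\<integral>\<omega>. indicator (A s) (X s \<omega>) * cl (X s \<omega>) \<partial>P y)"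
        by (intro Bochner_Integration.integral_cong) (auto simp: B_def indicator_def X.space_P)
      also have "\<dots> = (\<integral>v. indicator (A s) v * cl v \<partial>distr (P y) borel (X s))"
        by (rule integral_distr[symmetric]) (use X.X_meas_P[OF sI] As clm in auto)
      finally show ?thesis .
    qed
    moreover have "measure (Q (x, y)) {\<omega> \<in> space N'. (\<lambda>t\<in>I. V' t \<omega>) \<in> cyl J A} = (\<integral>v. indicator (A s) v * cl v \<partial>distr (Q (x, y)) borel (V' s))"
    proof -
      define B where "B = {\<omega> \<in> space N'. V' s \<omega> \<in> A s}"
      have "V' s \<in> G s \<rightarrow>\<^sub>M borel" using measurable_compose[OF W'a[OF s0 order_refl] measurable_snd_borel] by simp
      from measurable_sets[OF this As] have B: "B \<in> sets (G s)"
        by (simp add: B_def vimage_def Int_def conj_commute)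
      define D :: "(real \<Rightarrow> 'e \<times> 'e) set" where "D = {p \<in> space (paths I). (\<lambda>t\<in>I. snd (p t)) \<in> cyl J' A'}"
      have D: "D \<in> sets (paths I :: (real \<Rightarrow> 'e \<times> 'e) measure)"
      proof -
        have "(\<lambda>p. \<lambda>s\<in>I. snd (p s)) \<in> (paths I :: (real \<Rightarrow> 'e \<times> 'e) measure) \<rightarrow>\<^sub>M (paths I :: (real \<Rightarrow> 'e) measure)"
          by (intro measurable_restrict measurable_compose[OF coord measurable_snd_borel]) auto
        from measurable_sets[OF this C'] show ?thesis by (simp add: D_def vimage_def Int_def conj_commute)
      qed
      have inD: "(\<lambda>t\<in>I. w t) \<in> D \<longleftrightarrow> (\<lambda>t\<in>I. snd (w t)) \<in> cyl J' A'" for w :: "real \<Rightarrow> 'e \<times> 'e"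
      proof -
        have "(\<lambda>t\<in>I. snd ((\<lambda>t\<in>I. w t) t)) = (\<lambda>t\<in>I. snd (w t))" by (intro restrict_ext) simp
        then show ?thesis unfolding D_def using restrict_in_paths by simp
      qed
      \<comment> \<open>The induction hypothesis from the pair \<open>(u, v)\<close>: the first
        coordinate disappears, so the integrand below is a function of \<open>V' s\<close>
        alone.\<close>
      have lawD: "law (u, v) D = cl v" for u v
      proof -
        have "law (u, v) D = measure (Q (u, v)) {\<omega> \<in> space N'. (\<lambda>t\<in>I. V' t \<omega>) \<in> cyl J' A'}"
          by (simp add: law_event[OF D] inD)
        also have "\<dots> = cl v" unfolding cl_eq by (rule less.hyps) (use J' in auto)
        finally show ?thesis .
      qed
      have "{\<omega> \<in> space N'. (\<lambda>t\<in>I. V' t \<omega>) \<in> cyl J A} = B \<inter> {\<omega> \<in> space N'. (\<lambda>t\<in>I. W' (s + t) \<omega>) \<in> D}"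
        unfolding inD using split by (auto simp: B_def)
      then have "measure (Q (x, y)) {\<omega> \<in> space N'. (\<lambda>t\<in>I. V' t \<omega>) \<in> cyl J A} = (\<integral>\<omega>. indicator B \<omega> * cl (V' s \<omega>) \<partial>Q (x, y))"
        using W'_markov_integral[OF s0 D B, of "(x, y)"] by (simp add: lawD)
      also have "\<dots> = (\<integral>\<omega>. indicator (A s) (V' s \<omega>) * cl (V' s \<omega>) \<partial>Q (x, y))"
        by (intro Bochner_Integration.integral_cong) (auto simp: B_def indicator_def W.space_P)
      also have "\<dots> = (\<integral>v. indicator (A s) v * cl v \<partial>distr (Q (x, y)) borel (V' s))"
        by (rule integral_distr[symmetric]) (use Q_meas[OF V'm[OF s0]] As clm in auto)
      finally show ?thesis .
    qed
    ultimately show ?thesis using distr_V'[OF s0] by simp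
  qed
qed

lemma path_law_V': "path_law I (Q (x, y)) V' = path_law I (P y) X"
proof -
  interpret Qp: prob_space "Q (x, y)" by (rule W.prob_space_P)
  interpret Pp: prob_space "P y" by (rule X.prob_space_P)
  have mV: "(\<lambda>\<omega>. \<lambda>t\<in>I. V' t \<omega>) \<in> Q (x, y) \<rightarrow>\<^sub>M paths I" by (intro measurable_path Q_meas V'm) simp
  have mX: "(\<lambda>\<omega>. \<lambda>t\<in>I. X t \<omega>) \<in> P y \<rightarrow>\<^sub>M paths I" by (intro measurable_path X.X_meas_P)
  show ?thesis
  proof (rule measure_eqI_PiM_infinite)
    show "sets (path_law I (Q (x, y)) V') = sets (paths I)" "sets (path_law I (P y) X) = sets (paths I)"
      by (simp_all add: path_law_def)
    show "finite_measure (path_law I (Q (x, y)) V')"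
      unfolding path_law_def by (rule Qp.finite_measure_distr[OF mV])
    fix A :: "real \<Rightarrow> 'e set" and J assume J: "finite J" "J \<subseteq> I" and A: "\<And>i. i \<in> J \<Longrightarrow> A i \<in> sets (borel :: 'e measure)"
    have emb: "prod_emb I (\<lambda>_. borel) J (Pi\<^sub>E J A) = cyl J A"
      using J by (auto simp: prod_emb_def cyl_def space_PiM PiE_def Pi_def)
    have C: "cyl J A \<in> sets (paths I)" by (rule cyl_sets[OF J A])
    show "emeasure (path_law I (Q (x, y)) V') (prod_emb I (\<lambda>_. borel) J (Pi\<^sub>E J A)) = emeasure (path_law I (P y) X) (prod_emb I (\<lambda>_. borel) J (Pi\<^sub>E J A))"
      unfolding emb path_law_def using cylinder_law[OF J A, where x = x and y = y] C mV mX
      by (simp add: emeasure_distr Qp.emeasure_eq_measure Pp.emeasure_eq_measure vimage_def Int_def conj_commute W.space_P X.space_P)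
  qed
qed

lemma markovian_coupling_V': "markovian_coupling I P X N' Q U V'"
  unfolding markovian_coupling_def using markov_process_W' law_U path_law_V' by simp

text \<open>After meeting, \<open>U\<close> and \<open>V'\<close> coincide and the integrand
  vanishes; before, \<open>V'\<close> is \<open>V\<close>, so the bound for the original coupling
  restricted to paths that are still apart applies.\<close>

lemma contraction:
  assumes t: "0 \<le> t"
  shows "(\<integral>\<omega>. exp (lam * t - (LBINT s:{0..t}. rho (U s \<omega>))) * dist (U t \<omega>) (V' t \<omega>) \<partial>Q (x, y)) \<le> dist x y"
proof -
  obtain \<tau> where "contracting_process (Q (x, y)) G fd gd \<tau> dbar (dist (fst (x, y)) (snd (x, y))) rd R lam" using contracting by blast
  then interpret c: contracting_process "Q (x, y)" G fd gd \<tau> dbar "dist (fst (x, y)) (snd (x, y))" rd R lam .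
  have [measurable]: "Measurable.pred (Q (x, y)) (apart 0 t)" unfolding apart_def by (rule c.free_meas)
  have "(\<lambda>\<omega>. LBINT s:{0..t}. rd s \<omega>) \<in> borel_measurable (Q (x, y))"
    by (rule measurable_section_fst[OF borel_measurable_LBINT_Icc[OF c.r_meas]])
  moreover have "(LBINT s:{0..t}. rd s \<omega>) = (LBINT s:{0..t}. rho (U s \<omega>))" for \<omega>
    by (intro set_lebesgue_integral_cong) (auto simp: rd_def max_def)
  ultimately have [measurable]: "(\<lambda>\<omega>. LBINT s:{0..t}. rho (U s \<omega>)) \<in> borel_measurable (Q (x, y))" by simp
  have [measurable]: "(\<lambda>\<omega>. dist (U t \<omega>) (V t \<omega>)) \<in> borel_measurable (Q (x, y))"
    "(\<lambda>\<omega>. dist (U t \<omega>) (V' t \<omega>)) \<in> borel_measurable (Q (x, y))"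
    using Q_meas[OF measurable_compose[OF Wm[OF t] dist_meas]] Q_meas[OF measurable_compose[OF W'm[OF t] dist_meas]] by simp_all
  have "(\<integral>\<omega>. exp (lam * t - (LBINT s:{0..t}. rho (U s \<omega>))) * dist (U t \<omega>) (V' t \<omega>) \<partial>Q (x, y))
    = (\<integral>\<omega>. exp (lam * t - (LBINT s:{0..t}. rho (U s \<omega>))) * dist (U t \<omega>) (V t \<omega>) * of_bool (apart 0 t \<omega>) \<partial>Q (x, y))"
  proof (rule integral_cong_AE)
    show "AE \<omega> in Q (x, y). exp (lam * t - (LBINT s:{0..t}. rho (U s \<omega>))) * dist (U t \<omega>) (V' t \<omega>)
      = exp (lam * t - (LBINT s:{0..t}. rho (U s \<omega>))) * dist (U t \<omega>) (V t \<omega>) * of_bool (apart 0 t \<omega>)"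
      using AE_met_0[of "(x, y)"] by eventually_elim (use t in \<open>auto simp: V'_def\<close>)
  qed measurable
  then show ?thesis using expectation_apart_le[OF t] by simp
qed

end

section \<open>The proposition\<close>

text \<open>\<open>penalization\<close> selects its form by the test \<open>I = \<nat>\<close>; this
  lets it reduce to the integral form in continuous time.\<close>

lemma atLeast_0_neq_Nats: "{0..} \<noteq> (\<nat> :: real set)"
proof
  assume *: "{0..} = (\<nat> :: real set)"
  have "1 / 2 \<in> {0 :: real..}" by simp
  then have "1 / 2 \<in> (\<nat> :: real set)" unfolding * .
  then obtain n :: nat where "1 / 2 = real n" by (auto elim: Nats_cases)
  then have "real 1 = real (2 * n)" by simp
  then have "1 = 2 * n" by (simp only: of_nat_eq_iff)
  then show False by presburger
qed

lemma penalization_pos: "0 < penalization I \<rho> Y t \<omega>"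
  by (simp add: penalization_def prod_pos)

text \<open>In continuous time measurability is asked of the path clipped at 0, as nothing is known
  about the process at negative times.\<close>

lemma penalization_le:
  fixes \<rho> :: "'e \<Rightarrow> real"
  assumes I: "I = {0..} \<or> I = \<nat>" and t: "t \<in> I"
    and \<rho>: "\<And>x. m \<le> \<rho> x" "\<And>x. \<bar>\<rho> x\<bar> \<le> R"
    and meas: "I = {0..} \<Longrightarrow> (\<lambda>s. \<rho> (Y (max 0 s) \<omega>)) \<in> borel_measurable borel"
  shows "penalization I \<rho> Y t \<omega> \<le> exp (- m * t)"
proof (cases "I = \<nat>")
  case True
  then obtain n :: nat where n: "t = real n" using t by (auto elim: Nats_cases)
  have "(\<Prod>k<n. exp (- \<rho> (Y (real k) \<omega>))) \<le> (\<Prod>k<n. exp (- m))"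
    using \<rho>(1) by (intro prod_mono) auto
  also have "\<dots> = exp (- m * t)" by (simp add: n exp_of_nat_mult[symmetric] mult.commute)
  finally show ?thesis using True by (simp add: penalization_def n)
next
  case False
  with I t have I0: "I = {0..}" and t0: "0 \<le> t" by auto
  have eq: "(LBINT s:{0..t}. \<rho> (Y s \<omega>)) = (LBINT s:{0..t}. \<rho> (Y (max 0 s) \<omega>))"
    by (intro set_lebesgue_integral_cong) (auto simp: max_def)
  have "(LBINT s:{0..t}. m) \<le> (LBINT s:{0..t}. \<rho> (Y (max 0 s) \<omega>))"
  proof (rule set_integral_mono)
    show "set_integrable lborel {0..t} (\<lambda>s. \<rho> (Y (max 0 s) \<omega>))"
      by (rule set_integrable_bounded_Icc[OF meas[OF I0] \<rho>(2)])
  qed (use \<rho>(1) in auto)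
  then have "m * t \<le> (LBINT s:{0..t}. \<rho> (Y s \<omega>))" using t0 by (simp add: eq LBINT_const_Icc)
  then show ?thesis using False by (simp add: penalization_def)
qed

theorem proposition3p1:
  fixes N :: "'w measure"
    and I :: "real set"
    and F :: "real \<Rightarrow> 'w measure"
    and P :: "'e::polish_space \<Rightarrow> 'w measure"
    and X :: "real \<Rightarrow> 'w \<Rightarrow> 'e"
    and \<rho> :: "'e \<Rightarrow> real"
    and dbar K :: real
  assumes "I = {0..} \<or> I = \<nat>"
    and "\<And>x y :: 'e. dist x y \<le> dbar"
    and "\<And>x. 0 \<le> \<rho> x"
    and "K-lipschitz_on UNIV \<rho>"
    and "markov_process N I F P X"
  shows
    "(\<forall>C c \<gamma> \<kappa> (N' :: 'v measure) Q U V.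
        0 < C \<and> 0 < c \<and> 0 < \<gamma> \<and> 0 < \<kappa> \<and>
        (\<forall>t\<in>I. \<forall>x. (\<integral>\<omega>. penalization I \<rho> X t \<omega> \<partial>P x) \<ge> c * exp (- \<kappa> * t)) \<and>
        markovian_coupling I P X N' Q U V \<and>
        (\<forall>t\<in>I. \<forall>x y. (\<integral>\<omega>. dist (U t \<omega>) (V t \<omega>) \<partial>Q (x, y)) \<le> C * exp (- \<gamma> * t) * dist x y) \<and>
        \<gamma> > \<kappa> - (INF x. \<rho> x)
        \<longrightarrow> condition_A TYPE('v) I \<rho> P X (C / c) (\<gamma> - \<kappa> + (INF x. \<rho> x)))
     \<and>
     (I = {0..} \<longrightarrow>
      (\<forall>(N' :: 'v measure) Q U V (Ld :: 'e \<times> 'e \<Rightarrow> real) (\<sigma> :: real).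
        markovian_coupling I P X N' Q U V \<and>
        extended_generator N' Q (\<lambda>t \<omega>. (U t \<omega>, V t \<omega>)) (\<lambda>(x, y). dist x y) Ld \<and>
        ereal \<sigma> = (SUP (x, y)\<in>{(x, y). x \<noteq> y}.
                     ereal (Ld (x, y) / dist x y - \<rho> x + (SUP z. \<rho> z))) \<and>
        \<sigma> < 0
        \<longrightarrow> condition_A TYPE('v) I \<rho> P X 1 (- \<sigma>)))"
proof (intro conjI impI allI; (elim conjE)?)
  define m where "m = (INF x. \<rho> x)"
  define R where "R = (SUP x. \<rho> x)"
  have "K-lipschitz_on UNIV \<rho>" by fact
  then have "continuous_on UNIV \<rho>" by (rule lipschitz_on_continuous_on)
  then have \<rho>m[measurable]: "\<rho> \<in> borel_measurable borel" by (rule borel_measurable_continuous_onI)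
  have K0: "0 \<le> K" by (rule lipschitz_on_nonneg) fact
  \<comment> \<open>A Lipschitz function on a space of bounded diameter is bounded; without this the
    real-valued \<open>INF\<close> and \<open>SUP\<close> of \<open>\<rho>\<close> would carry no
    information.\<close>
  have bdd: "\<rho> x \<le> \<rho> undefined + K * dbar" for x
  proof -
    have "\<bar>\<rho> x - \<rho> undefined\<bar> \<le> K * dist x undefined"
      using lipschitz_onD[OF assms(4), of x undefined] by (simp add: dist_real_def)
    also have "\<dots> \<le> K * dbar" using K0 assms(2) by (intro mult_left_mono)
    finally show ?thesis by linarith
  qed
  have m_le: "m \<le> \<rho> x" for x
    unfolding m_def by (rule cINF_lower[OF bdd_belowI2[of _ 0]]) (use assms(3) in auto)
  have R_ge: "\<rho> x \<le> R" for x
    unfolding R_def by (rule cSUP_upper[OF _ bdd_aboveI2[OF bdd]]) auto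
  have absR: "\<bar>\<rho> x\<bar> \<le> R" for x using assms(3)[of x] R_ge[of x] by simp
  {
    fix C c \<gamma> \<kappa> :: real and N' :: "'v measure" and Q U V
    assume pos: "0 < C" "0 < c" "0 < \<gamma>" "0 < \<kappa>"
      and Z_ge: "\<forall>t\<in>I. \<forall>x. c * exp (- \<kappa> * t) \<le> (\<integral>\<omega>. penalization I \<rho> X t \<omega> \<partial>P x)"
      and mc: "markovian_coupling I P X N' Q U V"
      and contr: "\<forall>t\<in>I. \<forall>x y. (\<integral>\<omega>. dist (U t \<omega>) (V t \<omega>) \<partial>Q (x, y)) \<le> C * exp (- \<gamma> * t) * dist x y"
      and \<gamma>: "\<kappa> - (INF x. \<rho> x) < \<gamma>"
    interpret W: markov_process N' I "natural_filtration N' I (\<lambda>t \<omega>. (U t \<omega>, V t \<omega>))" Q "\<lambda>t \<omega>. (U t \<omega>, V t \<omega>)"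
      using mc by (simp add: markovian_coupling_def)
    have "(\<integral>\<omega>. penalization I \<rho> U t \<omega> / (\<integral>\<omega>'. penalization I \<rho> X t \<omega>' \<partial>P x) * dist (U t \<omega>) (V t \<omega>) \<partial>Q (x, y))
      \<le> C / c * exp (- (\<gamma> - \<kappa> + m) * t) * dist x y" if t: "t \<in> I" for x y t
    proof -
      interpret prob_space "Q (x, y)" by (rule W.prob_space_P)
      define z where "z = (\<integral>\<omega>'. penalization I \<rho> X t \<omega>' \<partial>P x)"
      have z: "c * exp (- \<kappa> * t) \<le> z" using Z_ge t by (simp add: z_def)
      have z0: "0 < c * exp (- \<kappa> * t)" using pos by simp
      have "(\<lambda>p. dist (fst p) (snd p)) \<in> borel_measurable (borel :: ('e \<times> 'e) measure)"
        by (intro borel_measurable_continuous_onI continuous_intros)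
      from measurable_compose[OF W.X_meas_P[OF t] this]
      have dm: "(\<lambda>\<omega>. dist (U t \<omega>) (V t \<omega>)) \<in> borel_measurable (Q (x, y))" by simp
      have di: "integrable (Q (x, y)) (\<lambda>\<omega>. dist (U t \<omega>) (V t \<omega>))"
        by (rule integrable_const_bound[where B = dbar]) (use dm assms(2) in auto)
      have "(\<integral>\<omega>. penalization I \<rho> U t \<omega> / z * dist (U t \<omega>) (V t \<omega>) \<partial>Q (x, y))
        \<le> (\<integral>\<omega>. exp (- m * t) / (c * exp (- \<kappa> * t)) * dist (U t \<omega>) (V t \<omega>) \<partial>Q (x, y))"
      proof (rule integral_mono')
        show "integrable (Q (x, y)) (\<lambda>\<omega>. exp (- m * t) / (c * exp (- \<kappa> * t)) * dist (U t \<omega>) (V t \<omega>))"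
          using di by (rule integrable_mult_right[rotated])
        fix \<omega> assume \<omega>: "\<omega> \<in> space (Q (x, y))"
        have pl: "penalization I \<rho> U t \<omega> \<le> exp (- m * t)"
        proof (rule penalization_le[OF assms(1) t m_le absR])
          assume I0: "I = {0..}"
          have "(\<lambda>s. (max 0 s, \<omega>)) \<in> (borel :: real measure) \<rightarrow>\<^sub>M restrict_space borel I \<Otimes>\<^sub>M N'"
            using \<omega> by (intro measurable_Pair measurable_restrict_space2) (auto simp: I0 W.space_P)
          from measurable_compose[OF measurable_compose[OF this W.measurable_X] measurable_fst_borel]
          have "(\<lambda>s. U (max 0 s) \<omega>) \<in> borel \<rightarrow>\<^sub>M borel" by simp
          then show "(\<lambda>s. \<rho> (U (max 0 s) \<omega>)) \<in> borel_measurable borel" by measurable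
        qed
        show "penalization I \<rho> U t \<omega> / z * dist (U t \<omega>) (V t \<omega>) \<le> exp (- m * t) / (c * exp (- \<kappa> * t)) * dist (U t \<omega>) (V t \<omega>)"
          using pl z z0 penalization_pos[of I \<rho> U t \<omega>] by (intro mult_right_mono frac_le) auto
        show "0 \<le> exp (- m * t) / (c * exp (- \<kappa> * t)) * dist (U t \<omega>) (V t \<omega>)" using pos by simp
      qed
      also have "\<dots> = exp (- m * t) / (c * exp (- \<kappa> * t)) * (\<integral>\<omega>. dist (U t \<omega>) (V t \<omega>) \<partial>Q (x, y))" by simp
      also have "\<dots> \<le> exp (- m * t) / (c * exp (- \<kappa> * t)) * (C * exp (- \<gamma> * t) * dist x y)"
        using contr t pos by (intro mult_left_mono) auto
      also have "\<dots> = C / c * exp (- (\<gamma> - \<kappa> + m) * t) * dist x y"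
      proof -
        have e: "exp (- (\<gamma> - \<kappa> + m) * t) = exp (- m * t) * exp (- \<gamma> * t) / exp (- \<kappa> * t)"
          by (simp add: exp_add[symmetric] exp_diff[symmetric] algebra_simps)
        show ?thesis unfolding e by simp
      qed
      finally show ?thesis by (simp add: z_def)
    qed
    then show "condition_A TYPE('v) I \<rho> P X (C / c) (\<gamma> - \<kappa> + (INF x. \<rho> x))"
      unfolding condition_A_def m_def using pos \<gamma> mc by (intro conjI exI[of _ N'] exI[of _ Q] exI[of _ U] exI[of _ V]) auto
  }
  {
    fix N' :: "'v measure" and Q U V and Ld :: "'e \<times> 'e \<Rightarrow> real" and \<sigma> :: real
    assume I0: "I = {0..}" and mc: "markovian_coupling I P X N' Q U V"
      and eg: "extended_generator N' Q (\<lambda>t \<omega>. (U t \<omega>, V t \<omega>)) (\<lambda>(x, y). dist x y) Ld"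
      and \<sigma>: "ereal \<sigma> = (SUP (x, y)\<in>{(x, y). x \<noteq> y}. ereal (Ld (x, y) / dist x y - \<rho> x + (SUP z. \<rho> z)))"
      and \<sigma>0: "\<sigma> < 0"
    \<comment> \<open>The supremum is extended-valued but equal to the real \<open>\<sigma>\<close>,
      so each member is at most \<open>\<sigma>\<close>; multiplying by the positive distance clears
      the fraction.\<close>
    have Ld_le: "Ld (x, y) \<le> - ((R - \<sigma>) - \<rho> x) * dist x y" if xy: "x \<noteq> y" for x y
    proof -
      have "ereal (Ld (x, y) / dist x y - \<rho> x + R) \<le> ereal \<sigma>"
        unfolding \<sigma> R_def by (rule SUP_upper2[of "(x, y)"]) (use xy in auto)
      then have "Ld (x, y) / dist x y \<le> - ((R - \<sigma>) - \<rho> x)" by simp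
      then show ?thesis using xy by (simp add: pos_divide_le_eq)
    qed
    interpret c: contractive_coupling N F P X N' Q U V Ld \<rho> "R - \<sigma>" R dbar
    proof (rule contractive_coupling.intro)
      show "markov_process N {0..} F P X" "markovian_coupling {0..} P X N' Q U V"
        using assms(5) mc by (simp_all only: I0)
      show "R < R - \<sigma>" using \<sigma>0 by simp
    qed (fact eg assms(2,3) R_ge \<rho>m Ld_le)+
    have pen: "penalization {0..} \<rho> Y t \<omega> = exp (- (LBINT s:{0..t}. \<rho> (Y s \<omega>)))" for Y :: "real \<Rightarrow> 'z \<Rightarrow> 'e" and t \<omega>
      by (simp add: penalization_def atLeast_0_neq_Nats)
    have "(\<integral>\<omega>. penalization I \<rho> U t \<omega> / (\<integral>\<omega>'. penalization I \<rho> X t \<omega>' \<partial>P x) * dist (U t \<omega>) (c.V' t \<omega>) \<partial>Q (x, y))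
      \<le> 1 * exp (- (- \<sigma>) * t) * dist x y" if t: "t \<in> I" for x y t
    proof -
      have t0: "0 \<le> t" using t I0 by simp
      interpret Pp: prob_space "P x" by (rule c.X.prob_space_P)
      define z where "z = (\<integral>\<omega>'. penalization I \<rho> X t \<omega>' \<partial>P x)"
      \<comment> \<open>Since \<open>\<rho>\<close> is at most \<open>R\<close>, the normalising
        expectation is at least \<open>exp (- R * t)\<close>. Measurability of the time integral has
        to be shown first, for otherwise the expectation could be 0 by convention.\<close>
      have z: "exp (- R * t) \<le> z"
      proof -
        have jm: "(\<lambda>(s, \<omega>). \<rho> (X (max 0 s) \<omega>)) \<in> borel_measurable (borel \<Otimes>\<^sub>M N)"
        proof -
          have "(\<lambda>p. (max 0 (fst p), snd p)) \<in> (borel :: real measure) \<Otimes>\<^sub>M N \<rightarrow>\<^sub>M restrict_space borel {0..} \<Otimes>\<^sub>M N"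
            by (intro measurable_Pair measurable_restrict_space2) auto
          from measurable_compose[OF measurable_compose[OF this c.X.measurable_X] \<rho>m]
          show ?thesis by (simp add: split_def)
        qed
        have eq: "(LBINT s:{0..t}. \<rho> (X s \<omega>)) = (LBINT s:{0..t}. \<rho> (X (max 0 s) \<omega>))" for \<omega>
          by (intro set_lebesgue_integral_cong) (auto simp: max_def)
        have "(\<lambda>\<omega>. LBINT s:{0..t}. \<rho> (X s \<omega>)) \<in> borel_measurable N"
          unfolding eq by (rule measurable_section_fst[OF borel_measurable_LBINT_Icc[OF jm]])
        then have [measurable]: "(\<lambda>\<omega>. LBINT s:{0..t}. \<rho> (X s \<omega>)) \<in> borel_measurable (P x)"
          by (simp cong: measurable_cong_sets add: c.X.sets_P)
        have int: "0 \<le> (LBINT s:{0..t}. \<rho> (X s \<omega>)) \<and> (LBINT s:{0..t}. \<rho> (X s \<omega>)) \<le> R * t" if "\<omega> \<in> space (P x)" for \<omega>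
        proof
          show "0 \<le> (LBINT s:{0..t}. \<rho> (X s \<omega>))"
            unfolding set_lebesgue_integral_def using assms(3) by (intro Bochner_Integration.integral_nonneg) (auto simp: indicator_def)
          have "(LBINT s:{0..t}. \<rho> (X (max 0 s) \<omega>)) \<le> (LBINT s:{0..t}. R)"
          proof (rule set_integral_mono)
            show "set_integrable lborel {0..t} (\<lambda>s. \<rho> (X (max 0 s) \<omega>))"
              by (rule set_integrable_bounded_Icc[where C = R])
                (use measurable_section_snd[OF jm] that absR in \<open>auto simp: c.X.space_P\<close>)
          qed (use R_ge in auto)
          then show "(LBINT s:{0..t}. \<rho> (X s \<omega>)) \<le> R * t" using t0 by (simp add: eq LBINT_const_Icc)
        qed
        have "(\<integral>\<omega>. exp (- R * t) \<partial>P x) \<le> z"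
          unfolding z_def I0 pen
        proof (rule integral_mono)
          show "integrable (P x) (\<lambda>\<omega>. exp (- (LBINT s:{0..t}. \<rho> (X s \<omega>))))"
            by (rule Pp.integrable_const_bound[where B = 1]) (use int in auto)
        qed (use int in auto)
        then show ?thesis by (simp add: Pp.prob_space)
      qed
      have z0: "0 < z" using z exp_gt_zero[of "- R * t"] by linarith
      \<comment> \<open>The factor \<open>exp ((R - \<sigma>) * t)\<close> required by
        \<open>contraction\<close> is inserted and its inverse pulled out. Divided by the lower
        bound for \<open>z\<close>, that inverse leaves exactly
        \<open>exp (\<sigma> * t)\<close>.\<close>
      have "(\<integral>\<omega>. penalization I \<rho> U t \<omega> / z * dist (U t \<omega>) (c.V' t \<omega>) \<partial>Q (x, y))
        = (\<integral>\<omega>. (exp (- (R - \<sigma>) * t) / z) * (exp ((R - \<sigma>) * t - (LBINT s:{0..t}. \<rho> (U s \<omega>))) * dist (U t \<omega>) (c.V' t \<omega>)) \<partial>Q (x, y))"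
      proof (intro Bochner_Integration.integral_cong refl)
        fix \<omega>
        have "penalization I \<rho> U t \<omega> = exp (- (R - \<sigma>) * t) * exp ((R - \<sigma>) * t - (LBINT s:{0..t}. \<rho> (U s \<omega>)))"
          unfolding I0 pen by (simp add: exp_add[symmetric] algebra_simps)
        then show "penalization I \<rho> U t \<omega> / z * dist (U t \<omega>) (c.V' t \<omega>)
          = (exp (- (R - \<sigma>) * t) / z) * (exp ((R - \<sigma>) * t - (LBINT s:{0..t}. \<rho> (U s \<omega>))) * dist (U t \<omega>) (c.V' t \<omega>))"
          by simp
      qed
      also have "\<dots> = (exp (- (R - \<sigma>) * t) / z) * (\<integral>\<omega>. exp ((R - \<sigma>) * t - (LBINT s:{0..t}. \<rho> (U s \<omega>))) * dist (U t \<omega>) (c.V' t \<omega>) \<partial>Q (x, y))"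
        by simp
      also have "\<dots> \<le> (exp (- (R - \<sigma>) * t) / exp (- R * t)) * dist x y"
        using c.contraction[OF t0, of x y] z z0 by (intro mult_mono divide_left_mono Bochner_Integration.integral_nonneg) auto
      also have "exp (- (R - \<sigma>) * t) / exp (- R * t) = exp (\<sigma> * t)"
        by (simp add: exp_diff[symmetric] algebra_simps)
      finally show ?thesis by (simp add: z_def)
    qed
    then show "condition_A TYPE('v) I \<rho> P X 1 (- \<sigma>)"
      unfolding condition_A_def using \<sigma>0 c.markovian_coupling_V' I0
      by (intro conjI exI[of _ N'] exI[of _ Q] exI[of _ U] exI[of _ c.V']) auto
  }
qed

end
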